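(* Let $V$ be a finite-dimensional irreducible $\boxtimes$-module over $\mathbb F$. Then there exists a nonzero bilinear form $\langle\,,\rangle$ on $V$ such that $$\langle\xi.u,v\rangle=-\langle u,\xi.v\rangle\qquad\text{for all }\xi\in\boxtimes,\ u,v\in V.$$ This form is unique up to multiplication by a nonzero scalar in $\mathbb F$. The form is nondegenerate. The form is symmetric (resp. antisymmetric) when the diameter of $V$ is even (resp. odd).
   Context: $\mathbb F$ is an algebraically closed field of characteristic $0$, and $\mathbb I=\{0,1,2,3\}$. The tetrahedron algebra $\boxtimes$ is the Lie algebra over $\mathbb F$ with generators $\{x_{ij}\mid i,j\in\mathbb I,\ i\ne j\}$ and relations: (i) $x_{ij}+x_{ji}=0$ for distinct $i,j$; (ii) $[x_{ij},x_{jk}]=2x_{ij}+2x_{jk}$ for mutually distinct $i,j,k$; (iii) $[x_{ij},[x_{ij},[x_{ij},x_{k\ell}]]]=4[x_{ij},x_{k\ell}]$ for mutually distinct $i,j,k,\ell$. Diameter: for a finite-dimensional irreducible $\boxtimes$-module $V$ it is known (Hartwig) that there is an integer $d\ge0$ such that every $x_{ij}$ acts semisimply on $V$ with set of distinct eigenvalues $\{d-2n\mid 0\le n\le d\}$; $d$ is called the diameter of $V$. *)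

theory Defs
  imports
    "HOL-Computational_Algebra.Polynomial"
    "HOL-Library.Numeral_Type"
begin

section \<open>Lie algebras and their modules\<close>

locale lie_algebra = vector_space scale
  for scale :: "'k::field \<Rightarrow> 'l::ab_group_add \<Rightarrow> 'l" +
  fixes bracket :: "'l \<Rightarrow> 'l \<Rightarrow> 'l"
  assumes linear_bracket_right: "Vector_Spaces.linear scale scale (bracket a)"
    and linear_bracket_left: "Vector_Spaces.linear scale scale (\<lambda>a. bracket a b)"
    and bracket_self: "bracket a a = 0"
    and jacobi: "bracket a (bracket b c) + bracket b (bracket c a) + bracket c (bracket a b) = 0"

locale lie_module = L: lie_algebra scaleL bracket + V: vector_space scaleV
  for scaleL :: "'k::field \<Rightarrow> 'l::ab_group_add \<Rightarrow> 'l"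
    and bracket :: "'l \<Rightarrow> 'l \<Rightarrow> 'l"
    and scaleV :: "'k \<Rightarrow> 'v::ab_group_add \<Rightarrow> 'v" +
  fixes act :: "'l \<Rightarrow> 'v \<Rightarrow> 'v"
  assumes linear_act: "Vector_Spaces.linear scaleV scaleV (act a)"
    and linear_act_left: "Vector_Spaces.linear scaleL scaleV (\<lambda>a. act a v)"
    and act_bracket: "act (bracket a b) v = act a (act b v) - act b (act a v)"

definition finite_dimensional :: "('k::field \<Rightarrow> 'v::ab_group_add \<Rightarrow> 'v) \<Rightarrow> bool" where
  "finite_dimensional scale \<longleftrightarrow> (\<exists>B. finite B \<and> module.span scale B = UNIV)"

definition irreducible_action ::
    "('k::field \<Rightarrow> 'v::ab_group_add \<Rightarrow> 'v) \<Rightarrow> ('l \<Rightarrow> 'v \<Rightarrow> 'v) \<Rightarrow> bool" where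
  "irreducible_action scale act \<longleftrightarrow>
     (UNIV :: 'v set) \<noteq> {0} \<and>
     (\<forall>W. module.subspace scale W \<and> (\<forall>a. \<forall>w\<in>W. act a w \<in> W) \<longrightarrow> W = {0} \<or> W = UNIV)"

definition eigenvectors ::
    "('k::field \<Rightarrow> 'v::ab_group_add \<Rightarrow> 'v) \<Rightarrow> ('v \<Rightarrow> 'v) \<Rightarrow> 'k \<Rightarrow> 'v set" where
  "eigenvectors scale T \<theta> = {v. v \<noteq> 0 \<and> T v = scale \<theta> v}"

text \<open>Over an algebraically closed field, semisimple means diagonalizable, i.e. spanned by eigenvectors.\<close>

definition semisimple_map ::
    "('k::field \<Rightarrow> 'v::ab_group_add \<Rightarrow> 'v) \<Rightarrow> ('v \<Rightarrow> 'v) \<Rightarrow> bool" where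
  "semisimple_map scale T \<longleftrightarrow> module.span scale (\<Union>\<theta>. eigenvectors scale T \<theta>) = UNIV"

definition eigenvalues ::
    "('k::field \<Rightarrow> 'v::ab_group_add \<Rightarrow> 'v) \<Rightarrow> ('v \<Rightarrow> 'v) \<Rightarrow> 'k set" where
  "eigenvalues scale T = {\<theta>. eigenvectors scale T \<theta> \<noteq> {}}"


section \<open>The tetrahedron algebra\<close>

text \<open>
  The index set is the four-element type \<open>4\<close>, whose elements are \<open>0, 1, 2, 3\<close>.
  There is one generator for each ordered pair of distinct indices.
\<close>

typedef edge = "{p :: 4 \<times> 4. fst p \<noteq> snd p}"
  by (rule exI[of _ "(0, 1)"]) simp

text \<open>
  The Lie algebra with the given generators and relations is the set of all formal Lie
  expressions in the generators, modulo the least congruence containing the vector space axioms,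
  the Lie algebra axioms and the defining relations.
\<close>

datatype 'k lie_expr =
    Gen edge
  | Zero
  | Plus "'k lie_expr" "'k lie_expr"
  | Scale 'k "'k lie_expr"
  | Brac "'k lie_expr" "'k lie_expr"

abbreviation (input) X :: "4 \<Rightarrow> 4 \<Rightarrow> 'k lie_expr" where
  "X i j \<equiv> Gen (Abs_edge (i, j))"

inductive tet_eq :: "'k::field lie_expr \<Rightarrow> 'k lie_expr \<Rightarrow> bool" where
  refl: "tet_eq a a"
| sym: "tet_eq a b \<Longrightarrow> tet_eq b a"
| trans: "tet_eq a b \<Longrightarrow> tet_eq b c \<Longrightarrow> tet_eq a c"
| cong_plus: "tet_eq a a' \<Longrightarrow> tet_eq b b' \<Longrightarrow> tet_eq (Plus a b) (Plus a' b')"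
| cong_scale: "tet_eq a a' \<Longrightarrow> tet_eq (Scale r a) (Scale r a')"
| cong_brac: "tet_eq a a' \<Longrightarrow> tet_eq b b' \<Longrightarrow> tet_eq (Brac a b) (Brac a' b')"
| plus_assoc: "tet_eq (Plus (Plus a b) c) (Plus a (Plus b c))"
| plus_comm: "tet_eq (Plus a b) (Plus b a)"
| plus_zero: "tet_eq (Plus Zero a) a"
| plus_neg: "tet_eq (Plus (Scale (-1) a) a) Zero"
| scale_right: "tet_eq (Scale r (Plus a b)) (Plus (Scale r a) (Scale r b))"
| scale_left: "tet_eq (Scale (r + s) a) (Plus (Scale r a) (Scale s a))"
| scale_scale: "tet_eq (Scale r (Scale s a)) (Scale (r * s) a)"
| scale_one: "tet_eq (Scale 1 a) a"
| brac_plus_left: "tet_eq (Brac (Plus a b) c) (Plus (Brac a c) (Brac b c))"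
| brac_plus_right: "tet_eq (Brac a (Plus b c)) (Plus (Brac a b) (Brac a c))"
| brac_scale_left: "tet_eq (Brac (Scale r a) b) (Scale r (Brac a b))"
| brac_scale_right: "tet_eq (Brac a (Scale r b)) (Scale r (Brac a b))"
| brac_self: "tet_eq (Brac a a) Zero"
| brac_jacobi:
    "tet_eq (Plus (Plus (Brac a (Brac b c)) (Brac b (Brac c a))) (Brac c (Brac a b))) Zero"
| tet_i: "i \<noteq> j \<Longrightarrow> tet_eq (Plus (X i j) (X j i)) Zero"
| tet_ii: "distinct [i, j, k] \<Longrightarrow>
    tet_eq (Brac (X i j) (X j k)) (Plus (Scale 2 (X i j)) (Scale 2 (X j k)))"
| tet_iii: "distinct [i, j, k, l] \<Longrightarrow>
    tet_eq (Brac (X i j) (Brac (X i j) (Brac (X i j) (X k l)))) (Scale 4 (Brac (X i j) (X k l)))"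

quotient_type (overloaded) 'k tetrahedron = "'k::field lie_expr" / tet_eq
  by (auto intro!: equivpI reflpI sympI transpI intro: tet_eq.refl tet_eq.sym tet_eq.trans)

instantiation tetrahedron :: (field) ab_group_add
begin

lift_definition zero_tetrahedron :: "'a tetrahedron" is Zero .

lift_definition plus_tetrahedron :: "'a tetrahedron \<Rightarrow> 'a tetrahedron \<Rightarrow> 'a tetrahedron"
  is Plus by (rule tet_eq.cong_plus)

lift_definition uminus_tetrahedron :: "'a tetrahedron \<Rightarrow> 'a tetrahedron"
  is "Scale (-1)" by (rule tet_eq.cong_scale)

definition minus_tetrahedron :: "'a tetrahedron \<Rightarrow> 'a tetrahedron \<Rightarrow> 'a tetrahedron" where
  "minus_tetrahedron a b = a + - b"

instance
proof
  fix a b c :: "'a tetrahedron"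
  show "a + b + c = a + (b + c)" by transfer (rule tet_eq.plus_assoc)
  show "a + b = b + a" by transfer (rule tet_eq.plus_comm)
  show "0 + a = a" by transfer (rule tet_eq.plus_zero)
  show "- a + a = 0" by transfer (rule tet_eq.plus_neg)
  show "a - b = a + - b" by (rule minus_tetrahedron_def)
qed

end

lift_definition tet_scale :: "'k::field \<Rightarrow> 'k tetrahedron \<Rightarrow> 'k tetrahedron"
  is Scale by (rule tet_eq.cong_scale)

lift_definition tet_bracket :: "'k::field tetrahedron \<Rightarrow> 'k tetrahedron \<Rightarrow> 'k tetrahedron"
  is Brac by (rule tet_eq.cong_brac)

text \<open>Only meaningful for \<open>i \<noteq> j\<close>.\<close>

lift_definition tet_x :: "4 \<Rightarrow> 4 \<Rightarrow> 'k::field tetrahedron" is "\<lambda>i j. X i j" .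

interpretation tet: vector_space "tet_scale :: 'k::field \<Rightarrow> 'k tetrahedron \<Rightarrow> 'k tetrahedron"
proof
  fix r s :: 'k and a b :: "'k tetrahedron"
  show "tet_scale r (a + b) = tet_scale r a + tet_scale r b"
    by transfer (rule tet_eq.scale_right)
  show "tet_scale (r + s) a = tet_scale r a + tet_scale s a"
    by transfer (rule tet_eq.scale_left)
  show "tet_scale r (tet_scale s a) = tet_scale (r * s) a"
    by transfer (rule tet_eq.scale_scale)
  show "tet_scale 1 a = a"
    by transfer (rule tet_eq.scale_one)
qed

interpretation tet: lie_algebra
  "tet_scale :: 'k::field \<Rightarrow> 'k tetrahedron \<Rightarrow> 'k tetrahedron" tet_bracket
proof
  fix r :: 'k and a b c :: "'k tetrahedron"
  show "tet_bracket a (b + c) = tet_bracket a b + tet_bracket a c"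
    by transfer (rule tet_eq.brac_plus_right)
  show "tet_bracket a (tet_scale r b) = tet_scale r (tet_bracket a b)"
    by transfer (rule tet_eq.brac_scale_right)
  show "tet_bracket (a + b) c = tet_bracket a c + tet_bracket b c"
    by transfer (rule tet_eq.brac_plus_left)
  show "tet_bracket (tet_scale r a) b = tet_scale r (tet_bracket a b)"
    by transfer (rule tet_eq.brac_scale_left)
  show "tet_bracket a a = 0"
    by transfer (rule tet_eq.brac_self)
  show "tet_bracket a (tet_bracket b c) + tet_bracket b (tet_bracket c a)
      + tet_bracket c (tet_bracket a b) = 0"
    by transfer (rule tet_eq.brac_jacobi)
qed

context lie_algebra
begin

definition tet_relations :: "(4 \<Rightarrow> 4 \<Rightarrow> 'l) \<Rightarrow> bool" where
  "tet_relations y \<longleftrightarrow>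
     (\<forall>i j. i \<noteq> j \<longrightarrow> y i j + y j i = 0) \<and>
     (\<forall>i j k. distinct [i, j, k] \<longrightarrow>
        bracket (y i j) (y j k) = scale 2 (y i j) + scale 2 (y j k)) \<and>
     (\<forall>i j k l. distinct [i, j, k, l] \<longrightarrow>
        bracket (y i j) (bracket (y i j) (bracket (y i j) (y k l)))
          = scale 4 (bracket (y i j) (y k l)))"

end

lemma tet_relations_tet_x: "tet.tet_relations (tet_x :: 4 \<Rightarrow> 4 \<Rightarrow> 'k::field tetrahedron)"
  unfolding tet.tet_relations_def
proof (intro conjI allI impI)
  fix i j k l :: 4
  show "tet_x i j + tet_x j i = (0 :: 'k tetrahedron)" if "i \<noteq> j"
    using that by transfer (rule tet_eq.tet_i)
  show "tet_bracket (tet_x i j) (tet_x j k)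
      = tet_scale 2 (tet_x i j) + tet_scale (2::'k) (tet_x j k)" if "distinct [i, j, k]"
    using that by transfer (rule tet_eq.tet_ii)
  show "tet_bracket (tet_x i j) (tet_bracket (tet_x i j) (tet_bracket (tet_x i j) (tet_x k l)))
      = tet_scale (4::'k) (tet_bracket (tet_x i j) (tet_x k l))" if "distinct [i, j, k, l]"
    using that by transfer (rule tet_eq.tet_iii)
qed

text \<open>The universal property of the presentation.\<close>

context lie_algebra
begin

primrec eval_expr :: "(4 \<Rightarrow> 4 \<Rightarrow> 'l) \<Rightarrow> 'k lie_expr \<Rightarrow> 'l" where
  "eval_expr y (Gen e) = (case Rep_edge e of (i, j) \<Rightarrow> y i j)"
| "eval_expr y Zero = 0"
| "eval_expr y (Plus a b) = eval_expr y a + eval_expr y b"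
| "eval_expr y (Scale r a) = scale r (eval_expr y a)"
| "eval_expr y (Brac a b) = bracket (eval_expr y a) (eval_expr y b)"

lemma eval_expr_X: "i \<noteq> j \<Longrightarrow> eval_expr y (X i j) = y i j"
  by (simp add: Abs_edge_inverse)

lemma eval_expr_cong:
  assumes "tet_relations y" "tet_eq a b"
  shows "eval_expr y a = eval_expr y b"
proof -
  note R = assms(1)[unfolded tet_relations_def]
  interpret l: Vector_Spaces.linear scale scale "\<lambda>a. bracket a b" for b
    by (rule linear_bracket_left)
  interpret r: Vector_Spaces.linear scale scale "bracket a" for a
    by (rule linear_bracket_right)
  show ?thesis
    using assms(2)
  proof (induction rule: tet_eq.induct)
    case (tet_i i j)
    then show ?case using R by (simp add: eval_expr_X del: eval_expr.simps(1))
  next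
    case (tet_ii i j k)
    then have "eval_expr y (X i j) = y i j" "eval_expr y (X j k) = y j k"
      by (simp_all add: eval_expr_X del: eval_expr.simps(1))
    with tet_ii R show ?case by (simp del: eval_expr.simps(1))
  next
    case (tet_iii i j k l)
    then have "eval_expr y (X i j) = y i j" "eval_expr y (X k l) = y k l"
      by (simp_all add: eval_expr_X del: eval_expr.simps(1))
    with tet_iii R show ?case by (simp del: eval_expr.simps(1))
  next
    case (brac_jacobi a b c)
    show ?case by (simp add: jacobi)
  qed (simp_all add: bracket_self l.add l.scale r.add r.scale scale_right_distrib
      scale_left_distrib ac_simps)
qed

definition lie_hom_from_tet :: "('k tetrahedron \<Rightarrow> 'l) \<Rightarrow> bool" where
  "lie_hom_from_tet \<phi> \<longleftrightarrow> Vector_Spaces.linear tet_scale scale \<phi> \<and>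
     (\<forall>a b. \<phi> (tet_bracket a b) = bracket (\<phi> a) (\<phi> b))"

theorem tetrahedron_universal:
  assumes "tet_relations y"
  shows "\<exists>!\<phi>. lie_hom_from_tet \<phi> \<and> (\<forall>i j. i \<noteq> j \<longrightarrow> \<phi> (tet_x i j) = y i j)"
proof -
  define \<phi> where "\<phi> t = eval_expr y (rep_tetrahedron t)" for t
  have abs: "\<phi> (abs_tetrahedron e) = eval_expr y e" for e
    unfolding \<phi>_def
    by (rule eval_expr_cong[OF assms])
       (metis Quotient3_abs_rep Quotient3_tetrahedron tetrahedron.abs_eq_iff)
  have ex_abs: "\<exists>e. t = abs_tetrahedron e" for t :: "'k tetrahedron"
    by (metis Quotient3_abs_rep Quotient3_tetrahedron)
  have plus: "\<phi> (s + t) = \<phi> s + \<phi> t" for s t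
    using ex_abs[of s] ex_abs[of t] by (auto simp: plus_tetrahedron.abs_eq abs)
  have scl: "\<phi> (tet_scale r t) = scale r (\<phi> t)" for r t
    using ex_abs[of t] by (auto simp: tet_scale.abs_eq abs)
  have brac: "\<phi> (tet_bracket s t) = bracket (\<phi> s) (\<phi> t)" for s t
    using ex_abs[of s] ex_abs[of t] by (auto simp: tet_bracket.abs_eq abs)
  have gen: "\<phi> (tet_x i j) = y i j" if "i \<noteq> j" for i j
    unfolding tet_x.abs_eq abs by (rule eval_expr_X[OF that])
  have "Vector_Spaces.linear tet_scale scale \<phi>"
    by unfold_locales (simp_all add: plus scl)
  then have hom: "lie_hom_from_tet \<phi>"
    by (simp add: lie_hom_from_tet_def brac)
  have unique: "\<psi> = \<phi>"
    if h: "lie_hom_from_tet \<psi>" and g: "\<forall>i j. i \<noteq> j \<longrightarrow> \<psi> (tet_x i j) = y i j" for \<psi>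
  proof
    interpret psi: Vector_Spaces.linear tet_scale scale \<psi>
      using h by (simp add: lie_hom_from_tet_def)
    have "\<psi> (abs_tetrahedron e) = eval_expr y e" for e
    proof (induction e)
      case (Gen e)
      obtain i j where e: "e = Abs_edge (i, j)" "i \<noteq> j"
        by (cases e) auto
      then have "\<psi> (abs_tetrahedron (X i j)) = y i j"
        using g by (simp flip: tet_x.abs_eq)
      then show ?case
        using e by (simp add: eval_expr_X del: eval_expr.simps(1))
    next
      case Zero
      show ?case using psi.zero by (simp add: zero_tetrahedron_def)
    next
      case (Plus a b)
      then show ?case by (simp add: psi.add flip: plus_tetrahedron.abs_eq)
    next
      case (Scale r a)
      then show ?case by (simp add: psi.scale flip: tet_scale.abs_eq)
    next
      case (Brac a b)
      then show ?case using h by (simp add: lie_hom_from_tet_def flip: tet_bracket.abs_eq)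
    qed
    then show "\<psi> t = \<phi> t" for t
      using ex_abs[of t] abs by auto
  qed
  show ?thesis
    using hom gen unique by blast
qed

end

text \<open>
  By a theorem of Hartwig, such a \<open>d\<close> exists for every finite-dimensional irreducible module
  over an algebraically closed field of characteristic 0; it is unique because the eigenvalue
  set has \<open>d + 1\<close> elements.
\<close>

definition tet_diameter ::
    "('k::field \<Rightarrow> 'v::ab_group_add \<Rightarrow> 'v) \<Rightarrow> ('k tetrahedron \<Rightarrow> 'v \<Rightarrow> 'v) \<Rightarrow> nat" where
  "tet_diameter scale act = (THE d. \<forall>i j. i \<noteq> j \<longrightarrow>
     semisimple_map scale (act (tet_x i j)) \<and>
     eigenvalues scale (act (tet_x i j)) = {of_int (int d - 2 * int n) |n. n \<le> d})"


section \<open>Bilinear forms\<close>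

definition bilinear_form ::
    "('k::field \<Rightarrow> 'v::ab_group_add \<Rightarrow> 'v) \<Rightarrow> ('v \<Rightarrow> 'v \<Rightarrow> 'k) \<Rightarrow> bool" where
  "bilinear_form scale f \<longleftrightarrow>
     (\<forall>u. Vector_Spaces.linear scale (*) (f u)) \<and>
     (\<forall>v. Vector_Spaces.linear scale (*) (\<lambda>u. f u v))"

definition nondegenerate :: "('v::zero \<Rightarrow> 'v \<Rightarrow> 'k::zero) \<Rightarrow> bool" where
  "nondegenerate f \<longleftrightarrow>
     (\<forall>u. (\<forall>v. f u v = 0) \<longrightarrow> u = 0) \<and> (\<forall>v. (\<forall>u. f u v = 0) \<longrightarrow> v = 0)"

definition nonzero_invariant_form ::
    "('k::field \<Rightarrow> 'v::ab_group_add \<Rightarrow> 'v) \<Rightarrow> ('l \<Rightarrow> 'v \<Rightarrow> 'v) \<Rightarrow> ('v \<Rightarrow> 'v \<Rightarrow> 'k) \<Rightarrow> bool" where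
  "nonzero_invariant_form scale act f \<longleftrightarrow>
     bilinear_form scale f \<and> (\<exists>u v. f u v \<noteq> 0) \<and>
     (\<forall>\<xi> u v. f (act \<xi> u) v = - f u (act \<xi> v))"

end

theory Submission
  imports Defs "HOL-Library.Function_Algebras"
begin

text \<open>
  Put \<open>h = x 1 2\<close>. The elements \<open>e\<^sub>0 = (x 1 2 + x 2 3) / 2\<close>, \<open>e\<^sub>1 = (x 1 2 + x 2 0) / 2\<close>,
  \<open>f\<^sub>0 = - (x 1 2 + x 3 1) / 2\<close> and \<open>f\<^sub>-\<^sub>1 = - (x 1 2 + x 0 1) / 2\<close> generate a quotient of the loop
  algebra of \<open>sl\<^sub>2\<close>, and on a finite-dimensional module the remaining generator \<open>x 3 0\<close> acts through
  the image of this loop algebra. An irreducible module \<open>V\<close> therefore has a one-dimensional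
  top weight space, spanned by a common eigenvector \<open>v\<close> of all \<open>h\<^sub>n\<close>. If \<open>d\<close> is the diameter,
  \<open>w = f\<^sub>0\<^sup>d v\<close> spans the bottom weight space, and the eigenvalues of the \<open>h\<^sub>n\<close> on \<open>w\<close> are the
  negatives of those on \<open>v\<close>. Hence \<open>V\<close> and its dual have the same highest weight, so the submodule
  of \<open>V \<oplus> V*\<close> generated by the two highest weight vectors is the graph of an isomorphism
  \<open>V \<rightarrow> V*\<close>, which is the invariant form. Uniqueness holds because an invariant form is determined
  by its value at \<open>(v, w)\<close>, and the sign comes from \<open>\<langle>v, f\<^sub>0\<^sup>d v\<rangle> = (-1)\<^sup>d \<langle>f\<^sub>0\<^sup>d v, v\<rangle>\<close>.
\<close>

section \<open>Loop algebra relations\<close>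

text \<open>The formulas come from the model sl2 tensored with F[t, 1/t, 1/(t - 1)], where
  \<open>x 1 2\<close> is \<open>h\<close>, \<open>x 2 3\<close> is \<open>2 e - h\<close>,
  \<open>x 2 0\<close> is \<open>2 t e - h\<close>, \<open>x 3 1\<close> is \<open>- h - 2 f\<close>
  and \<open>x 0 1\<close> is \<open>- h - 2 f / t\<close>. Only \<open>x 3 0\<close> involves the
  pole at \<open>t = 1\<close>. That pole is the obstacle to treating the module as an ordinary loop
  module, and finite dimension removes it: multiplication by \<open>t - 1\<close> maps the operators
  spanned by \<open>f / (t - 1)\<close> and all \<open>f n\<close> injectively into those spanned by
  the \<open>f n\<close> alone, so the two finite-dimensional spaces coincide. The model is only a
  guide. The loop relations are derived from the presentation: a finite window of them is shown to
  move along the indices in both directions, and the general relations are then obtained from the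
  windows. The eigenvalues on \<open>w\<close> are the negatives of those on \<open>v\<close>
  because every \<open>e n\<close> annihilates \<open>f 0\<close> to the power \<open>d + 1\<close>
  applied to \<open>v\<close>, which is 0; expanding this expresses \<open>f n\<close> on the last
  but one vector of the string through \<open>w\<close>.\<close>

context lie_algebra
begin

sublocale left: Vector_Spaces.linear scale scale "\<lambda>a. bracket a b" for b
  by (rule linear_bracket_left)

sublocale right: Vector_Spaces.linear scale scale "\<lambda>b. bracket a b" for a
  using linear_bracket_right by simp

lemmas bracket_bilinear = left.add left.diff left.neg left.scale left.zero
  right.add right.diff right.neg right.scale right.zero

lemma bracket_anticommute: "bracket a b = - bracket b a"
proof -
  have "bracket a a + bracket a b + (bracket b a + bracket b b) = 0"
    using bracket_self[of "a + b"] by (simp only: left.add right.add ac_simps)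
  then show ?thesis by (simp add: eq_neg_iff_add_eq_0 bracket_self)
qed

lemma bracket_leibniz: "bracket a (bracket b c) = bracket (bracket a b) c + bracket b (bracket a c)"
proof -
  have "bracket a (bracket b c) - bracket b (bracket a c) - bracket (bracket a b) c = 0"
    using jacobi[of a b c] bracket_anticommute[of c a] bracket_anticommute[of c "bracket a b"]
    by (simp add: right.neg)
  then show ?thesis by (simp add: algebra_simps)
qed

end

section \<open>Four adjacent loop generators, their symmetries and the index shift\<close>

locale lie_algebra_char_0 = lie_algebra scale bracket
  for scale :: "'k::field_char_0 \<Rightarrow> 'l::ab_group_add \<Rightarrow> 'l"
    and bracket :: "'l \<Rightarrow> 'l \<Rightarrow> 'l"  (infixr "\<bullet>" 75)
begin

declare bracket_bilinear [simp] bracket_self [simp]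

text \<open>Multiples by 2 and its powers are written as sums, so that additive simplification
  handles them; this fact and \<open>double_cancel\<close> then divide by 2.\<close>

lemma double_eq_0: "x + x = 0 \<longleftrightarrow> (x::'l) = 0"
proof -
  have "x + x = scale 2 x" using scale_left_distrib[of 1 1 x] by simp
  then show ?thesis by simp
qed

lemma double_cancel: "x + x = y + y \<longleftrightarrow> (x::'l) = y"
  using double_eq_0[of "x - y"] by (auto simp: algebra_simps)

text \<open>The arguments stand for \<open>e\<^sub>0, e\<^sub>1, f\<^sub>0, f\<^sub>-\<^sub>1, h\<^sub>0/2, h\<^sub>1/2, h\<^sub>-\<^sub>1/2\<close>; the last four equations are
  the Serre relations. The proof that all loop relations follow rests on the fact that these
  conditions are stable under \<open>e\<^sub>n \<mapsto> e\<^bsub>n+1\<^esub>\<close>, \<open>f\<^sub>n \<mapsto> f\<^bsub>n-1\<^esub>\<close>.\<close>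

definition loop_base where
  "loop_base a b c d g k l \<longleftrightarrow>
     g \<bullet> a = a \<and> g \<bullet> b = b \<and> g \<bullet> c = - c \<and> g \<bullet> d = - d \<and>
     a \<bullet> c = g + g \<and> b \<bullet> d = g + g \<and> b \<bullet> c = k + k \<and> a \<bullet> d = l + l \<and>
     a \<bullet> b = 0 \<and> c \<bullet> d = 0 \<and>
     a \<bullet> (l \<bullet> a) = 0 \<and> b \<bullet> (k \<bullet> b) = 0 \<and> c \<bullet> (k \<bullet> c) = 0 \<and> d \<bullet> (l \<bullet> d) = 0"

text \<open>This is the symmetry \<open>e_n |-> e_(1-n)\<close>, \<open>f_n |-> f_(-1-n)\<close>,
  \<open>h_n |-> h_(-n)\<close>: inversion of \<open>t\<close> combined with a shift.\<close>

lemma loop_base_reverse: "loop_base a b c d g k l \<Longrightarrow> loop_base b a d c g l k"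
  unfolding loop_base_def using bracket_anticommute[of b a] bracket_anticommute[of d c] by simp

text \<open>This is the symmetry exchanging \<open>e_n\<close> with \<open>f_(-n)\<close> and
  sending \<open>h_n\<close> to \<open>- h_(-n)\<close>. Together with the reversal it lets one
  computation serve for all four generators.\<close>

lemma loop_base_swap: "loop_base a b c d g k l \<Longrightarrow> loop_base c d a b (- g) (- l) (- k)"
  unfolding loop_base_def
  using bracket_anticommute[of c a] bracket_anticommute[of d b] bracket_anticommute[of c b] bracket_anticommute[of d a]
  by simp

lemma loop_base_ad:
  assumes "loop_base a b c d g k l"
  shows "k \<bullet> a = b" "l \<bullet> b = a" "k \<bullet> d = - c" "l \<bullet> c = - d" "g \<bullet> k = 0" "g \<bullet> l = 0" "k \<bullet> l = 0"
proof -
  note Q = assms[unfolded loop_base_def]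
  have 1: "k \<bullet> a = b" if "loop_base a b c d g k l" for a b c d g k l
  proof -
    note Q = that[unfolded loop_base_def]
    have "a \<bullet> (b \<bullet> c) = b \<bullet> (g + g)"
      using bracket_leibniz[of a b c] Q by simp
    then have "a \<bullet> k + a \<bullet> k = - b + - b"
      using Q bracket_anticommute[of b g] by simp
    then have "a \<bullet> k = - b" by (simp only: double_cancel)
    then show ?thesis using bracket_anticommute[of k a] by simp
  qed
  show ka: "k \<bullet> a = b" and lb: "l \<bullet> b = a" using 1 assms loop_base_reverse by blast+
  have "- l \<bullet> c = d" using 1 assms loop_base_swap by blast
  then show lc: "l \<bullet> c = - d" by (metis left.neg minus_minus)
  have "- k \<bullet> d = c" using 1 loop_base_swap[OF loop_base_reverse[OF assms]] loop_base_reverse by blast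
  then show kd: "k \<bullet> d = - c" by (metis left.neg minus_minus)
  have 2: "g \<bullet> k = 0" if "loop_base a b c d g k l" for a b c d g k l
  proof -
    note Q = that[unfolded loop_base_def]
    have "g \<bullet> (b \<bullet> c) = 0"
      using bracket_leibniz[of g b c] Q by simp
    then show ?thesis using Q by (simp add: double_eq_0)
  qed
  show gk: "g \<bullet> k = 0" and gl: "g \<bullet> l = 0" using 2 assms loop_base_reverse by blast+
  have "k \<bullet> (a \<bullet> d) = 0"
    using bracket_leibniz[of k a d] Q ka kd by simp
  then show "k \<bullet> l = 0" using Q by (simp add: double_eq_0)
qed

text \<open>This is \<open>[e\<^sub>2, e\<^sub>3] = 0\<close>. It suffices that \<open>[h\<^sub>1, h\<^sub>2] = 0\<close>, which follows by computing this
  bracket in two ways and comparing: a multiple of it by 6 vanishes.\<close>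

lemma loop_base_serre:
  assumes "loop_base a b c d g k l"
  shows "(k \<bullet> b) \<bullet> (k \<bullet> (k \<bullet> b)) = 0"
proof -
  note Q = assms[unfolded loop_base_def] and ad = loop_base_ad[OF assms]
  define e where "e n = ((\<bullet>) k ^^ n) a" for n
  define f where "f n = ((\<lambda>x. - (k \<bullet> x)) ^^ n) c" for n
  have e0: "e 0 = a" and e1: "e (Suc 0) = b" and ke: "k \<bullet> e n = e (Suc n)" for n
    by (simp_all add: e_def ad)
  have f0: "f 0 = c" and kf: "k \<bullet> f n = - f (Suc n)" for n
    by (simp_all add: f_def)
  have Dee: "k \<bullet> (e m \<bullet> e n) = e (Suc m) \<bullet> e n + e m \<bullet> e (Suc n)" for m n
    using bracket_leibniz[of k "e m" "e n"] by (simp add: ke)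
  have Def: "k \<bullet> (e m \<bullet> f n) = e (Suc m) \<bullet> f n - e m \<bullet> f (Suc n)" for m n
    using bracket_leibniz[of k "e m" "f n"] by (simp add: ke kf)
  have Dff: "k \<bullet> (f m \<bullet> f n) = - (f (Suc m) \<bullet> f n) - f m \<bullet> f (Suc n)" for m n
    using bracket_leibniz[of k "f m" "f n"] by (simp add: kf)
  have e01: "e 0 \<bullet> e 1 = 0" and e12: "e 1 \<bullet> e 2 = 0"
    using Q ke[of 1] by (simp_all add: e0 e1 numeral_2_eq_2)
  have e02: "e 0 \<bullet> e 2 = 0" using Dee[of 0 1] e01 by (simp add: numeral_2_eq_2)
  have e13: "e 1 \<bullet> e 3 = 0" using Dee[of 1 2] e12 by (simp add: numeral_2_eq_2 numeral_3_eq_3)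
  have e03: "e 0 \<bullet> e 3 = 0" using Dee[of 0 2] e02 e12 by (simp add: numeral_2_eq_2 numeral_3_eq_3)
  have e04: "e 0 \<bullet> e 4 = 0" using Dee[of 0 3] e03 e13 by (simp add: eval_nat_numeral)
  have e14: "e 2 \<bullet> e 3 + e 1 \<bullet> e 4 = 0" using Dee[of 1 3] e13 by (simp add: eval_nat_numeral)
  have e05: "e 1 \<bullet> e 4 + e 0 \<bullet> e 5 = 0" using Dee[of 0 4] e04 by (simp add: eval_nat_numeral)
  have f01: "f 0 \<bullet> f 1 = 0" using Q kf[of 0] by (metis f0 One_nat_def minus_minus neg_equal_0_iff_equal right.neg)
  have f02: "f 0 \<bullet> f 2 = 0" using Dff[of 0 1] f01 by (simp add: numeral_2_eq_2)
  have k1: "e 1 \<bullet> f 0 = k + k" "e 0 \<bullet> f 1 = k + k" 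
    using Q Def[of 0 0] ad bracket_anticommute[of k g] by (simp_all add: e0 e1 f0)
  \<comment> \<open>\<open>k2\<close> stands for \<open>h_2 / 2\<close>. Applying \<open>k\<close>
    to the brackets of total index 1 shows that all three \<open>[e m, f n]\<close> with
    \<open>m + n = 2\<close> equal \<open>k2 + k2\<close>.\<close>
  obtain k2 where k2: "e 1 \<bullet> f 1 = k2 + k2"
  proof
    have "scale (1/2) x + scale (1/2) x = x" for x
      by (simp flip: scale_left_distrib)
    then show "e 1 \<bullet> f 1 = scale (1/2) (e 1 \<bullet> f 1) + scale (1/2) (e 1 \<bullet> f 1)" by simp
  qed
  have k2': "e 2 \<bullet> f 0 = k2 + k2" "e 0 \<bullet> f 2 = k2 + k2"
    using Def[of 1 0] Def[of 0 1] k1 k2 by (simp_all add: numeral_2_eq_2)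
  have k2e0: "k2 \<bullet> e 0 = e 2"
  proof -
    have "e 0 \<bullet> (e 1 \<bullet> f 1) = e 1 \<bullet> (k + k)"
      using bracket_leibniz[of "e 0" "e 1" "f 1"] e01 k1 by simp
    then have "(e 0 \<bullet> k2) + (e 0 \<bullet> k2) = - e 2 + - e 2"
      using k2 ke[of 1] bracket_anticommute[of "e 1" k] by (simp add: numeral_2_eq_2)
    then show ?thesis unfolding double_cancel using bracket_anticommute[of k2 "e 0"] by simp
  qed
  have k2e1: "k2 \<bullet> e 1 = e 3"
  proof -
    have "e 1 \<bullet> (e 2 \<bullet> f 0) = e 2 \<bullet> (k + k)"
      using bracket_leibniz[of "e 1" "e 2" "f 0"] e12 k1 by simp
    then have "(e 1 \<bullet> k2) + (e 1 \<bullet> k2) = - e 3 + - e 3"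
      using k2' ke[of 2] bracket_anticommute[of "e 2" k] by (simp add: numeral_2_eq_2 numeral_3_eq_3)
    then show ?thesis unfolding double_cancel using bracket_anticommute[of k2 "e 1"] by simp
  qed
  have k2f0: "k2 \<bullet> f 0 = - f 2"
  proof -
    have "f 0 \<bullet> (e 0 \<bullet> f 2) = - ((g + g) \<bullet> f 2)"
      using bracket_leibniz[of "f 0" "e 0" "f 2"] f02 Q bracket_anticommute[of c a] by (simp add: e0 f0)
    moreover have "g \<bullet> f n = - f n" for n
    proof (induction n)
      case (Suc n)
      have "f (Suc n) = - (k \<bullet> f n)" by (simp add: kf)
      then have "g \<bullet> f (Suc n) = - (k \<bullet> (g \<bullet> f n))"
        using bracket_leibniz[of g k "f n"] ad by simp
      then show ?case using Suc by (simp add: kf)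
    qed (use Q in \<open>simp add: f0\<close>)
    ultimately have "f 0 \<bullet> k2 + f 0 \<bullet> k2 = f 2 + f 2"
      using k2' by simp
    then show ?thesis unfolding double_cancel using bracket_anticommute[of k2 "f 0"] by simp
  qed
  have kk2: "k \<bullet> k2 = 0"
  proof -
    let ?x = "k \<bullet> k2"
    have A: "?x + ?x = e 3 \<bullet> f 0 - e 2 \<bullet> f 1" "?x + ?x = e 2 \<bullet> f 1 - e 1 \<bullet> f 2"
      using Def[of 2 0] Def[of 1 1] k2 k2' by (simp_all add: numeral_2_eq_2 numeral_3_eq_3)
    \<comment> \<open>The two differences in \<open>A\<close> telescope to
      \<open>[e 3, f 0] - [e 1, f 2]\<close>, which \<open>k2\<close> also produces from
      \<open>[e 1, f 0] = k + k\<close>. Hence \<open>- 2 ?x = 4 ?x\<close>.\<close>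
    have "k2 \<bullet> (e 1 \<bullet> f 0) = (e 3 \<bullet> f 0 - e 2 \<bullet> f 1) + (e 2 \<bullet> f 1 - e 1 \<bullet> f 2)"
      using bracket_leibniz[of k2 "e 1" "f 0"] k2e1 k2f0 by simp
    then have "k2 \<bullet> (k + k) = (?x + ?x) + (?x + ?x)"
      by (simp only: k1 A[symmetric])
    then have "- (?x + ?x) = (?x + ?x) + (?x + ?x)"
      using bracket_anticommute[of k2 k] by simp
    then have "scale 6 ?x = 0"
      using scale_left_distrib[of 1 5 ?x] scale_left_distrib[of 1 4 ?x] scale_left_distrib[of 1 3 ?x]
        scale_left_distrib[of 1 2 ?x] scale_left_distrib[of 1 1 ?x] 
      by (simp add: algebra_simps neg_eq_iff_add_eq_0)
    then show ?thesis by simp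
  qed
  have k2e: "k2 \<bullet> e (Suc n) = e (n + 3)" for n
  proof (induction n)
    case (Suc n)
    have "k \<bullet> (k2 \<bullet> e (Suc n)) = k2 \<bullet> e (Suc (Suc n))"
      using bracket_leibniz[of k k2 "e (Suc n)"] kk2 by (simp add: ke)
    then show ?case using Suc by (simp add: ke)
  qed (use k2e1 in simp)
  \<comment> \<open>Applying \<open>k\<close> alone gives only
    \<open>[e 2, e 3] = - [e 1, e 4] = [e 0, e 5]\<close>. Applying \<open>k2\<close> to
    \<open>[e 0, e 3] = 0\<close> supplies an independent relation, namely that the two outer terms
    add up to 0.\<close>
  have "k2 \<bullet> (e 0 \<bullet> e 3) = e 2 \<bullet> e 3 + e 0 \<bullet> e 5"
    using bracket_leibniz[of k2 "e 0" "e 3"] k2e0 k2e[of 2] by (simp add: eval_nat_numeral)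
  moreover have "e 0 \<bullet> e 5 = e 2 \<bullet> e 3"
    using e14 e05 by (metis add.commute add_left_imp_eq)
  ultimately have "e 2 \<bullet> e 3 = 0"
    using e03 by (simp add: double_eq_0)
  then show ?thesis
    using ke[of 1] ke[of 2] e1 by (simp add: numeral_2_eq_2 numeral_3_eq_3)
qed

text \<open>The base conditions say that neighbours commute among \<open>e_(-1), ..., e_2\<close>
  and among \<open>f_(-2), ..., f_1\<close>. Moving both windows by one step keeps all such pairs
  but one in each: \<open>[e_2, e_3]\<close> is \<open>loop_base_serre\<close>, and
  \<open>[f_(-2), f_(-3)]\<close> is its image under \<open>loop_base_swap\<close>.\<close>

lemma loop_base_shift:
  assumes "loop_base a b c d g k l"
  shows "loop_base b (k \<bullet> b) d (- (l \<bullet> d)) g k l"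
proof -
  note Q = assms[unfolded loop_base_def] and ad = loop_base_ad[OF assms]
  have s2: "(l \<bullet> d) \<bullet> (l \<bullet> (l \<bullet> d)) = 0"
    using loop_base_serre[OF loop_base_swap[OF assms]] by simp
  have "k \<bullet> (b \<bullet> d) = (k \<bullet> b) \<bullet> d - b \<bullet> c"
    using bracket_leibniz[of k b d] ad by simp
  then have kbd: "(k \<bullet> b) \<bullet> d = k + k" using Q ad bracket_anticommute[of k g] by simp
  have "l \<bullet> (b \<bullet> d) = a \<bullet> d + b \<bullet> (l \<bullet> d)"
    using bracket_leibniz[of l b d] ad by simp
  then have bld: "b \<bullet> (l \<bullet> d) = - (l + l)" using Q ad bracket_anticommute[of l g] by (simp add: add_eq_0_iff)
  have "k \<bullet> (l \<bullet> d) = - (l \<bullet> c)"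
    using bracket_leibniz[of k l d] ad by simp
  then have "k \<bullet> (b \<bullet> (l \<bullet> d)) = (k \<bullet> b) \<bullet> (l \<bullet> d) + b \<bullet> d"
    using bracket_leibniz[of k b "l \<bullet> d"] ad by simp
  then have "(k \<bullet> b) \<bullet> (l \<bullet> d) = - (g + g)" using bld ad Q by (simp add: add_eq_0_iff)
  then show ?thesis
    unfolding loop_base_def
    using Q ad kbd bld s2 loop_base_serre[OF assms] bracket_leibniz[of g k b] bracket_leibniz[of g l d]
      bracket_anticommute[of b a] bracket_anticommute[of d c]
    by simp
qed


section \<open>Sequences of loop generators indexed by all integers\<close>

lemma int_orbit:
  fixes T T' :: "'a \<Rightarrow> 'a"
  assumes "\<And>x. T (T' x) = T' (T x)" "T' (T a) = a"
  shows "\<exists>s :: int \<Rightarrow> 'a. s 0 = a \<and> (\<forall>n. T (s n) = s (n + 1) \<and> T' (s n) = s (n - 1))"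
proof -
  define s where "s n = (if 0 \<le> n then (T ^^ nat n) a else (T' ^^ nat (- n)) a)" for n :: int
  \<comment> \<open>The maps cancel at \<open>a\<close>; since they commute, this cancellation is
    carried along both half-orbits.\<close>
  have TT': "T' (T x) = x" if "x \<in> {(T ^^ n) a, (T' ^^ n) a}" for x n
    using that
  proof (induction n arbitrary: x)
    case (Suc n)
    then show ?case
      by (metis assms(1) funpow.simps(2) insert_iff o_apply singletonD)
  qed (use assms(2) in auto)
  have "T (s n) = s (n + 1) \<and> T' (s n) = s (n - 1)" for n
  proof (cases "0 \<le> n")
    case True
    have "nat (n + 1) = Suc (nat n)" using True by simp
    then have 1: "T (s n) = s (n + 1)" using True by (simp add: s_def)
    have "T' (s n) = s (n - 1)"
    proof (cases "n = 0")
      case False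
      then obtain m where m: "n = int (Suc m)" using True by (metis gr0_implies_Suc not_gr_zero of_nat_0 zero_le_imp_eq_int)
      then show ?thesis using TT'[of "(T ^^ m) a" m] by (simp add: s_def nat_add_distrib)
    qed (simp add: s_def)
    with 1 show ?thesis by blast
  next
    case False
    then obtain m where m: "n = - int (Suc m)" by (cases n rule: int_cases) auto
    have 1: "T' (s n) = s (n - 1)" using False by (simp add: s_def m nat_add_distrib Suc_nat_eq_nat_zadd1)
    have "T (T' ((T' ^^ m) a)) = (T' ^^ m) a" using TT'[of "(T' ^^ m) a" m] assms(1) by simp
    then have "T (s n) = s (n + 1)" by (cases m) (simp_all add: s_def m nat_add_distrib Suc_nat_eq_nat_zadd1)
    with 1 show ?thesis by blast
  qed
  moreover have "s 0 = a" by (simp add: s_def)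
  ultimately show ?thesis by blast
qed

lemma loop_base_sequences:
  assumes "loop_base a b c d g k l"
  obtains e f :: "int \<Rightarrow> 'l" where "e 0 = a" "e 1 = b" "f 0 = c" "f (- 1) = d"
    "\<And>n. k \<bullet> e n = e (n + 1)" "\<And>n. l \<bullet> e n = e (n - 1)"
    "\<And>n. k \<bullet> f n = - f (n + 1)" "\<And>n. l \<bullet> f n = - f (n - 1)"
    "\<And>n. loop_base (e n) (e (n + 1)) (f (- n)) (f (- n - 1)) g k l"
proof -
  note ad = loop_base_ad[OF assms]
  have kl: "k \<bullet> (l \<bullet> x) = l \<bullet> (k \<bullet> x)" for x
    using bracket_leibniz[of k l x] ad by simp
  obtain e where e: "e 0 = a" "\<And>n::int. k \<bullet> e n = e (n + 1)" "\<And>n::int. l \<bullet> e n = e (n - 1)"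
    using int_orbit[of "(\<bullet>) k" "(\<bullet>) l" a] kl ad by auto
  have "l \<bullet> (k \<bullet> c) = c"
    using kl[of c] ad by simp
  then obtain f where f: "f 0 = c" "\<And>n::int. - (k \<bullet> f n) = f (n + 1)" "\<And>n::int. - (l \<bullet> f n) = f (n - 1)"
    using int_orbit[of "\<lambda>x. - (k \<bullet> x)" "\<lambda>x. - (l \<bullet> x)" c] kl ad by auto
  have kf: "k \<bullet> f n = - f (n + 1)" and lf: "l \<bullet> f n = - f (n - 1)" for n
    by (simp_all flip: f)
  have e1: "e 1 = b" using e(2)[of 0] e(1) ad by simp
  have f1: "f (- 1) = d" using f(3)[of 0] f(1) ad by simp
  have "loop_base (e n) (e (n + 1)) (f (- n)) (f (- n - 1)) g k l" for n
  proof (induction n rule: int_induct[of _ 0])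
    case base
    show ?case using assms e f e1 f1 by simp
  next
    case (step1 i)
    show ?case using loop_base_shift[OF step1(2)] by (simp add: e kf lf)
  next
    case (step2 i)
    \<comment> \<open>Conjugating the shift by the reversal yields the shift in the opposite
      direction.\<close>
    have "loop_base (l \<bullet> e i) (e i) (- (k \<bullet> f (- i))) (f (- i)) g k l"
      by (rule loop_base_reverse, rule loop_base_shift, rule loop_base_reverse, rule step2(2))
    then show ?case by (simp add: e f)
  qed
  with that e f kf lf e1 f1 show ?thesis by blast
qed

end

section \<open>All brackets between the \<open>e n\<close>, \<open>f n\<close> and
  \<open>h n\<close>\<close>

locale loop_sequences = lie_algebra_char_0 +
  fixes e f :: "int \<Rightarrow> 'b" and g k l :: 'b
  assumes ke: "k \<bullet> e n = e (n + 1)" and le: "l \<bullet> e n = e (n - 1)"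
    and kf: "k \<bullet> f n = - f (n + 1)" and lf: "l \<bullet> f n = - f (n - 1)"
    and base: "loop_base (e n) (e (n + 1)) (f (- n)) (f (- n - 1)) g k l"
begin

lemma ge: "g \<bullet> e n = e n" and ef_neg: "e n \<bullet> f (- n) = g + g"
  using base[of n] by (simp_all add: loop_base_def)

lemma gf: "g \<bullet> f n = - f n"
  using base[of "- n"] by (simp add: loop_base_def)

lemma ef_one: "e (n + 1) \<bullet> f (- n) = k + k"
  using base[of n] by (simp add: loop_base_def)

text \<open>Applying \<open>k\<close> to a bracket of index gap \<open>j + 1\<close> gives one of
  gap \<open>j\<close> plus one of gap \<open>j + 2\<close>. The induction therefore carries two
  consecutive gaps, and the base conditions provide gaps 0 and 1.\<close>

lemma ee: "e m \<bullet> e n = 0"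
proof -
  have "e m \<bullet> e (m + int j) = 0 \<and> e m \<bullet> e (m + int j + 1) = 0" for m j
  proof (induction j arbitrary: m)
    case 0
    show ?case using base[of m] by (simp add: loop_base_def)
  next
    case (Suc j)
    have "k \<bullet> (e m \<bullet> e (m + int j + 1)) = e (m + 1) \<bullet> e (m + 1 + int j) + e m \<bullet> e (m + int j + 2)"
      using bracket_leibniz[of k "e m" "e (m + int j + 1)"] by (simp add: ke ac_simps)
    then show ?case using Suc[of m] Suc[of "m + 1"] by (simp add: ac_simps)
  qed
  note A = this
  show ?thesis
  proof (cases "m \<le> n")
    case True
    then show ?thesis using A[of m "nat (n - m)"] by simp
  next
    case False
    then show ?thesis using A[of n "nat (m - n)"] bracket_anticommute[of "e m" "e n"] by simp
  qed
qed

lemma swapped: "loop_sequences scale bracket (\<lambda>n. f (- n)) (\<lambda>n. e (- n)) (- g) (- l) (- k)"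
proof (unfold_locales, goal_cases)
  case (5 n)
  have 1: "- (n + 1) = - n - 1" "- (- n) = n" "- (- n - 1) = n + 1" by simp_all
  show ?case unfolding 1 by (rule loop_base_swap[OF base])
qed (simp_all add: ke le kf lf)

lemma ef_e_commute: "(e m \<bullet> f n) \<bullet> e j = (e j \<bullet> f n) \<bullet> e m"
  using bracket_leibniz[of "e m" "e j" "f n"] ee[of m j]
    bracket_anticommute[of "e m" "e j \<bullet> f n"] bracket_anticommute[of "e j" "e m \<bullet> f n"] by simp

text \<open>Induction on \<open>i = n + j\<close>, in both directions. Applying \<open>k\<close> or
  \<open>l\<close> at level \<open>i\<close> shows that at the next level the value does not change
  when index is moved between \<open>f n\<close> and \<open>e j\<close>. It can then be read off at
  \<open>n = - m\<close>, where the inner bracket is \<open>g + g\<close>.\<close>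

lemma ef_e: "(e m \<bullet> f n) \<bullet> e j = e (m + n + j) + e (m + n + j)"
proof -
  have const: "s i = s j" if "\<And>i. s (i + 1) = s i" for s :: "int \<Rightarrow> 'b" and i j
  proof -
    have "s i = s 0" for i
      by (induction i rule: int_induct[of _ 0]) (use that in \<open>auto, metis diff_add_cancel\<close>)
    then show ?thesis by metis
  qed
  have at: "(e m \<bullet> f (- m)) \<bullet> e j = e j + e j" for m j
    by (simp add: ef_neg ge)
  have D: "k \<bullet> ((e m \<bullet> f n) \<bullet> e j)
      = (e (m + 1) \<bullet> f n) \<bullet> e j - (e m \<bullet> f (n + 1)) \<bullet> e j + (e m \<bullet> f n) \<bullet> e (j + 1)" for m n j
    using bracket_leibniz[of k "e m \<bullet> f n" "e j"] bracket_leibniz[of k "e m" "f n"] by (simp add: ke kf)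
  have D': "l \<bullet> ((e m \<bullet> f n) \<bullet> e j)
      = (e (m - 1) \<bullet> f n) \<bullet> e j - (e m \<bullet> f (n - 1)) \<bullet> e j + (e m \<bullet> f n) \<bullet> e (j - 1)" for m n j
    using bracket_leibniz[of l "e m \<bullet> f n" "e j"] bracket_leibniz[of l "e m" "f n"] by (simp add: le lf)
  have "(e m \<bullet> f n) \<bullet> e (i - n) = e (m + i) + e (m + i)" for m n i
  proof (induction i arbitrary: m n rule: int_induct[of _ 0])
    case base
    show ?case using ef_e_commute[of m n "- n"] at[of "- n" m] by simp
  next
    case (step1 i)
    have "(e m \<bullet> f (n + 1)) \<bullet> e (i + 1 - (n + 1)) = (e m \<bullet> f n) \<bullet> e (i + 1 - n)" for n
    proof -
      have "e (m + 1 + i) + e (m + 1 + i) = e (m + 1 + i) + e (m + 1 + i)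
          - (e m \<bullet> f (n + 1)) \<bullet> e (i - n) + (e m \<bullet> f n) \<bullet> e (i - n + 1)"
        using D[of m n "i - n"] unfolding step1(2) by (simp add: ke ac_simps)
      then show ?thesis by (simp add: algebra_simps)
    qed
    then have "(e m \<bullet> f n) \<bullet> e (i + 1 - n) = (e m \<bullet> f (- m)) \<bullet> e (i + 1 - (- m))"
      by (rule const[of "\<lambda>n. (e m \<bullet> f n) \<bullet> e (i + 1 - n)"])
    then show ?case using at[of m "i + 1 - (- m)"] by (simp add: ac_simps)
  next
    case (step2 i)
    have "(e m \<bullet> f (n + 1)) \<bullet> e (i - 1 - (n + 1)) = (e m \<bullet> f n) \<bullet> e (i - 1 - n)" for n
    proof -
      have "e (m - 1 + i) + e (m - 1 + i) = e (m - 1 + i) + e (m - 1 + i)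
          - (e m \<bullet> f n) \<bullet> e (i - (n + 1)) + (e m \<bullet> f (n + 1)) \<bullet> e (i - (n + 1) - 1)"
        using D'[of m "n + 1" "i - (n + 1)"] unfolding step2(2) by (simp add: le algebra_simps)
      then show ?thesis by (simp add: algebra_simps)
    qed
    then have "(e m \<bullet> f n) \<bullet> e (i - 1 - n) = (e m \<bullet> f (- m)) \<bullet> e (i - 1 - (- m))"
      by (rule const[of "\<lambda>n. (e m \<bullet> f n) \<bullet> e (i - 1 - n)"])
    then show ?case using at[of m "i - 1 - (- m)"] by (simp add: ac_simps)
  qed
  from this[of m n "n + j"] show ?thesis by (simp add: ac_simps)
qed

interpretation sw: loop_sequences scale bracket "\<lambda>n. f (- n)" "\<lambda>n. e (- n)" "- g" "- l" "- k"
  by (rule swapped)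

lemma ff: "f m \<bullet> f n = 0"
  using sw.ee[of "- m" "- n"] by simp

lemma ef_f: "(e m \<bullet> f n) \<bullet> f j = - f (m + n + j) - f (m + n + j)"
proof -
  have "(f n \<bullet> e m) \<bullet> f j = f (m + n + j) + f (m + n + j)"
    using sw.ef_e[of "- n" "- m" "- j"] by (simp add: algebra_simps)
  moreover have "(e m \<bullet> f n) \<bullet> f j = - ((f n \<bullet> e m) \<bullet> f j)"
    using bracket_anticommute[of "e m" "f n"] by simp
  ultimately show ?thesis by simp
qed

text \<open>The defect \<open>D m n = [e (m + 1), f n] - [e m, f (n + 1)]\<close> commutes with all
  \<open>e j\<close> and \<open>f j\<close>, hence with \<open>k + k = [e 1, f 0]\<close>. So it
  depends only on \<open>m + n\<close>, and moving \<open>j\<close> units of index from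
  \<open>e\<close> to \<open>f\<close> costs exactly \<open>j\<close> copies of it
  (\<open>ap\<close>). Comparing the two ends by \<open>sym\<close> makes a nonzero integer multiple
  of the defect vanish.\<close>

lemma ef_shift: "e m \<bullet> f n = e (m + n) \<bullet> f 0"
proof -
  define D where "D m n = k \<bullet> (e m \<bullet> f n)" for m n
  have D: "D m n = e (m + 1) \<bullet> f n - e m \<bullet> f (n + 1)" for m n
    using bracket_leibniz[of k "e m" "f n"] by (simp add: D_def ke kf)
  have De: "D m n \<bullet> e j = 0" and Df: "D m n \<bullet> f j = 0" for m n j
    by (simp_all add: D ef_e ef_f ac_simps)
  have "D m n \<bullet> (e 1 \<bullet> f 0) = 0" for m n
    using bracket_leibniz[of "D m n" "e 1" "f 0"] by (simp add: De Df)
  then have kD: "k \<bullet> D m n = 0" for m n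
    using ef_one[of 0] bracket_anticommute[of k "D m n"] by (simp add: double_eq_0)
  have D_step: "D (m + 1) n = D m (n + 1)" for m n
    using kD[of m n] bracket_leibniz[of k "e (m + 1)" "f n"] bracket_leibniz[of k "e m" "f (n + 1)"]
    by (simp add: D_def[symmetric] D[of m n])
  have D_nat: "D (m + int j) n = D m (n + int j)" for m n j
  proof (induction j arbitrary: n)
    case (Suc j)
    then show ?case using D_step[of "m + int j" n] Suc[of "n + 1"] by (simp add: ac_simps)
  qed simp
  have ap: "e (m + int j) \<bullet> f n = e m \<bullet> f (n + int j) + scale (of_nat j) (D (m + int j - 1) n)" for m n j
  proof (induction j arbitrary: n)
    case (Suc j)
    have eq: "D (m + int j - 1) (1 + n) = D (m + int j) n"
      using D_step[of "m + int j - 1" n] by (simp add: ac_simps)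
    show ?case using D[of "m + int j" n] Suc[of "n + 1"]
      by (simp add: eq scale_left_distrib ac_simps eq_diff_eq)
  qed simp
  \<comment> \<open>The bracket of \<open>[e c, f 0]\<close> with \<open>[e 0, f 0] = g + g\<close>
    is 0 because of weights; expanding it instead by the Leibniz rule gives twice the difference of
    the two sides.\<close>
  have sym: "e c \<bullet> f 0 = e 0 \<bullet> f c" for c
  proof -
    have "(e c \<bullet> f 0) \<bullet> (e 0 \<bullet> f 0) = (e c \<bullet> f 0 - e 0 \<bullet> f c) + (e c \<bullet> f 0 - e 0 \<bullet> f c)"
      using bracket_leibniz[of "e c \<bullet> f 0" "e 0" "f 0"] by (simp add: ef_e ef_f)
    moreover have "g \<bullet> (e c \<bullet> f 0) = 0"
      using bracket_leibniz[of g "e c" "f 0"] by (simp add: ge gf)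
    then have "(e c \<bullet> f 0) \<bullet> (e 0 \<bullet> f 0) = 0"
      using ef_neg[of 0] bracket_anticommute[of "e c \<bullet> f 0" g] by simp
    ultimately show ?thesis by (simp add: double_eq_0)
  qed
  have D0: "D (c - 1) 0 = 0" for c
  \<comment> \<open>For \<open>c = 0\<close> the multiple in \<open>ap\<close> is 0 and says
    nothing, but there the defect is a difference of two copies of \<open>g + g\<close>.\<close>
  proof (cases "c = 0")
    case True
    then show ?thesis using D[of "- 1" 0] D_step[of "- 1" 0] D[of "-1" 0] ef_neg[of 0] ef_neg[of "- 1"] by simp
  next
    case False
    consider j where "c = int j" | j where "c = - int j" by (metis int_cases2)
    then show ?thesis
    proof cases
      case 1
      then show ?thesis using ap[of 0 j 0] sym[of c] False by simp
    next
      case 2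
      then have "scale (of_nat j) (D (-1) c) = 0" using ap[of c j c] sym[of c] by simp
      then have "D (- 1) c = 0" using 2 False by simp
      then show ?thesis using D_nat[of "c - 1" j c] 2 by simp
    qed
  qed
  have D_0: "D m n = 0" for m n
  proof (cases "0 \<le> n")
    case True
    then show ?thesis using D_nat[of m "nat n" 0] D0[of "m + n + 1"] by simp
  next
    case False
    then show ?thesis using D_nat[of "m + n" "nat (- n)" n] D0[of "m + n + 1"] by simp
  qed
  show ?thesis
  proof (cases "0 \<le> n")
    case True
    then show ?thesis using ap[of m "nat n" 0] by (simp add: D_0)
  next
    case False
    then show ?thesis using ap[of "m + n" "nat (- n)" n] by (simp add: D_0)
  qed
qed

definition h where "h n = e n \<bullet> f 0"

lemma ef: "e m \<bullet> f n = h (m + n)"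
  by (simp add: h_def ef_shift[of m n])

lemma he: "h m \<bullet> e n = e (m + n) + e (m + n)" and hf: "h m \<bullet> f n = - f (m + n) - f (m + n)"
  by (simp_all add: h_def ef_e ef_f)

lemma hh: "h m \<bullet> h n = 0"
  using bracket_leibniz[of "h m" "e n" "f 0"] by (simp add: he hf ef h_def[symmetric] ac_simps)

lemma h_0: "h 0 = g + g"
  using ef_neg[of 0] by (simp add: h_def)

end

section \<open>The element with a pole at \<open>t = 1\<close>\<close>

context loop_sequences
begin

text \<open>In terms of \<open>e\<^sub>n = e \<otimes> t\<^sup>n\<close> and \<open>f\<^sub>n = f \<otimes> t\<^sup>n\<close>, the element \<open>s\<close> is \<open>f \<otimes> 1/(t - 1)\<close>.\<close>

context
  fixes s
  assumes es: "(e 1 - e 0) \<bullet> s = g + g" and sf0: "s \<bullet> f 0 = 0" "s \<bullet> f (- 1) = 0"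
begin

lemma extra_h_difference:
  assumes "s \<bullet> f n = 0"
  shows "(h (n + 1) - h n) \<bullet> s = - f n - f n"
proof -
  have "0 = (g + g) \<bullet> f n + s \<bullet> ((e 1 - e 0) \<bullet> f n)"
    using bracket_leibniz[of "e 1 - e 0" s "f n"] unfolding es assms right.zero .
  then have "((e 1 - e 0) \<bullet> f n) \<bullet> s = (g + g) \<bullet> f n"
    unfolding bracket_anticommute[of s "(e 1 - e 0) \<bullet> f n"]
    by (metis add.commute eq_neg_iff_add_eq_0 minus_minus)
  then show ?thesis by (simp add: ef gf add.commute)
qed

text \<open>Both \<open>h 1 - h 0\<close> and \<open>h (- 1) - h 0\<close> send \<open>s\<close> to
  multiples of some \<open>f n\<close>, which commute with \<open>f i\<close>. Applying them to
  \<open>[s, f i] = 0\<close> therefore reaches the neighbouring index. The upward step starts from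
  \<open>[s, f 0] = 0\<close>, the downward step from \<open>[s, f (- 1)] = 0\<close>.\<close>

lemma extra_f: "s \<bullet> f n = 0"
proof (induction n rule: int_induct[of _ 0])
  case base
  show ?case by (rule sf0)
next
  case (step1 i)
  have hs: "(h 1 - h 0) \<bullet> s = - f 0 - f 0"
    using extra_h_difference[OF sf0(1)] by (simp only: add_0)
  have "(h 1 - h 0) \<bullet> (s \<bullet> f i) = s \<bullet> ((h 1 - h 0) \<bullet> f i)"
    using bracket_leibniz[of "h 1 - h 0" s "f i"] unfolding hs by (simp add: ff)
  then have "s \<bullet> f (i + 1) + s \<bullet> f (i + 1) = 0"
    using step1 by (simp add: hf add.commute neg_eq_iff_add_eq_0)
  then show ?case by (simp only: double_eq_0)
next
  case (step2 i)
  have hs: "(h (- 1) - h 0) \<bullet> s = f (- 1) + f (- 1)"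
    using extra_h_difference[OF sf0(2)] by (simp add: algebra_simps)
  have "(h (- 1) - h 0) \<bullet> (s \<bullet> f i) = s \<bullet> ((h (- 1) - h 0) \<bullet> f i)"
    using bracket_leibniz[of "h (- 1) - h 0" s "f i"] unfolding hs by (simp add: ff)
  then have "s \<bullet> f (i - 1) + s \<bullet> f (i - 1) = 0"
    using step2 by (simp add: hf neg_eq_iff_add_eq_0)
  then show ?case by (simp only: double_eq_0)
qed

text \<open>In the model \<open>[e 0, s]\<close> is \<open>h / (t - 1)\<close>, and both sides are
  \<open>- 2 f t^n / (t - 1)\<close>.\<close>

lemma extra_e0_s: "(e 0 \<bullet> s) \<bullet> f n = h n \<bullet> s"
  using bracket_leibniz[of "e 0" s "f n"] bracket_anticommute[of s "h n"] extra_f[of n]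
  by (simp add: ef eq_neg_iff_add_eq_0 add.commute)

lemma extra_inverse: "(e 0 \<bullet> s) \<bullet> (f (n + 1) - f n) = - f n - f n"
  using extra_h_difference[OF extra_f[of n]] by (simp add: extra_e0_s)

end

end

section \<open>Loop generators of the tetrahedron algebra\<close>

locale tet_algebra = lie_algebra_char_0 +
  fixes y :: "4 \<Rightarrow> 4 \<Rightarrow> 'b"
  assumes rel: "tet_relations y"
begin

lemma y_swap: "i \<noteq> j \<Longrightarrow> y j i = - y i j"
  and y_triple: "distinct [i, j, k] \<Longrightarrow> y i j \<bullet> y j k = scale 2 (y i j) + scale 2 (y j k)"
  and y_dg: "distinct [i, j, k, l] \<Longrightarrow>
    y i j \<bullet> (y i j \<bullet> (y i j \<bullet> y k l)) = scale 4 (y i j \<bullet> y k l)"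
  using rel minus_unique[of "y i j" "y j i"] unfolding tet_relations_def by simp_all

lemma scale_2: "scale 2 x = x + x"
  using scale_left_distrib[of 1 1 x] by simp

lemma scale_4: "scale 4 x = (x + x) + (x + x)"
  using scale_left_distrib[of 2 2 x] by (simp add: scale_2)

text \<open>Once \<open>u\<close> and \<open>v\<close> are expanded in eigenvectors of
  \<open>ad g\<close>, the two sides of \<open>dg\<close> differ by exactly 16 times the bracket
  claimed to vanish.\<close>

lemma dolan_grady_serre:
  assumes g: "g \<bullet> e = e" "g \<bullet> f = - f"
    and u: "u = e + e - (g + g)" and v: "v = - (g + g) - (f + f)"
    and dg: "u \<bullet> (u \<bullet> (u \<bullet> v)) = scale 4 (u \<bullet> v)"
  shows "e \<bullet> (e \<bullet> (e \<bullet> f)) = 0"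
proof -
  have eg: "e \<bullet> g = - e" using g bracket_anticommute[of e g] by simp
  have gp: "g \<bullet> (e \<bullet> f) = 0" using bracket_leibniz[of g e f] g by simp
  have gq: "g \<bullet> (e \<bullet> (e \<bullet> f)) = e \<bullet> (e \<bullet> f)" using bracket_leibniz[of g e "e \<bullet> f"] g gp by simp
  let ?r = "e \<bullet> (e \<bullet> (e \<bullet> f))"
  have "((?r + ?r) + (?r + ?r)) + ((?r + ?r) + (?r + ?r)) + (((?r + ?r) + (?r + ?r)) + ((?r + ?r) + (?r + ?r))) = 0"
    using dg unfolding u v scale_4 by (simp add: g eg gp gq algebra_simps)
  then show ?thesis by (simp only: double_eq_0)
qed

lemma halves: "scale (1/2) x + scale (1/2) x = x"
  by (simp flip: scale_left_distrib)

text \<open>Here \<open>s\<close> is half the component of \<open>x 3 0\<close> of weight \<open>-2\<close> with respect to \<open>x 1 2\<close>.\<close>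

lemma loop_presentation:
  obtains e f g k l s where "loop_sequences scale bracket e f g k l"
    "y 1 2 = g + g" "y 2 3 = e 0 + e 0 - (g + g)" "y 2 0 = e 1 + e 1 - (g + g)"
    "y 3 1 = - (g + g) - (f 0 + f 0)" "y 0 1 = - (g + g) - (f (- 1) + f (- 1))"
    "y 3 0 = s + s + (e 0 \<bullet> s + e 0 \<bullet> s) + e 0 \<bullet> (e 0 \<bullet> s) + (g + g) - (e 0 + e 0)"
    "(e 1 - e 0) \<bullet> s = g + g" "s \<bullet> f 0 = 0" "s \<bullet> f (- 1) = 0" "g \<bullet> s = - s"
proof -
  define g where "g = scale (1/2) (y 1 2)"
  define a where "a = scale (1/2) (y 1 2 + y 2 3)"
  define b where "b = scale (1/2) (y 1 2 + y 2 0)"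
  define c where "c = - scale (1/2) (y 1 2 + y 3 1)"
  define d where "d = - scale (1/2) (y 1 2 + y 0 1)"
  define k where "k = scale (1/2) (b \<bullet> c)"
  define l where "l = scale (1/2) (a \<bullet> d)"
  have y12: "y 1 2 = g + g" by (simp only: g_def halves)
  have y23: "y 2 3 = a + a - (g + g)" and y20: "y 2 0 = b + b - (g + g)"
    unfolding g_def a_def b_def halves by simp_all
  have y31: "y 3 1 = - (g + g) - (c + c)" and y01: "y 0 1 = - (g + g) - (d + d)"
    unfolding g_def c_def d_def minus_add_distrib[symmetric] halves by simp_all
  have bc: "b \<bullet> c = k + k" and ad: "a \<bullet> d = l + l" by (simp_all only: k_def l_def halves)
  have ga: "g \<bullet> a = a"
    using y_triple[of 1 2 3] unfolding y12 y23 scale_2 by (simp add: double_cancel)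
  have gb: "g \<bullet> b = b"
    using y_triple[of 1 2 0] unfolding y12 y20 scale_2 by (simp add: double_cancel)
  have "(c \<bullet> g + c \<bullet> g) + (c \<bullet> g + c \<bullet> g) = (c + c) + (c + c)"
    using y_triple[of 3 1 2] unfolding y12 y31 scale_2 by (simp add: algebra_simps)
  then have cg: "c \<bullet> g = c" by (simp only: double_cancel)
  have "(d \<bullet> g + d \<bullet> g) + (d \<bullet> g + d \<bullet> g) = (d + d) + (d + d)"
    using y_triple[of 0 1 2] unfolding y12 y01 scale_2 by (simp add: algebra_simps)
  then have dg: "d \<bullet> g = d" by (simp only: double_cancel)
  have gc: "g \<bullet> c = - c" and gd: "g \<bullet> d = - d"
    using cg dg bracket_anticommute[of g] by simp_all
  have ag: "a \<bullet> g = - a" "b \<bullet> g = - b"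
    using ga gb bracket_anticommute[of _ g] by simp_all
  note w = ga gb gc gd ag cg dg
  have "(a \<bullet> c + a \<bullet> c) + (a \<bullet> c + a \<bullet> c) = ((g + g) + (g + g)) + ((g + g) + (g + g))"
    using y_triple[of 2 3 1] unfolding y31 y23 scale_2 by (simp add: w algebra_simps)
  then have ac: "a \<bullet> c = g + g" by (simp only: double_cancel)
  have "(b \<bullet> d + b \<bullet> d) + (b \<bullet> d + b \<bullet> d) = ((g + g) + (g + g)) + ((g + g) + (g + g))"
    using y_triple[of 2 0 1] unfolding y01 y20 scale_2 by (simp add: w algebra_simps)
  then have bd: "b \<bullet> d = g + g" by (simp only: double_cancel)
  have y32: "y 3 2 = (g + g) - (a + a)" using y_swap[of 2 3] y23 by simp
  have y10: "y 1 0 = (g + g) + (d + d)" using y_swap[of 0 1] y01 by simp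
  have y13: "y 1 3 = (g + g) + (c + c)" using y_swap[of 3 1] y31 by simp
  have y02: "y 0 2 = (g + g) - (b + b)" using y_swap[of 2 0] y20 by simp
  have "(a \<bullet> b + a \<bullet> b) + (a \<bullet> b + a \<bullet> b) = 0"
    using y_triple[of 3 2 0] unfolding y32 y20 scale_2 by (simp add: w algebra_simps)
  then have ab: "a \<bullet> b = 0" by (simp only: double_eq_0)
  have "(c \<bullet> d + c \<bullet> d) + (c \<bullet> d + c \<bullet> d) = 0"
    using y_triple[of 3 1 0] unfolding y31 y10 scale_2 by (simp add: w algebra_simps)
  then have cd: "c \<bullet> d = 0" by (simp only: double_eq_0)
  have serre: "a \<bullet> (a \<bullet> (a \<bullet> d)) = 0" "b \<bullet> (b \<bullet> (b \<bullet> c)) = 0"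
    "c \<bullet> (c \<bullet> (c \<bullet> b)) = 0" "d \<bullet> (d \<bullet> (d \<bullet> a)) = 0"
  proof -
    show "a \<bullet> (a \<bullet> (a \<bullet> d)) = 0"
      by (rule dolan_grady_serre[OF ga gd y23 y01]) (rule y_dg, simp)
    show "b \<bullet> (b \<bullet> (b \<bullet> c)) = 0"
      by (rule dolan_grady_serre[OF gb gc y20 y31]) (rule y_dg, simp)
    \<comment> \<open>Replacing \<open>g\<close> by \<open>- g\<close> turns \<open>c\<close> and
      \<open>d\<close> into raising elements. The matching \<open>u\<close> and \<open>v\<close> are
      then the generators of the reversed edges.\<close>
    show "c \<bullet> (c \<bullet> (c \<bullet> b)) = 0"
      by (rule dolan_grady_serre[of "- g" _ _ "y 1 3" "y 0 2"]) (simp add: gb gc, simp add: gb, simp add: y13, simp add: y02, rule y_dg, simp)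
    show "d \<bullet> (d \<bullet> (d \<bullet> a)) = 0"
      by (rule dolan_grady_serre[of "- g" _ _ "y 1 0" "y 3 2"]) (simp add: gd, simp add: ga, simp add: y10, simp add: y32, rule y_dg, simp)
  qed
  have serre': "u \<bullet> (v \<bullet> u) = 0" if "u \<bullet> (u \<bullet> (u \<bullet> w)) = 0" "u \<bullet> w = v + v \<or> w \<bullet> u = v + v" for u v w
  proof -
    have "u \<bullet> (u \<bullet> v) = 0"
      using that(2)
    proof
      assume "u \<bullet> w = v + v"
      then show ?thesis using that(1) by (simp add: double_eq_0)
    next
      assume "w \<bullet> u = v + v"
      then have "u \<bullet> w = - (v + v)" using bracket_anticommute[of u w] by simp
      then have "u \<bullet> (u \<bullet> (- (v + v))) = 0" using that(1) by simp
      then have "u \<bullet> (u \<bullet> v) + u \<bullet> (u \<bullet> v) = 0" by (simp add: neg_eq_iff_add_eq_0)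
      then show ?thesis by (simp only: double_eq_0)
    qed
    then show ?thesis using bracket_anticommute[of v u] by simp
  qed
  have "a \<bullet> (l \<bullet> a) = 0" "b \<bullet> (k \<bullet> b) = 0" "c \<bullet> (k \<bullet> c) = 0" "d \<bullet> (l \<bullet> d) = 0"
    by (rule serre'[OF serre(1)] serre'[OF serre(2)] serre'[OF serre(3)] serre'[OF serre(4)], simp add: ad bc)+
  then have "loop_base a b c d g k l"
    unfolding loop_base_def using ga gb gc gd ac bd bc ad ab cd by (intro conjI)
  then obtain e f where seq: "e 0 = a" "e 1 = b" "f 0 = c" "f (- 1) = d" "loop_sequences scale bracket e f g k l"
  proof (rule loop_base_sequences, goal_cases)
    case (1 e f)
    have "loop_sequences scale bracket e f g k l"
      by unfold_locales (fact 1(6-10))+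
    then show ?case using 1(1-5) by blast
  qed
  define X where "X = y 3 0"
  define P where "P = g \<bullet> X"
  define R where "R = g \<bullet> P"
  \<comment> \<open>The relation for the disjoint edges \<open>1 2\<close> and \<open>3 0\<close>
    says that the cube of \<open>ad g\<close> agrees with \<open>ad g\<close> on \<open>X\<close>
    (\<open>gR\<close> below). So \<open>X\<close> has components of \<open>g\<close>-weight 0, 1
    and -1, namely \<open>X - R\<close>, \<open>(R + P)/2\<close> and
    \<open>(R - P)/2\<close>.\<close>
  define s where "s = scale (1/4) (R - P)"
  have s4: "(s + s) + (s + s) = R - P"
    unfolding s_def by (simp flip: scale_4)
  have gX: "g \<bullet> X = P" and gP: "g \<bullet> P = R" by (simp_all add: P_def R_def)
  have "((g \<bullet> R + g \<bullet> R) + (g \<bullet> R + g \<bullet> R)) + ((g \<bullet> R + g \<bullet> R) + (g \<bullet> R + g \<bullet> R))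
      = ((P + P) + (P + P)) + ((P + P) + (P + P))"
    using y_dg[of 1 2 3 0] unfolding y12 scale_4 X_def[symmetric]
    by (simp add: gX gP algebra_simps)
  then have gR: "g \<bullet> R = P" by (simp only: double_cancel)
  have "a \<bullet> X + a \<bullet> X = (P + X + (a + a) - (g + g)) + (P + X + (a + a) - (g + g))"
    using y_triple[of 2 3 0] unfolding y23 scale_2 X_def[symmetric]
    by (simp add: gX algebra_simps)
  then have aX: "a \<bullet> X = P + X + (a + a) - (g + g)" by (simp only: double_cancel)
  have y02X: "y 0 2 \<bullet> X = - ((X + X) + (y 0 2 + y 0 2))"
    using y_triple[of 3 0 2] bracket_anticommute[of "y 0 2" X] by (simp add: scale_2 X_def)
  have y01X: "y 0 1 \<bullet> X = - ((X + X) + (y 0 1 + y 0 1))"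
    using y_triple[of 3 0 1] bracket_anticommute[of "y 0 1" X] by (simp add: scale_2 X_def)
  have "b \<bullet> X + b \<bullet> X = (P + X - (b + b) + (g + g)) + (P + X - (b + b) + (g + g))"
    using y02X unfolding y02 by (simp add: gX algebra_simps)
  then have bX: "b \<bullet> X = P + X - (b + b) + (g + g)" by (simp only: double_cancel)
  have "c \<bullet> X + c \<bullet> X = (X - P + (g + g) + (c + c)) + (X - P + (g + g) + (c + c))"
    using y_triple[of 1 3 0] unfolding y13 scale_2 X_def[symmetric]
    by (simp add: gX algebra_simps)
  then have cX: "c \<bullet> X = X - P + (g + g) + (c + c)" by (simp only: double_cancel)
  have "d \<bullet> X + d \<bullet> X = (X - P - (g + g) - (d + d)) + (X - P - (g + g) - (d + d))"
    using y01X unfolding y01 by (simp add: gX algebra_simps)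
  then have dX: "d \<bullet> X = X - P - (g + g) - (d + d)" by (simp only: double_cancel)
  have aP: "a \<bullet> P = R - X + (g + g)"
    using bracket_leibniz[of a g X] by (simp add: gX gP aX w algebra_simps)
  have bP: "b \<bullet> P = R - X - (g + g)"
    using bracket_leibniz[of b g X] by (simp add: gX gP bX w algebra_simps)
  have cP: "c \<bullet> P = X - R + (g + g)"
    using bracket_leibniz[of c g X] by (simp add: gX gP cX w algebra_simps)
  have dP: "d \<bullet> P = X - R - (g + g)"
    using bracket_leibniz[of d g X] by (simp add: gX gP dX w algebra_simps)
  have aR: "a \<bullet> R = X - R - (g + g)"
    using bracket_leibniz[of a g P] by (simp add: gX gP gR aP w algebra_simps)
  have bR: "b \<bullet> R = X - R + (g + g)"
    using bracket_leibniz[of b g P] by (simp add: gX gP gR bP w algebra_simps)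
  have cR: "c \<bullet> R = X - R + (g + g)"
    using bracket_leibniz[of c g P] by (simp add: gX gP gR cP w algebra_simps)
  have dR: "d \<bullet> R = X - R - (g + g)"
    using bracket_leibniz[of d g P] by (simp add: gX gP gR dP w algebra_simps)
  have cs: "c \<bullet> s = 0" and ds: "d \<bullet> s = 0"
    by (simp_all add: s_def cP cR dP dR)
  have as4: "(a \<bullet> s + a \<bullet> s) + (a \<bullet> s + a \<bullet> s) = (X - R - (g + g)) + (X - R - (g + g))"
    using arg_cong[OF s4, of "(\<bullet>) a"] by (simp add: aP aR algebra_simps)
  then have as2: "a \<bullet> s + a \<bullet> s = X - R - (g + g)" by (simp only: double_cancel)
  have "(b \<bullet> s + b \<bullet> s) + (b \<bullet> s + b \<bullet> s) = (X - R + (g + g)) + (X - R + (g + g))"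
    using arg_cong[OF s4, of "(\<bullet>) b"] by (simp add: bP bR algebra_simps)
  then have bs2: "b \<bullet> s + b \<bullet> s = X - R + (g + g)" by (simp only: double_cancel)
  have "(b - a) \<bullet> s + (b - a) \<bullet> s = (g + g) + (g + g)"
  proof -
    have "(b - a) \<bullet> s + (b - a) \<bullet> s = (b \<bullet> s + b \<bullet> s) - (a \<bullet> s + a \<bullet> s)" by simp
    then show ?thesis unfolding as2 bs2 by simp
  qed
  then have bas: "(b - a) \<bullet> s = g + g" by (simp only: double_cancel)
  have aas2: "a \<bullet> (a \<bullet> s) + a \<bullet> (a \<bullet> s) = P + R + ((a + a) + (a + a))"
    using arg_cong[OF as2, of "(\<bullet>) a"] by (simp add: aX aR w algebra_simps)
  \<comment> \<open>Each component of \<open>X\<close> is recovered from \<open>s\<close>: weight -1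
    is \<open>2 s\<close>, weight 0 is \<open>X - R = 2 [a, s] + 2 g\<close> by \<open>as2\<close>,
    and weight 1 is \<open>(P + R)/2 = [a, [a, s]] - 2 a\<close> by \<open>aas2\<close>.\<close>
  let ?Y = "s + s + (a \<bullet> s + a \<bullet> s) + a \<bullet> (a \<bullet> s) + (g + g) - (a + a)"
  have "?Y + ?Y = ((s + s) + (s + s)) + ((a \<bullet> s + a \<bullet> s) + (a \<bullet> s + a \<bullet> s))
      + (a \<bullet> (a \<bullet> s) + a \<bullet> (a \<bullet> s)) + ((g + g) + (g + g)) - ((a + a) + (a + a))"
    by (simp add: algebra_simps)
  then have "X + X = ?Y + ?Y"
    unfolding s4 as2 aas2 by (simp add: algebra_simps)
  then have X: "X = s + s + (a \<bullet> s + a \<bullet> s) + a \<bullet> (a \<bullet> s) + (g + g) - (a + a)"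
    by (simp only: double_cancel)
  have gs: "g \<bullet> s = - s"
    unfolding s_def by (simp add: gP gR scale_right_diff_distrib)
  show ?thesis
    using that[of e f g k l s] gs seq y12 y23 y20 y31 y01 X bas cs ds
      bracket_anticommute[of s c] bracket_anticommute[of s d]
    by (simp add: X_def)
qed

end

section \<open>Linear algebra\<close>

locale endomorphism = vector_space scale
  for scale :: "'k::field \<Rightarrow> 'v::ab_group_add \<Rightarrow> 'v" +
  fixes T :: "'v \<Rightarrow> 'v"
  assumes linear_T: "Vector_Spaces.linear scale scale T"
begin

sublocale T: Vector_Spaces.linear scale scale T
  by (rule linear_T)

definition poly_act :: "'k poly \<Rightarrow> 'v \<Rightarrow> 'v" where
  "poly_act p x = fold_coeffs (\<lambda>a r. scale a x + T r) p 0"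

lemma poly_act_0 [simp]: "poly_act 0 x = 0"
  by (simp add: poly_act_def)

lemma poly_act_pCons [simp]: "poly_act (pCons a p) x = scale a x + T (poly_act p x)"
  by (cases "p = 0 \<and> a = 0") (auto simp: poly_act_def)

lemma poly_act_right_add: "poly_act p (x + y) = poly_act p x + poly_act p y"
  by (induction p) (simp_all add: T.add scale_right_distrib algebra_simps)

lemma poly_act_right_scale: "poly_act p (scale c x) = scale c (poly_act p x)"
  by (induction p) (simp_all add: T.scale scale_right_distrib mult.commute)

lemma linear_poly_act: "Vector_Spaces.linear scale scale (poly_act p)"
  by unfold_locales (simp_all add: poly_act_right_add poly_act_right_scale)

lemma poly_act_add: "poly_act (p + q) x = poly_act p x + poly_act q x"
  by (induction p q rule: poly_induct2) (simp_all add: T.add scale_left_distrib algebra_simps)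

lemma poly_act_smult: "poly_act (smult c p) x = scale c (poly_act p x)"
  by (induction p) (simp_all add: T.scale scale_right_distrib)

lemma poly_act_mult: "poly_act (p * q) x = poly_act p (poly_act q x)"
  by (induction p) (simp_all add: poly_act_add poly_act_smult)

lemma poly_act_eigenvector: "T x = scale \<theta> x \<Longrightarrow> poly_act p x = scale (poly p \<theta>) x"
  by (induction p) (simp_all add: T.scale scale_left_distrib mult.commute)

lemma poly_act_in_subspace:
  assumes "subspace W" "\<And>x. x \<in> W \<Longrightarrow> T x \<in> W" "x \<in> W"
  shows "poly_act p x \<in> W"
  by (induction p) (use assms in \<open>auto intro: subspace_0 subspace_add subspace_scale\<close>)

end

context vector_space
begin

lemma finite_dimensional_sequence:
  assumes "finite_dimensional scale"
  obtains n where "s n \<in> span (s ` {..<n::nat})"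
proof (rule ccontr)
  assume *: "\<not> thesis"
  obtain B where B: "finite B" "span B = UNIV"
    using assms by (auto simp: finite_dimensional_def)
  have "independent (s ` {..<n}) \<and> card (s ` {..<n}) = n" for n
  proof (induction n)
    case (Suc n)
    have "s n \<notin> span (s ` {..<n})" using * that by blast
    then show ?case
      using Suc span_superset[of "s ` {..<n}"] by (auto simp: lessThan_Suc independent_insert)
  qed (simp add: independent_empty)
  from this[of "Suc (card B)"] show False
    using independent_span_bound[OF B(1), of "s ` {..<Suc (card B)}"] B(2) by auto
qed

end

context endomorphism
begin

lemma annihilating_poly_vector:
  assumes "finite_dimensional scale"
  obtains p where "p \<noteq> 0" "poly_act p x = 0"
proof -
  obtain n where n: "(T ^^ n) x \<in> span ((\<lambda>i. (T ^^ i) x) ` {..<n})"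
    by (rule finite_dimensional_sequence[OF assms])
  have monom: "poly_act (monom 1 i) x = (T ^^ i) x" for i
    by (induction i) (simp_all add: monom_0 monom_Suc T.zero)
  \<comment> \<open>A vanishing coefficient at \<open>n\<close> is all that must be tracked: it
    already guarantees that \<open>monom 1 n\<close> minus \<open>q\<close> is a nonzero
    polynomial.\<close>
  define S where "S = {y. \<exists>q. coeff q n = 0 \<and> y = poly_act q x}"
  have "subspace S"
  proof (rule subspaceI)
    show "0 \<in> S" unfolding S_def by (auto intro!: exI[of _ 0])
    fix y z assume "y \<in> S" "z \<in> S"
    then obtain p q where "coeff p n = 0" "y = poly_act p x" "coeff q n = 0" "z = poly_act q x"
      by (auto simp: S_def)
    then show "y + z \<in> S" unfolding S_def by (auto intro!: exI[of _ "p + q"] simp: poly_act_add)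
  next
    fix c y assume "y \<in> S"
    then obtain q where "coeff q n = 0" "y = poly_act q x"
      by (auto simp: S_def)
    then show "scale c y \<in> S" unfolding S_def by (auto intro!: exI[of _ "smult c q"] simp: poly_act_smult)
  qed
  moreover have "(\<lambda>i. (T ^^ i) x) ` {..<n} \<subseteq> S"
  proof
    fix y assume "y \<in> (\<lambda>i. (T ^^ i) x) ` {..<n}"
    then obtain i where "i < n" "y = (T ^^ i) x" by auto
    then show "y \<in> S" unfolding S_def by (auto intro!: exI[of _ "monom 1 i"] simp: monom)
  qed
  ultimately have "(T ^^ n) x \<in> S" using n span_minimal by blast
  then obtain q where q: "coeff q n = 0" "(T ^^ n) x = poly_act q x" by (auto simp: S_def)
  have "coeff (monom 1 n + smult (- 1) q) n = 1" using q by simp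
  then have "monom 1 n + smult (- 1) q \<noteq> 0" by (metis coeff_0 zero_neq_one)
  moreover have "poly_act (monom 1 n + smult (- 1) q) x = 0"
    unfolding poly_act_add poly_act_smult monom q by simp
  ultimately show ?thesis using that by blast
qed

lemma annihilating_poly:
  assumes "finite_dimensional scale"
  shows "\<exists>p. p \<noteq> 0 \<and> (\<forall>x. poly_act p x = 0)"
proof -
  obtain B where B: "finite B" "span B = UNIV"
    using assms by (auto simp: finite_dimensional_def)
  have "\<exists>p. p \<noteq> 0 \<and> (\<forall>x\<in>B. poly_act p x = 0)"
    using B(1)
  proof (induction B)
    case (insert b B)
    then obtain p where p: "p \<noteq> 0" "\<forall>x\<in>B. poly_act p x = 0" by blast
    obtain q where q: "q \<noteq> 0" "poly_act q b = 0" by (rule annihilating_poly_vector[OF assms])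
    interpret pl: Vector_Spaces.linear scale scale "poly_act r" for r by (rule linear_poly_act)
    have "poly_act (p * q) b = 0" "\<forall>x\<in>B. poly_act (q * p) x = 0"
      using p q by (simp_all add: poly_act_mult pl.zero)
    then show ?case using p q by (intro exI[of _ "p * q"]) (simp add: mult.commute)
  qed (auto intro: exI[of _ 1])
  then obtain p where p: "p \<noteq> 0" "\<forall>x\<in>B. poly_act p x = 0" by blast
  interpret pl: Vector_Spaces.linear scale scale "poly_act p" by (rule linear_poly_act)
  have "poly_act p x = 0" for x
    using pl.eq_0_on_span[of B x] p B by auto
  with p show ?thesis by blast
qed

definition eigenspace where "eigenspace \<theta> = {v. T v = scale \<theta> v}"

lemma subspace_eigenspace: "subspace (eigenspace \<theta>)"
  by (rule subspaceI) (auto simp: eigenspace_def T.add T.zero T.scale scale_right_distrib mult.commute)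

lemma finite_eigenvalues:
  assumes "finite_dimensional scale"
  shows "finite {\<theta>. eigenspace \<theta> \<noteq> {0}}"
proof -
  from annihilating_poly[OF assms]
  obtain p where p: "p \<noteq> 0" "\<forall>x. poly_act p x = 0"
    by (elim exE conjE)
  have "poly p \<theta> = 0" if "eigenspace \<theta> \<noteq> {0}" for \<theta>
  proof -
    have "\<exists>x. x \<noteq> 0 \<and> x \<in> eigenspace \<theta>"
      using that subspace_0[OF subspace_eigenspace[of \<theta>]] by fast
    then obtain x where "x \<noteq> 0" "x \<in> eigenspace \<theta>" by (elim exE conjE)
    then have "x \<noteq> 0" "T x = scale \<theta> x" by (simp_all add: eigenspace_def)
    then show ?thesis using poly_act_eigenvector[of x \<theta> p] p by simp
  qed
  then show ?thesis using poly_roots_finite[OF p(1)] by (auto intro: finite_subset[rotated])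
qed

text \<open>Every vector of the span is annihilated by some polynomial in \<open>T\<close> that does
  not vanish at \<mu>; such polynomials are closed under products, and each generator has a linear
  one. On \<open>x\<close> the polynomial acts as a nonzero scalar.\<close>

lemma eigenspace_Int_span:
  assumes "x \<in> span (\<Union>\<theta>\<in>\<Theta>. eigenspace \<theta>)" "x \<in> eigenspace \<mu>" "\<mu> \<notin> \<Theta>"
  shows "x = 0"
proof -
  define S where "S = {y. \<exists>p. poly p \<mu> \<noteq> 0 \<and> poly_act p y = 0}"
  interpret pl: Vector_Spaces.linear scale scale "poly_act r" for r by (rule linear_poly_act)
  have "subspace S"
  proof (rule subspaceI)
    show "0 \<in> S" unfolding S_def by (auto intro!: exI[of _ 1] simp: T.zero)
    fix y z assume "y \<in> S" "z \<in> S"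
    then obtain p q where pq: "poly p \<mu> \<noteq> 0" "poly_act p y = 0" "poly q \<mu> \<noteq> 0" "poly_act q z = 0"
      by (auto simp: S_def)
    then have "poly_act (p * q) z = 0" "poly_act (q * p) y = 0" by (simp_all add: poly_act_mult pl.zero)
    then have "poly_act (p * q) (y + z) = 0" by (simp add: poly_act_right_add mult.commute)
    then show "y + z \<in> S" unfolding S_def using pq by (auto intro!: exI[of _ "p * q"])
  next
    fix c y assume "y \<in> S"
    then show "scale c y \<in> S" unfolding S_def by (auto simp: poly_act_right_scale)
  qed
  moreover have "(\<Union>\<theta>\<in>\<Theta>. eigenspace \<theta>) \<subseteq> S"
  proof
    fix y assume "y \<in> (\<Union>\<theta>\<in>\<Theta>. eigenspace \<theta>)"
    then obtain \<theta> where "\<theta> \<in> \<Theta>" "T y = scale \<theta> y" by (auto simp: eigenspace_def)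
    then show "y \<in> S"
      using assms(3) by (auto simp: S_def T.zero T.neg T.scale intro!: exI[of _ "[:- \<theta>, 1:]"])
  qed
  ultimately have "x \<in> S" using assms(1) span_minimal by blast
  then obtain p where p: "poly p \<mu> \<noteq> 0" "poly_act p x = 0" by (auto simp: S_def)
  then show ?thesis using poly_act_eigenvector[of x \<mu> p] assms(2) by (simp add: eigenspace_def)
qed

end

lemma (in endomorphism) eigenvector_in_subspace:
  assumes root: "\<And>p :: 'k poly. degree p > 0 \<Longrightarrow> \<exists>z. poly p z = 0"
    and "finite_dimensional scale" and W: "subspace W" "\<And>x. x \<in> W \<Longrightarrow> T x \<in> W" "x \<in> W" "x \<noteq> 0"
  obtains \<theta> v where "v \<in> W" "v \<noteq> 0" "T v = scale \<theta> v"
proof -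
  obtain p where p: "p \<noteq> 0" "poly_act p x = 0"
    by (rule annihilating_poly_vector[OF assms(2)])
  have "\<exists>\<theta> v. v \<in> W \<and> v \<noteq> 0 \<and> T v = scale \<theta> v"
    using p
  proof (induction "degree p" arbitrary: p rule: less_induct)
    case less
    show ?case
    proof (cases "degree p = 0")
      case True
      then show ?thesis using less W by (auto elim!: degree_eq_zeroE simp: T.zero)
    next
      case False
      then obtain z where "poly p z = 0" using root by blast
      then obtain q where q: "p = [:- z, 1:] * q" using poly_eq_0_iff_dvd by (metis dvdE)
      have "q \<noteq> 0" using q less by auto
      then have "degree q < degree p" unfolding q by (subst degree_mult_eq) auto
      show ?thesis
      proof (cases "poly_act q x = 0")
        case True
        then show ?thesis using less(1) \<open>q \<noteq> 0\<close> \<open>degree q < degree p\<close> by blast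
      next
        case False
        have "T (poly_act q x) = scale z (poly_act q x)"
          using less(3) by (simp add: q poly_act_mult T.zero flip: add_eq_0_iff del: mult_pCons_left)
        then show ?thesis using False poly_act_in_subspace[OF W(1-3)] by blast
      qed
    qed
  qed
  with that show ?thesis by blast
qed

lemma alg_closed_root:
  fixes p :: "'k::alg_closed_field poly"
  assumes "degree p > 0"
  shows "\<exists>z. poly p z = 0"
  using alg_closed_imp_poly_has_root[OF assms] by blast

text \<open>The family may be infinite, so the induction is on the dimension of \<open>W\<close>. If
  some operator is not scalar on \<open>W\<close>, one of its eigenspaces in \<open>W\<close> is
  nonzero, proper, and invariant under all operators by commutativity.\<close>

lemma (in vector_space) common_eigenvector:
  assumes root: "\<And>p :: 'a poly. degree p > 0 \<Longrightarrow> \<exists>z. poly p z = 0"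
    and fd: "finite_dimensional scale"
    and T: "\<And>i. Vector_Spaces.linear scale scale (T i)" "\<And>i j x. T i (T j x) = T j (T i x)"
    and W: "subspace W" "W \<noteq> {0}" "\<And>i x. x \<in> W \<Longrightarrow> T i x \<in> W"
  obtains v where "v \<in> W" "v \<noteq> 0" "\<And>i. \<exists>\<theta>. T i v = scale \<theta> v"
proof -
  obtain B where B: "finite B" "span B = UNIV"
    using fd by (auto simp: finite_dimensional_def)
  obtain B' where B': "B' \<subseteq> B" "independent B'" "B \<subseteq> span B'"
    by (rule maximal_independent_subset)
  interpret fd: finite_dimensional_vector_space scale B'
    using B B' finite_subset span_mono[OF B'(3)] by unfold_locales (auto simp: span_span)
  have "\<exists>v\<in>W. v \<noteq> 0 \<and> (\<forall>i. \<exists>\<theta>. T i v = scale \<theta> v)"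
    using W
  proof (induction "dim W" arbitrary: W rule: less_induct)
    case less
    note W = less(2-4)
    show ?case
    proof (cases "\<forall>i. \<exists>\<theta>. \<forall>x\<in>W. T i x = scale \<theta> x")
      case True
      moreover obtain v where "v \<in> W" "v \<noteq> 0" using W(1,2) subspace_0 by blast
      ultimately show ?thesis by blast
    next
      case False
      then obtain i where i: "\<And>\<theta>. \<exists>x\<in>W. T i x \<noteq> scale \<theta> x" by blast
      interpret Ti: endomorphism scale "T i"
        using T(1) vector_space_axioms by (simp add: endomorphism_def endomorphism_axioms_def)
      obtain x where "x \<in> W" "x \<noteq> 0" using W(1,2) subspace_0 by blast
      then obtain \<theta> v where v: "v \<in> W" "v \<noteq> 0" "T i v = scale \<theta> v"
        using Ti.eigenvector_in_subspace[OF root fd W(1) W(3)] by metis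
      define W' where "W' = W \<inter> Ti.eigenspace \<theta>"
      have W': "subspace W'" unfolding W'_def by (intro subspace_inter W Ti.subspace_eigenspace)
      have "W' \<subset> W" using i[of \<theta>] by (auto simp: W'_def Ti.eigenspace_def)
      then have "dim W' < dim W" using fd.dim_psubset[of W' W] W' W(1) by (simp add: span_eq_iff[THEN iffD2])
      moreover have "W' \<noteq> {0}" using v by (auto simp: W'_def Ti.eigenspace_def)
      moreover have "T j x \<in> W'" if "x \<in> W'" for j x
      proof -
        interpret Tj: Vector_Spaces.linear scale scale "T j" by (rule T)
        show ?thesis using that W(3) T(2)[of i j x] by (auto simp: W'_def Ti.eigenspace_def Tj.scale)
      qed
      ultimately have "\<exists>v\<in>W'. v \<noteq> 0 \<and> (\<forall>i. \<exists>\<theta>. T i v = scale \<theta> v)"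
        by (intro less(1)[OF _ W']) 
      then show ?thesis using W'_def by blast
    qed
  qed
  with that show ?thesis by blast
qed

section \<open>Spaces of operators and a dimension count\<close>

lemma (in vector_space) vector_space_fun: "vector_space (\<lambda>c (g::'c \<Rightarrow> 'b) x. scale c (g x))"
  by unfold_locales (simp_all add: fun_eq_iff scale_right_distrib scale_left_distrib)

text \<open>The space of all maps on \<open>V\<close> need not be finite-dimensional, but the matrix
  units \<open>E b c\<close> capture the linear ones. This supplies the finite bound for dimension
  counts among the operators \<open>act a\<close>.\<close>

lemma (in vector_space) linear_maps_in_finite_span:
  assumes "finite_dimensional scale"
  shows "\<exists>G. finite G \<and> (\<forall>g. Vector_Spaces.linear scale scale g \<longrightarrow>
    g \<in> module.span (\<lambda>c (g::'b \<Rightarrow> 'b) x. scale c (g x)) G)"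
proof -
  interpret fs: vector_space "\<lambda>c (g::'b \<Rightarrow> 'b) x. scale c (g x)"
    by (rule vector_space_fun)
  obtain A where A: "finite A" "span A = UNIV"
    using assms by (auto simp: finite_dimensional_def)
  obtain B where B: "B \<subseteq> A" "independent B" "A \<subseteq> span B"
    by (rule maximal_independent_subset)
  have fin: "finite B" using A B finite_subset by blast
  have span: "x \<in> span B" for x
    using A(2) B(3) span_minimal[of A "span B"] by auto
  define E where "E b c x = scale (representation B x b) c" for b c x
  have rep: "x = (\<Sum>b\<in>B. scale (representation B x b) b)" for x
    using sum_representation_eq[OF B(2) span fin order_refl] by simp
  have "g \<in> fs.span ((\<lambda>(b, c). E b c) ` (B \<times> B))" if "Vector_Spaces.linear scale scale g" for g
  proof -
    interpret g: Vector_Spaces.linear scale scale g by (rule that)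
    have sum_apply: "(\<Sum>b\<in>B. F b) x = (\<Sum>b\<in>B. F b x)" for F :: "'b \<Rightarrow> 'b \<Rightarrow> 'b" and x
      using fin by (induction B) simp_all
    have "g x = (\<Sum>b\<in>B. \<Sum>c\<in>B. (\<lambda>x. scale (representation B (g b) c) (E b c x))) x" for x
    proof -
      have "g x = (\<Sum>b\<in>B. scale (representation B x b) (g b))"
        by (subst rep[of x]) (simp add: g.sum g.scale)
      also have "\<dots> = (\<Sum>b\<in>B. \<Sum>c\<in>B. scale (representation B (g b) c) (E b c x))"
      proof (rule sum.cong[OF HOL.refl])
        fix b assume "b \<in> B"
        have "scale (representation B x b) (g b)
            = scale (representation B x b) (\<Sum>c\<in>B. scale (representation B (g b) c) c)"
          using rep[of "g b"] by (rule arg_cong)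
        then show "scale (representation B x b) (g b)
            = (\<Sum>c\<in>B. scale (representation B (g b) c) (E b c x))"
          by (simp only: scale_sum_right E_def scale_scale mult.commute)
      qed
      finally show ?thesis by (simp add: sum_apply)
    qed
    then have "g = (\<Sum>b\<in>B. \<Sum>c\<in>B. (\<lambda>x. scale (representation B (g b) c) (E b c x)))" by blast
    also have "\<dots> \<in> fs.span ((\<lambda>(b, c). E b c) ` (B \<times> B))"
      by (intro fs.span_sum fs.span_scale fs.span_base) auto
    finally show ?thesis .
  qed
  then show ?thesis using fin by (intro exI[of _ "(\<lambda>(b, c). E b c) ` (B \<times> B)"]) auto
qed

text \<open>If \<open>s\<close> lay outside, \<open>D\<close> would embed a space of dimension one
  more than that of the span of \<open>A\<close> into that span; the left inverse \<open>K\<close>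
  gives injectivity.\<close>

lemma (in vector_space) in_span_of_injective:
  assumes fin: "finite G" "A \<subseteq> span G"
    and D: "Vector_Spaces.linear scale scale D" "D ` insert s A \<subseteq> span A"
    and K: "Vector_Spaces.linear scale scale K" "\<And>x. x \<in> insert s A \<Longrightarrow> K (D x) = x"
  shows "s \<in> span A"
proof (rule ccontr)
  assume s: "s \<notin> span A"
  interpret D: Vector_Spaces.linear scale scale D by (rule D)
  interpret K: Vector_Spaces.linear scale scale K by (rule K)
  obtain B where B: "B \<subseteq> A" "independent B" "A \<subseteq> span B"
    by (rule maximal_independent_subset)
  have AB: "span A = span B"
    using span_mono[OF B(1)] span_minimal[OF B(3)] by auto
  have finB: "finite B"
    using independent_span_bound[OF fin(1) B(2)] B(1) fin(2) by blast
  have ind: "independent (insert s B)" and sB: "s \<notin> B"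
    using s B AB span_superset by (auto simp: independent_insert)
  have KD: "K (D x) = x" if "x \<in> span (insert s B)" for x
    using that
  proof (induction rule: span_induct)
    case base
    have "subspace {x. K (D x) = x}"
      by (rule subspaceI) (simp_all add: D.zero K.zero D.add K.add D.scale K.scale)
    then show ?case .
  next
    case (step x)
    then show ?case using K(2) B(1) by blast
  qed
  then have inj: "inj_on D (span (insert s B))" by (rule inj_on_inverseI)
  have "independent (D ` insert s B)" by (rule D.independent_injective_image[OF ind inj])
  moreover have "D ` insert s B \<subseteq> span B" using D(2) B(1) AB by blast
  ultimately have "card (D ` insert s B) \<le> card B"
    using independent_span_bound[OF finB] by blast
  moreover have "card (D ` insert s B) = card (insert s B)"
    by (rule card_image[OF inj_on_subset[OF inj span_superset]])
  ultimately show False using finB sB by simp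
qed

section \<open>Invariant forms on irreducible loop modules\<close>

lemma (in lie_module) irreducible_subspace:
  assumes "irreducible_action scaleV act" "V.subspace W" "\<And>a w. w \<in> W \<Longrightarrow> act a w \<in> W"
    "v \<in> W" "v \<noteq> 0"
  shows "x \<in> W"
proof -
  have "W = {0} \<or> W = UNIV"
    using assms(1-3) unfolding irreducible_action_def by blast
  then show ?thesis using assms(4,5) by auto
qed

text \<open>The algebra itself may exceed the loop generators; only its action has to come from
  them. Hence the last closure condition in \<open>generated\<close>, which allows an element to be
  replaced by one with the same action. By \<open>weights\<close>, \<open>d\<close> is the largest
  weight of \<open>h 0\<close>.\<close>

locale loop_module = lie_module scaleL bracket scaleV act
  for scaleL :: "'k::{alg_closed_field, field_char_0} \<Rightarrow> 'l::ab_group_add \<Rightarrow> 'l"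
    and bracket :: "'l \<Rightarrow> 'l \<Rightarrow> 'l"
    and scaleV :: "'k \<Rightarrow> 'v::ab_group_add \<Rightarrow> 'v"
    and act :: "'l \<Rightarrow> 'v \<Rightarrow> 'v" +
  fixes e f h :: "int \<Rightarrow> 'l" and d :: nat
  assumes ee: "bracket (e m) (e n) = 0" and ff: "bracket (f m) (f n) = 0"
    and hh: "bracket (h m) (h n) = 0" and ef: "bracket (e m) (f n) = h (m + n)"
    and he: "bracket (h m) (e n) = scaleL 2 (e (m + n))"
    and hf: "bracket (h m) (f n) = scaleL (- 2) (f (m + n))"
    and generated: "\<And>P \<xi>. \<lbrakk>\<And>n. P (e n); \<And>n. P (f n); \<And>a b. P a \<Longrightarrow> P b \<Longrightarrow> P (a + b);
      \<And>c a. P a \<Longrightarrow> P (scaleL c a); \<And>a b. P a \<Longrightarrow> P b \<Longrightarrow> P (bracket a b);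
      \<And>a b. P a \<Longrightarrow> act a = act b \<Longrightarrow> P b\<rbrakk> \<Longrightarrow> P \<xi>"
    and irreducible: "irreducible_action scaleV act"
    and finite_dim: "finite_dimensional scaleV"
    and diagonalizable: "V.span (\<Union>\<theta>. {x. act (h 0) x = scaleV \<theta> x}) = UNIV"
    and weights: "(\<exists>x. x \<noteq> 0 \<and> act (h 0) x = scaleV \<theta> x) \<longleftrightarrow>
      (\<exists>n\<le>d. \<theta> = of_int (int d - 2 * int n))"
begin

sublocale act: Vector_Spaces.linear scaleV scaleV "act a" for a
  by (rule linear_act)

sublocale act_left: Vector_Spaces.linear scaleL scaleV "\<lambda>a. act a x" for x
  by (rule linear_act_left)

sublocale H: endomorphism scaleV "act (h 0)"
  using linear_act V.vector_space_axioms by (simp add: endomorphism_def endomorphism_axioms_def)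

abbreviation weight_space where "weight_space \<theta> \<equiv> H.eigenspace \<theta>"

lemma act_commute: "act a (act b x) = act b (act a x) + act (bracket a b) x"
  by (simp add: act_bracket)

lemma act_ef: "act (e m) (act (f n) x) = act (f n) (act (e m) x) + act (h (m + n)) x"
  using act_commute[of "e m"] by (simp add: ef)

lemma act_hf: "act (h m) (act (f n) x) = act (f n) (act (h m) x) - scaleV 2 (act (f (m + n)) x)"
  using act_commute[of "h m"] by (simp add: hf act_left.scale act_left.neg)

lemma act_he: "act (h m) (act (e n) x) = act (e n) (act (h m) x) + scaleV 2 (act (e (m + n)) x)"
  using act_commute[of "h m"] by (simp add: he act_left.scale)

lemma act_hh: "act (h m) (act (h n) x) = act (h n) (act (h m) x)"
  using act_commute[of "h m"] by (simp add: hh act_left.zero)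

lemma act_ff: "act (f m) (act (f n) x) = act (f n) (act (f m) x)"
  using act_commute[of "f m"] by (simp add: ff act_left.zero)

lemma weight_f: "x \<in> weight_space \<theta> \<Longrightarrow> act (f n) x \<in> weight_space (\<theta> - 2)"
  by (simp add: H.eigenspace_def act_hf act.scale V.scale_left_diff_distrib)

lemma weight_e: "x \<in> weight_space \<theta> \<Longrightarrow> act (e n) x \<in> weight_space (\<theta> + 2)"
  by (simp add: H.eigenspace_def act_he act.scale V.scale_left_distrib)

lemma weight_h: "x \<in> weight_space \<theta> \<Longrightarrow> act (h n) x \<in> weight_space \<theta>"
  using act_hh[of 0 n x] by (simp add: H.eigenspace_def act.scale)

lemma weight_eq_0: "x \<in> weight_space \<theta> \<Longrightarrow> \<forall>n\<le>d. \<theta> \<noteq> of_int (int d - 2 * int n) \<Longrightarrow> x = 0"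
  using weights[of \<theta>] by (auto simp: H.eigenspace_def)

lemma weight_above: "x \<in> weight_space (of_nat d + 2) \<Longrightarrow> x = 0"
proof (erule weight_eq_0, intro allI impI notI)
  fix n assume "(of_nat d + 2 :: 'k) = of_int (int d - 2 * int n)"
  then have "of_int (int d + 2) = (of_int (int d - 2 * int n) :: 'k)" by simp
  then have "int d + 2 = int d - 2 * int n" unfolding of_int_eq_iff .
  then show False by simp
qed

lemma weight_below: "x \<in> weight_space (- of_nat d - 2) \<Longrightarrow> x = 0"
proof (erule weight_eq_0, intro allI impI notI)
  fix n assume n: "n \<le> d" "(- of_nat d - 2 :: 'k) = of_int (int d - 2 * int n)"
  then have "of_int (- int d - 2) = (of_int (int d - 2 * int n) :: 'k)" by simp
  then have "- int d - 2 = int d - 2 * int n" unfolding of_int_eq_iff .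
  then show False using n(1) by simp
qed

section \<open>Highest weight vectors of \<open>V\<close> and of its dual\<close>

definition highest_weight :: "'v \<Rightarrow> (int \<Rightarrow> 'k) \<Rightarrow> bool" where
  "highest_weight v \<Lambda> \<longleftrightarrow> v \<noteq> 0 \<and> \<Lambda> 0 = of_nat d \<and> (\<forall>n. act (h n) v = scaleV (\<Lambda> n) v)"

lemma highest_weight_exists: "\<exists>v \<Lambda>. highest_weight v \<Lambda>"
proof -
  have "\<exists>x. x \<noteq> 0 \<and> act (h 0) x = scaleV (of_nat d) x"
    using weights[of "of_nat d"] by (auto intro!: exI[of _ 0])
  then have "weight_space (of_nat d) \<noteq> {0}" by (auto simp: H.eigenspace_def)
  then obtain v where v: "v \<in> weight_space (of_nat d)" "v \<noteq> 0" "\<And>n. \<exists>\<theta>. act (h n) v = scaleV \<theta> v"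
    using V.common_eigenvector[OF alg_closed_root finite_dim, of "\<lambda>n. act (h n)" "weight_space (of_nat d)"]
      linear_act act_hh H.subspace_eigenspace weight_h by metis
  then obtain \<Lambda> where \<Lambda>: "\<And>n. act (h n) v = scaleV (\<Lambda> n) v" by metis
  have "\<Lambda> 0 = of_nat d" using \<Lambda>[of 0] v by (simp add: H.eigenspace_def)
  with v \<Lambda> show ?thesis unfolding highest_weight_def by blast
qed

lemma highest_weight_space: "highest_weight v \<Lambda> \<Longrightarrow> v \<in> weight_space (of_nat d)"
  by (simp add: highest_weight_def H.eigenspace_def)

lemma highest_weight_e: "highest_weight v \<Lambda> \<Longrightarrow> act (e n) v = 0"
  using weight_above[OF weight_e[OF highest_weight_space]] .

text \<open>For the dual action, in which \<xi> sends \<phi> to the negative of \<phi> composed with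
  \<xi>, these equations say that every \<open>e n\<close> kills \<phi> and that \<open>h n\<close>
  has eigenvalue \<open>\<Lambda> n\<close> on it, as on \<open>v\<close>. The zero functional
  qualifies.\<close>

definition dual_highest_weight :: "('v \<Rightarrow> 'k) \<Rightarrow> (int \<Rightarrow> 'k) \<Rightarrow> bool" where
  "dual_highest_weight \<phi> \<Lambda> \<longleftrightarrow> Vector_Spaces.linear scaleV (*) \<phi> \<and>
     (\<forall>n x. \<phi> (act (e n) x) = 0) \<and> (\<forall>n x. \<phi> (act (h n) x) = - \<Lambda> n * \<phi> x)"

text \<open>The submodule of \<open>V \<oplus> V*\<close> generated by \<open>(v, \<phi>)\<close>, where \<open>\<xi>\<close> acts on a functional
  \<open>\<alpha>\<close> as \<open>- \<alpha> \<circ> \<xi>\<close>; the lowering operators \<open>f n\<close> suffice.\<close>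

inductive pair_orbit :: "'v \<Rightarrow> ('v \<Rightarrow> 'k) \<Rightarrow> 'v \<Rightarrow> ('v \<Rightarrow> 'k) \<Rightarrow> bool" for v \<phi> where
  base: "pair_orbit v \<phi> v \<phi>"
| add: "pair_orbit v \<phi> u \<alpha> \<Longrightarrow> pair_orbit v \<phi> u' \<alpha>' \<Longrightarrow> pair_orbit v \<phi> (u + u') (\<lambda>x. \<alpha> x + \<alpha>' x)"
| scale: "pair_orbit v \<phi> u \<alpha> \<Longrightarrow> pair_orbit v \<phi> (scaleV c u) (\<lambda>x. c * \<alpha> x)"
| lower: "pair_orbit v \<phi> u \<alpha> \<Longrightarrow> pair_orbit v \<phi> (act (f n) u) (\<lambda>x. - \<alpha> (act (f n) x))"

lemma linear_functional_iff:
  "Vector_Spaces.linear scaleV (*) \<alpha> \<longleftrightarrow>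
     (\<forall>x y. \<alpha> (x + y) = \<alpha> x + \<alpha> y) \<and> (\<forall>c x. \<alpha> (scaleV c x) = c * \<alpha> x)"
proof -
  have "vector_space ((*) :: 'k \<Rightarrow> 'k \<Rightarrow> 'k)" by unfold_locales (simp_all add: algebra_simps)
  then show ?thesis
    using V.vector_space_axioms
    by (auto simp: Vector_Spaces.linear_def module_hom_def module_hom_axioms_def vector_space_def module_def)
qed

lemma pair_orbit_linear:
  assumes "pair_orbit v \<phi> u \<alpha>" "Vector_Spaces.linear scaleV (*) \<phi>"
  shows "Vector_Spaces.linear scaleV (*) \<alpha>"
  using assms by (induction) (auto simp: linear_functional_iff algebra_simps act.add act.scale)

lemma pair_orbit_cong: "pair_orbit v \<phi> u \<alpha> \<Longrightarrow> u = u' \<Longrightarrow> \<alpha> = \<alpha>' \<Longrightarrow> pair_orbit v \<phi> u' \<alpha>'"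
  by simp

context
  fixes v \<phi> \<Lambda>
  assumes v: "highest_weight v \<Lambda>" and \<phi>: "dual_highest_weight \<phi> \<Lambda>"
begin

lemma pair_orbit_minus:
  assumes "pair_orbit v \<phi> u \<alpha>" "pair_orbit v \<phi> u' \<alpha>'"
  shows "pair_orbit v \<phi> (u - u') (\<lambda>x. \<alpha> x - \<alpha>' x)"
  using pair_orbit.add[OF assms(1) pair_orbit.scale[OF assms(2), of "- 1"]] by simp

lemma pair_orbit_functional:
  assumes "pair_orbit v \<phi> u \<alpha>"
  shows "\<alpha> (x + y) = \<alpha> x + \<alpha> y" "\<alpha> (scaleV c x) = c * \<alpha> x" "\<alpha> (x - y) = \<alpha> x - \<alpha> y"
proof -
  have l: "Vector_Spaces.linear scaleV (*) \<alpha>"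
    using pair_orbit_linear[OF assms] \<phi> by (simp add: dual_highest_weight_def)
  then show *: "\<alpha> (x + y) = \<alpha> x + \<alpha> y" "\<alpha> (scaleV c x) = c * \<alpha> x" for x y c
    by (auto simp: linear_functional_iff)
  show "\<alpha> (x - y) = \<alpha> x - \<alpha> y"
    using *(1)[of "x - y" y] by simp
qed

text \<open>The operator is moved past the lowering operators until it reaches the generating pair,
  which it scales. The case of \<open>h\<close> precedes that of \<open>e\<close>, since moving
  \<open>e m\<close> past \<open>f n\<close> leaves \<open>h (m + n)\<close> behind.\<close>

lemma pair_orbit_h:
  assumes "pair_orbit v \<phi> u \<alpha>"
  shows "pair_orbit v \<phi> (act (h m) u) (\<lambda>x. - \<alpha> (act (h m) x))"
  using assms
proof (induction arbitrary: m)
  case base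
  show ?case
    by (rule pair_orbit_cong[OF pair_orbit.scale[OF pair_orbit.base, of _ _ "\<Lambda> m"]])
      (use v \<phi> in \<open>auto simp: highest_weight_def dual_highest_weight_def\<close>)
next
  case (add u \<alpha> u' \<alpha>')
  show ?case
    by (rule pair_orbit_cong[OF pair_orbit.add[OF add.IH]]) (auto simp: act.add)
next
  case (scale u \<alpha> c)
  show ?case
    by (rule pair_orbit_cong[OF pair_orbit.scale[OF scale.IH]]) (auto simp: act.scale)
next
  case (lower u \<alpha> n)
  note lin = pair_orbit_functional[OF lower.hyps]
  have "pair_orbit v \<phi> (act (f n) (act (h m) u) - scaleV 2 (act (f (m + n)) u))
    (\<lambda>x. - (- \<alpha> (act (h m) (act (f n) x))) - 2 * (- \<alpha> (act (f (m + n)) x)))"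
    by (intro pair_orbit_minus pair_orbit.scale pair_orbit.lower lower.IH lower.hyps)
  then show ?case
    by (rule pair_orbit_cong) (auto simp: act_hf lin)
qed

lemma pair_orbit_e:
  assumes "pair_orbit v \<phi> u \<alpha>"
  shows "pair_orbit v \<phi> (act (e m) u) (\<lambda>x. - \<alpha> (act (e m) x))"
  using assms
proof (induction arbitrary: m)
  case base
  show ?case
    by (rule pair_orbit_cong[OF pair_orbit.scale[OF pair_orbit.base, of _ _ 0]])
      (use v \<phi> in \<open>auto simp: highest_weight_e dual_highest_weight_def\<close>)
next
  case (add u \<alpha> u' \<alpha>')
  show ?case
    by (rule pair_orbit_cong[OF pair_orbit.add[OF add.IH]]) (auto simp: act.add)
next
  case (scale u \<alpha> c)
  show ?case
    by (rule pair_orbit_cong[OF pair_orbit.scale[OF scale.IH]]) (auto simp: act.scale)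
next
  case (lower u \<alpha> n)
  note lin = pair_orbit_functional[OF lower.hyps]
  have "pair_orbit v \<phi> (act (f n) (act (e m) u) + act (h (m + n)) u)
    (\<lambda>x. - (- \<alpha> (act (e m) (act (f n) x))) + - \<alpha> (act (h (m + n)) x))"
    by (intro pair_orbit.add pair_orbit_h pair_orbit.lower lower.IH lower.hyps)
  then show ?case
    by (rule pair_orbit_cong) (auto simp: act_ef lin)
qed

lemma pair_orbit_act:
  assumes "pair_orbit v \<phi> u \<alpha>"
  shows "pair_orbit v \<phi> (act \<xi> u) (\<lambda>x. - \<alpha> (act \<xi> x))"
proof -
  \<comment> \<open>The property quantifies over all pairs of the orbit, because for a bracket one
    element is applied to the image under the other.\<close>
  define P where "P \<xi> \<longleftrightarrow> (\<forall>u \<alpha>. pair_orbit v \<phi> u \<alpha> \<longrightarrow>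
    pair_orbit v \<phi> (act \<xi> u) (\<lambda>x. - \<alpha> (act \<xi> x)))" for \<xi>
  have P_I: "P \<xi>" if "\<And>u \<alpha>. pair_orbit v \<phi> u \<alpha> \<Longrightarrow> pair_orbit v \<phi> (act \<xi> u) (\<lambda>x. - \<alpha> (act \<xi> x))" for \<xi>
    using that unfolding P_def by (intro allI impI)
  have P_D: "pair_orbit v \<phi> (act \<xi> u) (\<lambda>x. - \<alpha> (act \<xi> x))" if "P \<xi>" "pair_orbit v \<phi> u \<alpha>" for \<xi> u \<alpha>
    using that(1)[unfolded P_def, rule_format, OF that(2)] .
  have "P \<xi>"
  proof (rule generated)
    show "P (e n)" for n by (rule P_I, rule pair_orbit_e)
    show "P (f n)" for n by (rule P_I, rule pair_orbit.lower)
    fix a b assume ab: "P a" "P b"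
    show "P (a + b)"
    proof (rule P_I)
      fix u \<alpha> assume o: "pair_orbit v \<phi> u \<alpha>"
      show "pair_orbit v \<phi> (act (a + b) u) (\<lambda>x. - \<alpha> (act (a + b) x))"
        by (rule pair_orbit_cong[OF pair_orbit.add[OF P_D[OF ab(1) o] P_D[OF ab(2) o]]])
          (auto simp: act_left.add pair_orbit_functional[OF o])
    qed
    show "P (bracket a b)"
    proof (rule P_I)
      fix u \<alpha> assume o: "pair_orbit v \<phi> u \<alpha>"
      show "pair_orbit v \<phi> (act (bracket a b) u) (\<lambda>x. - \<alpha> (act (bracket a b) x))"
        by (rule pair_orbit_cong[OF pair_orbit_minus[OF P_D[OF ab(1) P_D[OF ab(2) o]]
              P_D[OF ab(2) P_D[OF ab(1) o]]]])
          (auto simp: act_bracket pair_orbit_functional[OF o])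
    qed
  next
    fix c a assume a: "P a"
    show "P (scaleL c a)"
    proof (rule P_I)
      fix u \<alpha> assume o: "pair_orbit v \<phi> u \<alpha>"
      show "pair_orbit v \<phi> (act (scaleL c a) u) (\<lambda>x. - \<alpha> (act (scaleL c a) x))"
        by (rule pair_orbit_cong[OF pair_orbit.scale[OF P_D[OF a o]]])
          (auto simp: act_left.scale pair_orbit_functional[OF o])
    qed
  next
    fix a b assume "P a" "act a = act b"
    then show "P b" unfolding P_def by simp
  qed
  then show ?thesis by (rule P_D[OF _ assms])
qed

lemma pair_orbit_total: "\<exists>\<alpha>. pair_orbit v \<phi> u \<alpha>"
proof -
  let ?W = "{u. \<exists>\<alpha>. pair_orbit v \<phi> u \<alpha>}"
  have "V.subspace ?W"
  proof (rule V.subspaceI)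
    show "0 \<in> ?W" using pair_orbit.scale[OF pair_orbit.base, of v \<phi> 0] by auto
  qed (use pair_orbit.add pair_orbit.scale in blast)+
  moreover have "v \<noteq> 0" "v \<in> ?W"
    using v pair_orbit.base by (auto simp: highest_weight_def)
  ultimately have "u \<in> ?W"
    using irreducible_subspace[OF irreducible, of ?W v u] pair_orbit_act by blast
  then show ?thesis by blast
qed

end

section \<open>Splitting off the top weight space\<close>

definition lower_part :: "'v set" where
  "lower_part = V.span (\<Union>\<theta>\<in>- {of_nat d}. weight_space \<theta>)"

lemma lower_partI: "x \<in> weight_space \<theta> \<Longrightarrow> \<theta> \<noteq> of_nat d \<Longrightarrow> x \<in> lower_part"
  unfolding lower_part_def by (rule V.span_base) auto

lemma subspace_lower_part: "V.subspace lower_part"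
  by (simp add: lower_part_def)

lemma lower_part_f: "act (f n) x \<in> lower_part"
proof -
  have "x \<in> V.span (\<Union>\<theta>. {x. act (h 0) x = scaleV \<theta> x})" using diagonalizable by simp
  then show ?thesis
  proof (induction rule: V.span_induct)
    case base
    have "V.subspace {x. act (f n) x \<in> lower_part}"
      by (rule V.subspaceI)
        (auto simp: act.add act.zero act.scale V.subspace_0 V.subspace_add V.subspace_scale subspace_lower_part)
    then show ?case .
  next
    case (step x)
    then obtain \<theta> where \<theta>: "x \<in> weight_space \<theta>" by (auto simp: H.eigenspace_def)
    show ?case
    \<comment> \<open>The only weight that \<open>f n\<close> could send to \<open>d\<close> is
      \<open>d + 2\<close>, and its weight space is zero.\<close>
    proof (cases "\<theta> = of_nat d + 2")
      case True
      then have "x = 0" using weight_above \<theta> by blast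
      then show ?thesis by (simp add: act.zero V.subspace_0 subspace_lower_part)
    next
      case False
      then show ?thesis by (intro lower_partI[OF weight_f[OF \<theta>]]) (simp add: diff_eq_eq)
    qed
  qed
qed

lemma lower_part_h:
  assumes "x \<in> lower_part"
  shows "act (h n) x \<in> lower_part"
  using assms[unfolded lower_part_def]
proof (induction rule: V.span_induct)
  case base
  have "V.subspace {x. act (h n) x \<in> lower_part}"
    by (rule V.subspaceI)
      (auto simp: act.add act.zero act.scale V.subspace_0 V.subspace_add V.subspace_scale subspace_lower_part)
  then show ?case .
next
  case (step x)
  then obtain \<theta> where "x \<in> weight_space \<theta>" "\<theta> \<noteq> of_nat d" by auto
  then show ?case by (intro lower_partI[OF weight_h])
qed

lemma top_decomposition:
  assumes "highest_weight v \<Lambda>"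
  shows "\<exists>!c. x - scaleV c v \<in> lower_part"
proof -
  \<comment> \<open>With the zero functional, the orbit reduces to the submodule of \<open>V\<close>
    generated by \<open>v\<close>. This yields that every vector is obtained from \<open>v\<close>
    by lowering, so it is a multiple of \<open>v\<close> modulo \<open>lower_part\<close>.\<close>
  have "dual_highest_weight (\<lambda>_. 0) \<Lambda>"
    by (simp add: dual_highest_weight_def linear_functional_iff)
  then obtain \<alpha> where "pair_orbit v (\<lambda>_. 0) x \<alpha>"
    using pair_orbit_total[OF assms] by blast
  then have ex: "\<exists>c. x - scaleV c v \<in> lower_part"
  proof induction
    case base
    show ?case by (rule exI[of _ 1]) (simp add: V.subspace_0 subspace_lower_part)
  next
    case (add u \<alpha> u' \<alpha>')
    then obtain c c' where "u - scaleV c v \<in> lower_part" "u' - scaleV c' v \<in> lower_part" by blast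
    then have "(u - scaleV c v) + (u' - scaleV c' v) \<in> lower_part"
      by (intro V.subspace_add subspace_lower_part)
    then show ?case by (intro exI[of _ "c + c'"]) (simp add: V.scale_left_distrib algebra_simps)
  next
    case (scale u \<alpha> c)
    then obtain a where "u - scaleV a v \<in> lower_part" by blast
    then have "scaleV c (u - scaleV a v) \<in> lower_part"
      by (intro V.subspace_scale subspace_lower_part)
    then show ?case by (intro exI[of _ "c * a"]) (simp add: V.scale_right_diff_distrib)
  next
    case (lower u \<alpha> n)
    show ?case by (rule exI[of _ 0]) (simp add: lower_part_f)
  qed
  moreover have "a = b" if "x - scaleV a v \<in> lower_part" "x - scaleV b v \<in> lower_part" for a b
  proof -
    have "(x - scaleV b v) - (x - scaleV a v) \<in> lower_part"
      by (rule V.subspace_diff[OF subspace_lower_part that(2) that(1)])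
    then have "scaleV (a - b) v \<in> lower_part" by (simp add: V.scale_left_diff_distrib)
    moreover have "scaleV (a - b) v \<in> weight_space (of_nat d)"
      using highest_weight_space[OF assms] by (intro V.subspace_scale H.subspace_eigenspace)
    ultimately have "scaleV (a - b) v = 0"
      unfolding lower_part_def by (rule H.eigenspace_Int_span) simp
    then show ?thesis using assms by (simp add: highest_weight_def)
  qed
  ultimately show ?thesis by blast
qed

text \<open>\<open>l\<close> reads off the coefficient of \<open>v\<close> modulo the other weight
  spaces. Applied to the module with \<open>e\<close> and \<open>f\<close> exchanged, it produces
  the highest weight vector of the dual.\<close>

lemma top_functional:
  assumes v: "highest_weight v \<Lambda>"
  obtains l where "Vector_Spaces.linear scaleV (*) l" "l v = 1" "\<And>x. x \<in> lower_part \<Longrightarrow> l x = 0"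
    "\<And>x. x - scaleV (l x) v \<in> lower_part"
    "\<And>n x. l (act (f n) x) = 0" "\<And>n x. l (act (h n) x) = \<Lambda> n * l x"
proof
  define l where "l x = (THE c. x - scaleV c v \<in> lower_part)" for x
  have l: "x - scaleV (l x) v \<in> lower_part" for x
    unfolding l_def by (rule theI') (rule top_decomposition[OF v])
  have l_eq: "l x = c" if "x - scaleV c v \<in> lower_part" for x c
    using top_decomposition[OF v, of x] l[of x] that by blast
  have "l (x + y) = l x + l y" for x y
    using V.subspace_add[OF subspace_lower_part l[of x] l[of y]]
    by (intro l_eq) (simp add: V.scale_left_distrib algebra_simps)
  moreover have "l (scaleV c x) = c * l x" for c x
    using V.subspace_scale[OF subspace_lower_part l[of x], of c]
    by (intro l_eq) (simp add: V.scale_right_diff_distrib)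
  ultimately show "Vector_Spaces.linear scaleV (*) l" by (simp add: linear_functional_iff)
  show "l v = 1" by (rule l_eq) (simp add: V.subspace_0 subspace_lower_part)
  show l0: "l x = 0" if "x \<in> lower_part" for x by (rule l_eq) (simp add: that)
  show "x - scaleV (l x) v \<in> lower_part" for x by (rule l)
  show "l (act (f n) x) = 0" for n x by (rule l0[OF lower_part_f])
  show "l (act (h n) x) = \<Lambda> n * l x" for n x
    using lower_part_h[OF l[of x], of n] v
    by (intro l_eq) (simp add: act.diff act.scale highest_weight_def mult.commute)
qed

end

section \<open>The bottom weight space\<close>

context loop_module
begin

text \<open>Exchanging \<open>e\<close> and \<open>f\<close> with indices kept negates
  \<open>h\<close>. Since the weights are symmetric about 0, lowest weight vectors of
  \<open>V\<close> become highest weight vectors of the new structure with the same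
  \<open>d\<close>.\<close>

lemma swapped: "loop_module scaleL bracket scaleV act f e (\<lambda>n. - h n) d"
proof (unfold_locales, goal_cases)
  case (1 m n)
  show ?case by (rule ff)
next
  case (2 m n)
  show ?case by (rule ee)
next
  case (3 m n)
  show ?case by (simp add: L.bracket_bilinear hh)
next
  case (4 m n)
  show ?case using L.bracket_anticommute[of "f m" "e n"] by (simp add: ef add.commute)
next
  case (5 m n)
  show ?case by (simp add: L.bracket_bilinear hf)
next
  case (6 m n)
  show ?case by (simp add: L.bracket_bilinear he)
next
  case (7 P \<xi>)
  show ?case by (rule generated) (rule 7; assumption)+
next
  case 8
  show ?case by (rule irreducible)
next
  case 9
  show ?case by (rule finite_dim)
next
  case 10
  have "x \<in> (\<Union>\<theta>. {x. act (- h 0) x = scaleV \<theta> x})" if "act (h 0) x = scaleV \<theta> x" for \<theta> x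
    using that by (auto simp: act_left.neg intro!: exI[of _ "- \<theta>"])
  then have "(\<Union>\<theta>. {x. act (h 0) x = scaleV \<theta> x}) \<subseteq> (\<Union>\<theta>. {x. act (- h 0) x = scaleV \<theta> x})"
    by blast
  from V.span_mono[OF this] show ?case unfolding diagonalizable by blast
next
  case (11 \<theta>)
  have "act (- h 0) x = scaleV \<theta> x \<longleftrightarrow> act (h 0) x = scaleV (- \<theta>) x" for x
    by (auto simp: act_left.neg minus_equation_iff)
  then have "(\<exists>x. x \<noteq> 0 \<and> act (- h 0) x = scaleV \<theta> x) \<longleftrightarrow>
      (\<exists>n\<le>d. - \<theta> = of_int (int d - 2 * int n))"
    using weights[of "- \<theta>"] by simp
  also have "\<dots> \<longleftrightarrow> (\<exists>n\<le>d. \<theta> = of_int (int d - 2 * int n))"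
  proof -
    have "\<exists>n\<le>d. - \<theta> = of_int (int d - 2 * int n)" if "n \<le> d" "\<theta> = of_int (int d - 2 * int n)" for n and \<theta> :: 'k
      using that by (intro exI[of _ "d - n"]) (simp add: of_nat_diff algebra_simps)
    from this[of _ \<theta>] this[of _ "- \<theta>", unfolded minus_minus] show ?thesis by blast
  qed
  finally show ?case .
qed

text \<open>Put \<open>F k = f_0^k v\<close>. Nonvanishing follows from
  \<open>e_0 F (k+1) = (k+1) (d-k) F k\<close>. Since \<open>F (d+1) = 0\<close>, the formula
  \<open>eF\<close> for \<open>e_n F (d+1)\<close> gives
  \<open>d f_n F (d-1) = \<Lambda>_n F d\<close>; substituting this into \<open>hF\<close> changes
  \<open>\<Lambda>_n\<close> into \<open>\<Lambda>_n - 2 \<Lambda>_n\<close>.\<close>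

lemma descent:
  assumes v: "highest_weight v \<Lambda>"
  shows "(act (f 0) ^^ d) v \<noteq> 0" and "act (h n) ((act (f 0) ^^ d) v) = scaleV (- \<Lambda> n) ((act (f 0) ^^ d) v)"
proof -
  define F where "F k = (act (f 0) ^^ k) v" for k
  have F0: "F 0 = v" and F_Suc: "F (Suc k) = act (f 0) (F k)" for k
    by (simp_all add: F_def)
  have hv: "act (h n) v = scaleV (\<Lambda> n) v" for n using v by (simp add: highest_weight_def)
  have hF: "act (h n) (F (Suc k)) = scaleV (\<Lambda> n) (F (Suc k)) - scaleV (2 * of_nat (Suc k)) (act (f n) (F k))" for n k
  proof (induction k)
    case 0
    show ?case by (simp add: F_Suc F0 act_hf hv act.scale)
  next
    case (Suc k)
    have "act (h n) (F (Suc (Suc k))) = act (f 0) (act (h n) (F (Suc k))) - scaleV 2 (act (f n) (F (Suc k)))"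
      unfolding F_Suc[of "Suc k"] by (simp add: act_hf)
    also have "\<dots> = scaleV (\<Lambda> n) (F (Suc (Suc k))) - scaleV (2 * of_nat (Suc k)) (act (f n) (F (Suc k)))
        - scaleV 2 (act (f n) (F (Suc k)))"
      unfolding Suc by (simp add: act.diff act.scale act_ff[of 0 n] F_Suc del: of_nat_Suc)
    also have "\<dots> = scaleV (\<Lambda> n) (F (Suc (Suc k)))
        - scaleV (2 * of_nat (Suc k) + 2) (act (f n) (F (Suc k)))"
      by (simp only: V.scale_left_distrib diff_diff_eq)
    also have "2 * of_nat (Suc k) + 2 = (2 * of_nat (Suc (Suc k)) :: 'k)" by simp
    finally show ?case .
  qed
  have eF1: "act (e n) (F (Suc 0)) = scaleV (\<Lambda> n) (F 0)" for n
    by (simp add: F_Suc F0 act_ef hv highest_weight_e[OF v] act.zero)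
  have eF: "act (e n) (F (Suc (Suc k))) = scaleV (of_nat (k + 2) * \<Lambda> n) (F (Suc k))
      - scaleV (of_nat ((k + 1) * (k + 2))) (act (f n) (F k))" for n k
  proof (induction k)
    case 0
    have "act (e n) (F (Suc (Suc 0))) = act (f 0) (act (e n) (F (Suc 0))) + act (h n) (F (Suc 0))"
      unfolding F_Suc[of "Suc 0"] by (simp add: act_ef)
    then show ?case unfolding eF1 hF
      by (simp add: act.scale F_Suc algebra_simps)
        (simp flip: V.scale_left_distrib)
  next
    case (Suc k)
    have "act (e n) (F (Suc (Suc (Suc k)))) = act (f 0) (act (e n) (F (Suc (Suc k)))) + act (h n) (F (Suc (Suc k)))"
      unfolding F_Suc[of "Suc (Suc k)"] by (simp add: act_ef)
    also have "\<dots> = scaleV (of_nat (k + 2) * \<Lambda> n) (F (Suc (Suc k))) - scaleV (of_nat ((k + 1) * (k + 2))) (act (f n) (F (Suc k)))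
       + (scaleV (\<Lambda> n) (F (Suc (Suc k))) - scaleV (2 * of_nat (Suc (Suc k))) (act (f n) (F (Suc k))))"
      unfolding Suc hF by (simp add: act.diff act.scale act_ff[of 0 n] F_Suc del: of_nat_Suc)
    also have "\<dots> = scaleV (of_nat (k + 2) * \<Lambda> n + \<Lambda> n) (F (Suc (Suc k)))
        - scaleV (of_nat ((k + 1) * (k + 2)) + 2 * of_nat (Suc (Suc k))) (act (f n) (F (Suc k)))"
      by (simp only: V.scale_left_distrib) simp
    finally show ?case by (simp add: algebra_simps)
  qed
  have "F k \<in> weight_space (of_nat d - 2 * of_nat k)" for k
  proof (induction k)
    case (Suc k)
    then show ?case using weight_f[OF Suc, of 0] by (simp add: F_Suc algebra_simps)
  qed (use highest_weight_space[OF v] in \<open>simp add: F0\<close>)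
  from this[of "Suc d"] have Fd: "F (Suc d) = 0"
    by (intro weight_below) (simp add: algebra_simps)
  have \<Lambda>0: "\<Lambda> 0 = of_nat d" using v by (simp add: highest_weight_def)
  have e0F: "act (e 0) (F (Suc k)) = scaleV (of_nat (Suc k) * (of_nat d - of_nat k)) (F k)" for k
  proof (cases k)
    case 0
    then show ?thesis by (simp add: eF1 \<Lambda>0)
  next
    case (Suc j)
    have "act (e 0) (F (Suc k)) = scaleV (of_nat (j + 2) * of_nat d - of_nat ((j + 1) * (j + 2))) (F k)"
      unfolding Suc eF \<Lambda>0 F_Suc[symmetric] by (simp only: V.scale_left_diff_distrib)
    then show ?thesis by (simp add: Suc algebra_simps)
  qed
  have nz: "k \<le> d \<Longrightarrow> F k \<noteq> 0" for k
  proof (induction k)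
    case 0
    then show ?case using v by (simp add: F0 highest_weight_def)
  next
    case (Suc k)
    have "(of_nat (Suc k) * (of_nat d - of_nat k) :: 'k) \<noteq> 0" using Suc.prems by (simp del: of_nat_Suc)
    then show ?case using Suc e0F[of k] by (auto simp del: of_nat_Suc simp: act.zero)
  qed
  then show "(act (f 0) ^^ d) v \<noteq> 0" by (simp flip: F_def)
  have "act (h n) (F d) = scaleV (- \<Lambda> n) (F d)"
  \<comment> \<open>For \<open>d = 0\<close> there is no \<open>F (d - 1)\<close>; instead
    \<open>e n\<close> applied to \<open>F 1 = 0\<close> shows
    \<open>\<Lambda> n = 0\<close>.\<close>
  proof (cases d)
    case 0
    then have "\<Lambda> n = 0" using eF1[of n] Fd nz[of 0] by (simp add: act.zero)
    then show ?thesis by (simp add: 0 F0 hv)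
  next
    case (Suc k)
    have "scaleV (of_nat (k + 2)) (scaleV (\<Lambda> n) (F (Suc k)) - scaleV (of_nat (Suc k)) (act (f n) (F k))) = 0"
    proof -
      have "(of_nat ((k + 1) * (k + 2)) :: 'k) = of_nat (k + 2) * of_nat (Suc k)" by (simp add: algebra_simps)
      then show ?thesis
        using eF[of n k] Fd Suc by (simp add: act.zero V.scale_right_diff_distrib del: of_nat_Suc of_nat_add of_nat_mult)
    qed
    moreover have "(of_nat (k + 2) :: 'k) \<noteq> 0" by (metis of_nat_eq_0_iff add_2_eq_Suc' nat.distinct(1))
    ultimately have "scaleV (of_nat (Suc k)) (act (f n) (F k)) = scaleV (\<Lambda> n) (F (Suc k))"
      by (metis V.scale_eq_0_iff right_minus_eq)
    then have "scaleV 2 (scaleV (of_nat (Suc k)) (act (f n) (F k))) = scaleV 2 (scaleV (\<Lambda> n) (F (Suc k)))"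
      by simp
    then have "act (h n) (F (Suc k)) = scaleV (\<Lambda> n) (F (Suc k)) - scaleV (2 * \<Lambda> n) (F (Suc k))"
      unfolding hF by (simp only: V.scale_scale)
    also have "\<dots> = scaleV (\<Lambda> n - 2 * \<Lambda> n) (F (Suc k))"
      by (simp only: V.scale_left_diff_distrib)
    finally show ?thesis unfolding Suc by simp
  qed
  then show "act (h n) ((act (f 0) ^^ d) v) = scaleV (- \<Lambda> n) ((act (f 0) ^^ d) v)"
    by (simp flip: F_def)
qed

section \<open>The invariant form\<close>

lemma bilinear_form_iff:
  "bilinear_form scaleV B \<longleftrightarrow>
     (\<forall>u x y. B u (x + y) = B u x + B u y) \<and> (\<forall>u c x. B u (scaleV c x) = c * B u x) \<and>
     (\<forall>u x y. B (x + y) u = B x u + B y u) \<and> (\<forall>u c x. B (scaleV c x) u = c * B x u)"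
  by (auto simp: bilinear_form_def linear_functional_iff)

lemma invariant_forms:
  "\<exists>B. nonzero_invariant_form scaleV act B \<and>
     (\<forall>g. nonzero_invariant_form scaleV act g \<longrightarrow> (\<exists>c. c \<noteq> 0 \<and> (\<forall>u v. g u v = c * B u v))) \<and>
     nondegenerate B \<and> (\<forall>u v. B u v = (- 1) ^ d * B v u)"
proof -
  interpret sw: loop_module scaleL bracket scaleV act f e "\<lambda>n. - h n" d
    by (rule swapped)
  obtain v \<Lambda> where v: "highest_weight v \<Lambda>" using highest_weight_exists by blast
  define w where "w = (act (f 0) ^^ d) v"
  have v0: "v \<noteq> 0" using v by (simp add: highest_weight_def)
  have w0: "w \<noteq> 0" using descent[OF v] by (simp add: w_def)
  have w: "sw.highest_weight w \<Lambda>"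
    using v descent[OF v] unfolding sw.highest_weight_def w_def
    by (simp add: highest_weight_def act_left.neg)
  \<comment> \<open>This functional reads off the coefficient of \<open>w\<close> modulo the weight
    spaces other than the bottom one.\<close>
  obtain \<phi> where \<phi>: "Vector_Spaces.linear scaleV (*) \<phi>" "\<phi> w = 1"
    "\<And>x. x - scaleV (\<phi> x) w \<in> sw.lower_part"
    "\<And>n x. \<phi> (act (e n) x) = 0" "\<And>n x. \<phi> (act (- h n) x) = \<Lambda> n * \<phi> x"
    by (rule sw.top_functional[OF w]) blast
  have "\<phi> (act (h n) x) = - \<Lambda> n * \<phi> x" for n x
  proof -
    have "\<phi> (scaleV (- 1) (act (h n) x)) = - 1 * \<phi> (act (h n) x)"
      using \<phi>(1) unfolding linear_functional_iff by blast
    then have "\<phi> (act (h n) x) = - \<phi> (act (- h n) x)"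
      by (simp add: act_left.neg)
    then show ?thesis by (simp add: \<phi>(5))
  qed
  then have dual: "dual_highest_weight \<phi> \<Lambda>"
    using \<phi> by (simp add: dual_highest_weight_def)
  obtain l where l: "Vector_Spaces.linear scaleV (*) l" "l v = 1" "\<And>n x. l (act (f n) x) = 0"
    by (rule top_functional[OF v]) blast
  note orbit_lin = pair_orbit_functional[OF v dual]
  have orbit_0: "\<alpha> 0 = 0" if "pair_orbit v \<phi> u \<alpha>" for u \<alpha>
    using orbit_lin(2)[OF that, of 0 0] by simp
  \<comment> \<open>Both sides are linear in the pair and equal 1 on the generating pair. After a
    lowering both vanish: the left one because \<open>l\<close> kills the images of
    \<open>f n\<close>, the right one because \<open>f n\<close> kills the bottom vector
    \<open>w\<close>.\<close>
  have l_orbit: "l u = \<alpha> w" if "pair_orbit v \<phi> u \<alpha>" for u \<alpha>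
    using that
  proof induction
    case (lower u \<alpha> n)
    then show ?case using sw.highest_weight_e[OF w] orbit_0 by (simp add: l)
  qed (use l \<phi> in \<open>simp_all add: linear_functional_iff\<close>)
  \<comment> \<open>This makes the orbit the graph of a map. The common zeros of all \<gamma> paired
    with 0 form a submodule, and by \<open>l_orbit\<close> it contains \<open>w\<close>, so it is
    everything.\<close>
  have orbit_zero: "\<gamma> x = 0" if "pair_orbit v \<phi> 0 \<gamma>" for \<gamma> x
  proof -
    let ?W = "{x. \<forall>\<gamma>. pair_orbit v \<phi> 0 \<gamma> \<longrightarrow> \<gamma> x = 0}"
    have "V.subspace ?W"
      by (rule V.subspaceI) (auto simp: orbit_0 orbit_lin)
    moreover have "act a x \<in> ?W" if "x \<in> ?W" for a x
    proof (intro CollectI allI impI)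
      fix \<gamma> assume "pair_orbit v \<phi> 0 \<gamma>"
      from pair_orbit_act[OF v dual this, of a]
      have "pair_orbit v \<phi> 0 (\<lambda>x. - \<gamma> (act a x))" by (simp add: act.zero)
      with that have "- \<gamma> (act a x) = 0" by blast
      then show "\<gamma> (act a x) = 0" by simp
    qed
    moreover have "w \<in> ?W"
    proof (intro CollectI allI impI)
      fix \<gamma> assume "pair_orbit v \<phi> 0 \<gamma>"
      from l_orbit[OF this] show "\<gamma> w = 0"
        using l(1) by (metis linear_functional_iff V.scale_zero_left mult_zero_left)
    qed
    ultimately have "x \<in> ?W" using irreducible_subspace[OF irreducible, of ?W w x] w0 by blast
    with that show ?thesis by blast
  qed
  define B where "B u = (THE \<alpha>. pair_orbit v \<phi> u \<alpha>)" for u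
  have B_eq: "B u = \<alpha>" if "pair_orbit v \<phi> u \<alpha>" for u \<alpha>
    unfolding B_def
  proof (rule the_equality)
    show "pair_orbit v \<phi> u \<alpha>" by (rule that)
    fix \<beta> assume "pair_orbit v \<phi> u \<beta>"
    from pair_orbit_minus[OF v dual this that] show "\<beta> = \<alpha>"
      using orbit_zero[of "\<lambda>x. \<beta> x - \<alpha> x"] by (auto simp: fun_eq_iff)
  qed
  have B: "pair_orbit v \<phi> u (B u)" for u
    using pair_orbit_total[OF v dual, of u] B_eq by metis
  have B_right: "B u (x + y) = B u x + B u y" "B u (scaleV c x) = c * B u x" for u x y c
    using orbit_lin[OF B] by blast+
  have B_left: "B (x + y) u = B x u + B y u" "B (scaleV c x) u = c * B x u" for u x y c
    using B_eq[OF pair_orbit.add[OF B B], of x y] B_eq[OF pair_orbit.scale[OF B], of c x] by simp_all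
  have B_inv: "B (act a u) x = - B u (act a x)" for a u x
    using B_eq[OF pair_orbit_act[OF v dual B, of a u]] by simp
  have Bv: "B v = \<phi>" by (rule B_eq) (rule pair_orbit.base)
  have Bvw: "B v w = 1" by (simp add: Bv \<phi>)
  have form: "nonzero_invariant_form scaleV act B"
    unfolding nonzero_invariant_form_def bilinear_form_iff
    using B_left B_right B_inv Bvw by (metis zero_neq_one)
  have unique: "\<exists>c. c \<noteq> 0 \<and> (\<forall>u x. g u x = c * B u x)" if "nonzero_invariant_form scaleV act g" for g
  proof -
    from that have g_right: "g u (x + y) = g u x + g u y" "g u (scaleV c x) = c * g u x"
      and g_left: "g (x + y) u = g x u + g y u" "g (scaleV c x) u = c * g x u"
      and g_inv: "g (act a u) x = - g u (act a x)" for u x y c a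
      unfolding nonzero_invariant_form_def bilinear_form_iff by blast+
    have g0: "g u 0 = 0" "g 0 u = 0" for u
      using g_right(2)[of u 0 0] g_left(2)[of 0 0 u] by simp_all
    \<comment> \<open>Invariance under \<open>h 0\<close> makes weight spaces orthogonal unless
      their weights add up to 0. So \<open>v\<close> can pair nontrivially only with the bottom
      weight space, and \<open>g v\<close> is determined by its value at \<open>w\<close>.\<close>
    have gv: "g v x = 0" if "x \<in> sw.lower_part" for x
      using that unfolding sw.lower_part_def
    proof (induction rule: V.span_induct)
      case base
      have "V.subspace {x. g v x = 0}"
        by (rule V.subspaceI) (auto simp: g0 g_right)
      then show ?case .
    next
      case (step x)
      then obtain \<theta> where \<theta>: "\<theta> \<noteq> of_nat d" "act (- h 0) x = scaleV \<theta> x"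
        by (auto simp: sw.H.eigenspace_def)
      have "act (- h 0) v = scaleV (- of_nat d) v"
        using v by (simp add: highest_weight_def act_left.neg)
      then have "(\<theta> - of_nat d) * g v x = 0"
        using g_inv[of "- h 0" v x] \<theta>(2) g_left(2)[of "- of_nat d" v x] g_right(2)[of v \<theta> x] by (simp add: algebra_simps)
      then show ?case using \<theta>(1) by simp
    qed
    define c where "c = g v w"
    have gv': "g v x = c * B v x" for x
    proof -
      have "g v ((x - scaleV (\<phi> x) w) + scaleV (\<phi> x) w) = \<phi> x * g v w"
        unfolding g_right gv[OF \<phi>(3)] by simp
      then show ?thesis by (simp add: c_def Bv)
    qed
    let ?W = "{u. \<forall>x. g u x = c * B u x}"
    have "V.subspace ?W"
      using B_left(2)[of 0 0] by (intro V.subspaceI) (auto simp: g0 g_left B_left algebra_simps)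
    moreover have "act a u \<in> ?W" if "u \<in> ?W" for a u
      using that by (simp add: g_inv B_inv)
    moreover have "v \<in> ?W" using gv' by blast
    ultimately have *: "u \<in> ?W" for u using irreducible_subspace[OF irreducible, of ?W v u] v0 by blast
    then have "c \<noteq> 0" using that unfolding nonzero_invariant_form_def by force
    with * show ?thesis by blast
  qed
  have B0: "B u 0 = 0" "B 0 u = 0" for u
    using B_right(2)[of u 0 0] B_left(2)[of 0 0 u] by simp_all
  have nondeg: "nondegenerate B"
    unfolding nondegenerate_def
  proof (intro conjI allI impI)
    fix u assume u: "\<forall>x. B u x = 0"
    show "u = 0"
    proof (rule ccontr)
      assume "u \<noteq> 0"
      moreover have "V.subspace {u. \<forall>x. B u x = 0}"
        by (rule V.subspaceI) (auto simp: B0 B_left)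
      ultimately have "v \<in> {u. \<forall>x. B u x = 0}"
        using irreducible_subspace[OF irreducible, of "{u. \<forall>x. B u x = 0}" u v] u B_inv by auto
      then show False using Bvw by simp
    qed
  next
    fix x assume x: "\<forall>u. B u x = 0"
    show "x = 0"
    proof (rule ccontr)
      assume "x \<noteq> 0"
      moreover have "V.subspace {x. \<forall>u. B u x = 0}"
        by (rule V.subspaceI) (auto simp: B0 B_right)
      moreover have "B u (act a y) = 0" if "\<forall>u. B u y = 0" for u a y
        using B_inv[of a u y] that by simp
      ultimately have "w \<in> {x. \<forall>u. B u x = 0}"
        using irreducible_subspace[OF irreducible, of "{x. \<forall>u. B u x = 0}" x w] x by auto
      then show False using Bvw by simp
    qed
  qed
  have B_inv': "- B (act a u) x = B u (act a x)" for a u x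
    using B_inv by simp
  \<comment> \<open>The transposed form is again invariant, so uniqueness makes it a multiple of
    \<open>B\<close>. The factor is found at \<open>v\<close> and \<open>w\<close> by moving the
    \<open>d\<close> copies of \<open>f 0\<close> across, each at the cost of a sign.\<close>
  have "nonzero_invariant_form scaleV act (\<lambda>u x. B x u)"
    unfolding nonzero_invariant_form_def bilinear_form_iff
    using B_left B_right B_inv' Bvw by (metis zero_neq_one)
  then obtain c where c: "\<And>u x. B x u = c * B u x" using unique by blast
  have "B ((act (f 0) ^^ k) u) x = (- 1) ^ k * B u ((act (f 0) ^^ k) x)" for k u x
    by (induction k arbitrary: u x) (simp_all add: B_inv funpow_swap1)
  from this[of d v v] have "B w v = (- 1) ^ d" using Bvw by (simp add: w_def)
  then have "c = (- 1) ^ d" using c[of w v] Bvw by simp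
  with c form unique nondeg show ?thesis by blast
qed

end

section \<open>The diameter\<close>

lemma tet_lie_algebra_char_0:
  "lie_algebra_char_0 (tet_scale :: 'k::field_char_0 \<Rightarrow> 'k tetrahedron \<Rightarrow> _) tet_bracket"
  by (simp add: lie_algebra_char_0_def tet.lie_algebra_axioms)

interpretation tet: tet_algebra
  "tet_scale :: 'k::field_char_0 \<Rightarrow> 'k tetrahedron \<Rightarrow> 'k tetrahedron" tet_bracket tet_x
  by (simp add: tet_algebra_def tet_algebra_axioms_def tet_lie_algebra_char_0 tet_relations_tet_x)

lemma tetrahedron_induct:
  fixes \<xi> :: "'k::field tetrahedron"
  assumes gen: "\<And>i j. i \<noteq> j \<Longrightarrow> P (tet_x i j)"
    and add: "\<And>a b. P a \<Longrightarrow> P b \<Longrightarrow> P (a + b)"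
    and scale: "\<And>c a. P a \<Longrightarrow> P (tet_scale c a)"
    and bracket: "\<And>a b. P a \<Longrightarrow> P b \<Longrightarrow> P (tet_bracket a b)"
  shows "P \<xi>"
proof -
  have "P (abs_tetrahedron x)" for x :: "'k lie_expr"
  proof (induction x)
    case (Gen x)
    obtain i j where e: "x = Abs_edge (i, j)" "i \<noteq> j"
      by (cases x) auto
    then show ?case using gen[of i j] by (simp flip: tet_x.abs_eq)
  next
    case Zero
    show ?case using scale[OF gen[of 0 1], of 0] by (simp add: zero_tetrahedron_def)
  next
    case (Plus a b)
    then show ?case using add by (simp flip: plus_tetrahedron.abs_eq)
  next
    case (Scale r a)
    then show ?case using scale by (simp flip: tet_scale.abs_eq)
  next
    case (Brac a b)
    then show ?case using bracket by (simp flip: tet_bracket.abs_eq)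
  qed
  moreover have "\<exists>x. \<xi> = abs_tetrahedron x"
    by (metis Quotient3_abs_rep Quotient3_tetrahedron)
  ultimately show ?thesis by blast
qed

text \<open>For disjoint edges this is a defining relation. If the edges share one vertex, then up
  to the sign of \<open>y = tet_x k l\<close> the triangle relation reads
  \<open>T y = c (x + y)\<close> with \<open>c\<close> equal to 2 or -2; as \<open>T x = 0\<close>,
  \<open>x + y\<close> is an eigenvector of \<open>T\<close> with eigenvalue
  \<open>c\<close>.\<close>

lemma tet_ad_cubed:
  fixes i j k l :: 4
  assumes "i \<noteq> j" "k \<noteq> l"
  defines "T \<equiv> tet_bracket (tet_x i j :: 'k::field_char_0 tetrahedron)"
  shows "T (T (T (tet_x k l))) = tet_scale 4 (T (tet_x k l))"
proof -
  let ?x = "tet_x i j :: 'k tetrahedron"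
  have cube: "T (T (T y)) = tet_scale 4 (T y)" if "T y = tet_scale c (?x + y)" "c * c = 4" for y c
  proof -
    have "T (tet_scale c (?x + y)) = tet_scale c (T y)"
      unfolding T_def by simp
    then have "T (T y) = tet_scale c (T y)" unfolding that(1)[symmetric] .
    then have "T (T (T y)) = tet_scale c (tet_scale c (T y))"
      unfolding T_def by simp
    then show ?thesis using that(2) by simp
  qed
  have neg: "T (T (T (- y))) = tet_scale 4 (T (- y))" if "T (T (T y)) = tet_scale 4 (T y)" for y
    using that unfolding T_def by simp
  have self: "T ?x = 0" unfolding T_def by simp
  have right: "T (T (T (tet_x j m))) = tet_scale 4 (T (tet_x j m))" if "m \<noteq> i" "m \<noteq> j" for m
    using that assms(1) by (intro cube[of _ 2]) (simp_all add: T_def tet.y_triple tet.scale_right_distrib)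
  have left: "T (T (T (tet_x m i))) = tet_scale 4 (T (tet_x m i))" if "m \<noteq> i" "m \<noteq> j" for m
    using that assms(1) tet.bracket_anticommute[of ?x "tet_x m i"]
    by (intro cube[of _ "- 2"]) (simp_all add: T_def tet.y_triple tet.scale_right_distrib)
  consider "k = i" "l = j" | "k = j" "l = i" | "k = j" "l \<noteq> i" | "l = i" "k \<noteq> j"
    | "l = j" "k \<noteq> i" | "k = i" "l \<noteq> j" | "distinct [i, j, k, l]"
    using assms by auto
  then show ?thesis
  proof cases
    case 1
    then show ?thesis by (simp add: self T_def)
  next
    case 2
    then have "tet_x k l = - ?x" using tet.y_swap[OF assms(1)] by simp
    then show ?thesis by (simp add: T_def)
  next
    case 3
    then show ?thesis using right[of l] assms(2) by blast
  next
    case 4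
    then show ?thesis using left[of k] assms(2) by blast
  next
    case 5
    have "tet_x k j = - (tet_x j k :: 'k tetrahedron)"
      by (rule tet.y_swap) (use 5 assms(2) in auto)
    then have "tet_x k l = - (tet_x j k :: 'k tetrahedron)" using 5(1) by simp
    moreover have "T (T (T (tet_x j k))) = tet_scale 4 (T (tet_x j k))"
      by (rule right) (use 5 assms(2) in auto)
    ultimately show ?thesis using neg by metis
  next
    case 6
    have "tet_x i l = - (tet_x l i :: 'k tetrahedron)"
      by (rule tet.y_swap) (use 6 assms(2) in auto)
    then have "tet_x k l = - (tet_x l i :: 'k tetrahedron)" using 6(1) by simp
    moreover have "T (T (T (tet_x l i))) = tet_scale 4 (T (tet_x l i))"
      by (rule left) (use 6 assms(2) in auto)
    ultimately show ?thesis using neg by metis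
  next
    case 7
    then show ?thesis unfolding T_def by (rule tet.y_dg)
  qed
qed

lemma tet_ad_decomposition:
  fixes i j k l :: 4
  assumes "i \<noteq> j" "k \<noteq> l"
  obtains y0 y1 y2 :: "'k::field_char_0 tetrahedron" where
    "tet_x k l = y0 + y1 + y2" "tet_bracket (tet_x i j) y0 = tet_scale 0 y0"
    "tet_bracket (tet_x i j) y1 = tet_scale 2 y1" "tet_bracket (tet_x i j) y2 = tet_scale (- 2) y2"
proof -
  define T where "T = tet_bracket (tet_x i j :: 'k tetrahedron)"
  let ?y = "tet_x k l :: 'k tetrahedron"
  have cube: "T (T (T ?y)) = tet_scale 4 (T ?y)"
    unfolding T_def by (rule tet_ad_cubed[OF assms])
  have T: "T (a + b) = T a + T b" "T (a - b) = T a - T b" "T (tet_scale c a) = tet_scale c (T a)" for a b c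
    by (simp_all add: T_def)
  \<comment> \<open>From \<open>T^3 = 4 T\<close> on \<open>?y\<close>, the projections to the
    eigenvalues 2 and -2 are \<open>T (T + 2) / 8\<close> and \<open>T (T - 2) / 8\<close>, that is,
    \<open>P + Q\<close> and \<open>P - Q\<close>.\<close>
  define P where "P = tet_scale (1/8) (T (T ?y))"
  define Q where "Q = tet_scale (1/4) (T ?y)"
  have TP: "T P = tet_scale 2 Q" by (simp add: P_def Q_def T cube)
  have TQ: "T Q = tet_scale 2 P" by (simp add: P_def Q_def T)
  have Ty: "T ?y = tet_scale 4 Q" by (simp add: Q_def)
  show ?thesis
  proof
    show "?y = (?y - (P + P)) + (P + Q) + (P - Q)" by simp
    show "tet_bracket (tet_x i j) (?y - (P + P)) = tet_scale 0 (?y - (P + P))"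
      unfolding T_def[symmetric] T TP Ty by (simp flip: tet.scale_left_distrib)
    show "tet_bracket (tet_x i j) (P + Q) = tet_scale 2 (P + Q)"
      unfolding T_def[symmetric] T TP TQ by (simp add: tet.scale_right_distrib add.commute)
    show "tet_bracket (tet_x i j) (P - Q) = tet_scale (- 2) (P - Q)"
      unfolding T_def[symmetric] T TP TQ by (simp add: tet.scale_right_diff_distrib)
  qed
qed

section \<open>The spectra of the generators \<open>x i j\<close>\<close>

locale tet_module = lie_module "tet_scale :: 'k \<Rightarrow> 'k tetrahedron \<Rightarrow> 'k tetrahedron" tet_bracket scaleV act
  for scaleV :: "'k::{alg_closed_field, field_char_0} \<Rightarrow> 'v::ab_group_add \<Rightarrow> 'v"
    and act :: "'k tetrahedron \<Rightarrow> 'v \<Rightarrow> 'v" +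
  assumes irreducible: "irreducible_action scaleV act"
    and finite_dim: "finite_dimensional scaleV"
begin

sublocale act: Vector_Spaces.linear scaleV scaleV "act a" for a
  by (rule linear_act)

sublocale act_left: Vector_Spaces.linear tet_scale scaleV "\<lambda>a. act a x" for x
  by (rule linear_act_left)

sublocale E: endomorphism scaleV "act a" for a
  using linear_act V.vector_space_axioms by (simp add: endomorphism_def endomorphism_axioms_def)

lemma act_commute: "act a (act b x) = act b (act a x) + act (tet_bracket a b) x"
  by (simp add: act_bracket)

lemma act_eigenspace:
  assumes "tet_bracket a b = tet_scale c b" "x \<in> E.eigenspace a \<theta>"
  shows "act b x \<in> E.eigenspace a (\<theta> + c)"
  using act_commute[of a b x] assms
  by (simp add: E.eigenspace_def act_left.scale act.scale V.scale_left_distrib)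

lemma act_subspace:
  assumes W: "V.subspace W" and gen: "\<And>i j x. i \<noteq> j \<Longrightarrow> x \<in> W \<Longrightarrow> act (tet_x i j) x \<in> W" and x: "x \<in> W"
  shows "act \<xi> x \<in> W"
proof -
  have "\<forall>x\<in>W. act \<xi> x \<in> W"
    by (induction \<xi> rule: tetrahedron_induct)
      (use W gen in \<open>simp_all add: act_left.add act_left.scale act_bracket V.subspace_add V.subspace_diff V.subspace_scale\<close>)
  with x show ?thesis by blast
qed

definition spectrum where "spectrum i j = {\<theta>. E.eigenspace (tet_x i j) \<theta> \<noteq> {0}}"

lemma spectrumI: "x \<in> E.eigenspace (tet_x i j) \<theta> \<Longrightarrow> x \<noteq> 0 \<Longrightarrow> \<theta> \<in> spectrum i j"
  by (auto simp: spectrum_def)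

lemma spectrumE:
  assumes "\<theta> \<in> spectrum i j"
  obtains x where "x \<in> E.eigenspace (tet_x i j) \<theta>" "x \<noteq> 0"
  using assms V.subspace_0[OF E.subspace_eigenspace[of "tet_x i j" \<theta>]] unfolding spectrum_def by fast

text \<open>Every generator splits into pieces that shift the eigenvalues of \<open>x i j\<close> by
  0, 2 or -2. The sum of the eigenspaces over a set closed under these steps is therefore a nonzero
  submodule. This gives diagonalizability and a single string of eigenvalues at once.\<close>

lemma eigenspaces_span:
  assumes "i \<noteq> j" "\<theta> \<in> \<Theta>" "\<theta> \<in> spectrum i j"
    and closed: "\<And>\<theta>. \<theta> \<in> \<Theta> \<Longrightarrow> \<theta> + 2 \<in> spectrum i j \<Longrightarrow> \<theta> + 2 \<in> \<Theta>"
      "\<And>\<theta>. \<theta> \<in> \<Theta> \<Longrightarrow> \<theta> - 2 \<in> spectrum i j \<Longrightarrow> \<theta> - 2 \<in> \<Theta>"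
  shows "V.span (\<Union>\<theta>\<in>\<Theta>. E.eigenspace (tet_x i j) \<theta>) = UNIV"
proof -
  let ?V = "E.eigenspace (tet_x i j)"
  let ?W = "V.span (\<Union>\<theta>\<in>\<Theta>. ?V \<theta>)"
  have W: "V.subspace ?W" by simp
  have in_W: "x \<in> ?W" if "x \<in> ?V (\<theta> + c)" "\<theta> \<in> \<Theta>" "c \<in> {0, 2, - 2}" for x \<theta> c
  proof (cases "x = 0")
    case False
    with that(1) have "\<theta> + c \<in> spectrum i j" by (rule spectrumI)
    then have "\<theta> + c \<in> \<Theta>"
      using that(3) closed[OF that(2)] that(2) by (elim insertE emptyE) simp_all
    then show ?thesis using that(1) by (intro V.span_base) blast
  qed (use W V.subspace_0 in auto)
  have "act (tet_x k l) x \<in> ?W" if kl: "k \<noteq> l" and xW: "x \<in> ?W" for k l x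
    using xW
  proof (induction rule: V.span_induct)
    case base
    have "V.subspace {x. act (tet_x k l) x \<in> ?W}"
      by (rule V.subspaceI) (simp_all add: act.add act.scale act.zero V.span_zero V.span_add V.span_scale)
    then show ?case .
  next
    case (step x)
    then obtain \<theta> where \<theta>: "\<theta> \<in> \<Theta>" "x \<in> ?V \<theta>" by blast
    obtain y0 y1 y2 :: "'k tetrahedron" where y: "tet_x k l = y0 + y1 + y2" 
      "tet_bracket (tet_x i j) y0 = tet_scale 0 y0"
      "tet_bracket (tet_x i j) y1 = tet_scale 2 y1" "tet_bracket (tet_x i j) y2 = tet_scale (- 2) y2"
      by (rule tet_ad_decomposition[OF assms(1) kl])
    have "act y0 x \<in> ?W" "act y1 x \<in> ?W" "act y2 x \<in> ?W"
      using in_W[OF act_eigenspace[OF y(2) \<theta>(2)] \<theta>(1)] in_W[OF act_eigenspace[OF y(3) \<theta>(2)] \<theta>(1)]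
        in_W[OF act_eigenspace[OF y(4) \<theta>(2)] \<theta>(1)] by simp_all
    then show ?case unfolding y(1) by (simp add: act_left.add V.span_add)
  qed
  then have inv: "act \<xi> x \<in> ?W" if "x \<in> ?W" for \<xi> x
    by (rule act_subspace[OF W _ that])
  obtain v where v: "v \<in> ?V \<theta>" "v \<noteq> 0"
    by (rule spectrumE[OF assms(3)])
  then have "v \<in> ?W" using assms(2) by (intro V.span_base) auto
  then have "x \<in> ?W" for x
    using irreducible_subspace[OF irreducible W inv _ v(2)] by blast
  then show ?thesis by blast
qed

lemma spectrum_nonempty: "\<exists>\<theta>. \<theta> \<in> spectrum i j"
proof -
  obtain x :: 'v where "x \<noteq> 0" using irreducible by (auto simp: irreducible_action_def)
  then obtain \<theta> v where "v \<noteq> 0" "act (tet_x i j) v = scaleV \<theta> v"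
    using E.eigenvector_in_subspace[OF alg_closed_root finite_dim V.subspace_UNIV UNIV_I UNIV_I, of x "tet_x i j"] by metis
  then have "\<theta> \<in> spectrum i j" by (intro spectrumI[of v]) (simp_all add: E.eigenspace_def)
  then show ?thesis by blast
qed

lemma finite_arithmetic_progression:
  fixes c :: 'k
  assumes "finite S" "c \<noteq> 0"
  obtains n where "\<And>m. m < n \<Longrightarrow> \<theta> + of_nat m * c \<in> S" "\<theta> + of_nat n * c \<notin> S"
proof -
  have "inj (\<lambda>n. \<theta> + of_nat n * c)" using assms(2) by (auto simp: inj_on_def)
  then have "infinite (range (\<lambda>n. \<theta> + of_nat n * c))" using range_inj_infinite by blast
  then have ex: "\<exists>n. \<theta> + of_nat n * c \<notin> S" using assms(1) by (metis finite_subset image_subsetI)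
  show ?thesis
    by (rule that[of "LEAST n. \<theta> + of_nat n * c \<notin> S"]) (use LeastI_ex[OF ex] not_less_Least in auto)
qed

lemma spectrum_string:
  assumes "i \<noteq> j"
  obtains t m where "spectrum i j = {t - 2 * of_nat n | n. n \<le> m}" 
    "V.span (\<Union>\<theta>\<in>spectrum i j. E.eigenspace (tet_x i j) \<theta>) = UNIV"
proof -
  let ?S = "spectrum i j"
  have fin: "finite ?S" unfolding spectrum_def by (rule E.finite_eigenvalues[OF finite_dim])
  obtain \<theta> where \<theta>: "\<theta> \<in> ?S" using spectrum_nonempty by blast
  obtain p where p: "\<And>m. m < p \<Longrightarrow> \<theta> + of_nat m * 2 \<in> ?S" "\<theta> + of_nat p * 2 \<notin> ?S"
    by (rule finite_arithmetic_progression[OF fin, of 2]) auto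
  have "p \<noteq> 0" using p(2) \<theta> by (metis add.right_neutral mult_zero_left of_nat_0)
  \<comment> \<open>\<open>t\<close> is the top of the string through \<theta>: climbing in steps of
    2 leaves the spectrum for the first time at \<open>p\<close> steps. The string \<Theta> then
    descends from \<open>t\<close> until it first leaves the spectrum.\<close>
  define t where "t = \<theta> + of_nat (p - 1) * 2"
  have t: "t \<in> ?S" unfolding t_def using \<open>p \<noteq> 0\<close> by (intro p) simp
  have t2: "t + 2 \<notin> ?S" using p(2) \<open>p \<noteq> 0\<close> by (simp add: t_def of_nat_diff algebra_simps)
  obtain q where q: "\<And>m. m < q \<Longrightarrow> t + of_nat m * (- 2) \<in> ?S" "t + of_nat q * (- 2) \<notin> ?S"
    by (rule finite_arithmetic_progression[OF fin, of "- 2"]) auto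
  have "q \<noteq> 0" using q(2) t by (metis add.right_neutral mult_zero_left of_nat_0)
  define \<Theta> where "\<Theta> = {t - 2 * of_nat n | n. n < q}"
  have sub: "\<Theta> \<subseteq> ?S" using q(1) unfolding \<Theta>_def by (auto simp: mult.commute)
  have span: "V.span (\<Union>\<theta>\<in>\<Theta>. E.eigenspace (tet_x i j) \<theta>) = UNIV"
  proof (rule eigenspaces_span[OF assms _ t])
    show "t \<in> \<Theta>" unfolding \<Theta>_def using \<open>q \<noteq> 0\<close> by (auto intro!: exI[of _ 0])
    fix \<theta> assume "\<theta> \<in> \<Theta>"
    then obtain n where n: "\<theta> = t - 2 * of_nat n" "n < q" by (auto simp: \<Theta>_def)
    show "\<theta> + 2 \<in> \<Theta>" if "\<theta> + 2 \<in> ?S"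
    proof (cases n)
      case 0
      then show ?thesis using that t2 n by simp
    next
      case (Suc k)
      then show ?thesis unfolding \<Theta>_def using n by (auto intro!: exI[of _ k])
    qed
    show "\<theta> - 2 \<in> \<Theta>" if "\<theta> - 2 \<in> ?S"
    proof -
      have eq: "\<theta> - 2 = t + of_nat (Suc n) * (- 2)" by (simp add: n)
      then have "Suc n \<noteq> q" using q(2) that by metis
      then show ?thesis unfolding \<Theta>_def using n by (auto intro!: exI[of _ "Suc n"])
    qed
  qed
  have "?S = \<Theta>"
  proof (intro equalityI sub subsetI)
    fix \<theta> assume \<theta>: "\<theta> \<in> ?S"
    then obtain v where v: "v \<in> E.eigenspace (tet_x i j) \<theta>" "v \<noteq> 0"
      by (rule spectrumE)
    show "\<theta> \<in> \<Theta>"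
    proof (rule ccontr)
      assume "\<theta> \<notin> \<Theta>"
      then show False using E.eigenspace_Int_span[of v "tet_x i j" \<Theta> \<theta>] v span by simp
    qed
  qed
  moreover have "n < q \<longleftrightarrow> n \<le> q - 1" for n using \<open>q \<noteq> 0\<close> by auto
  then have "\<Theta> = {t - 2 * of_nat n | n. n \<le> q - 1}" by (simp add: \<Theta>_def)
  ultimately show ?thesis using that[of t "q - 1"] span by simp
qed

text \<open>With respect to the filtration by the weights of \<open>x i j\<close>, the element \<open>x j k\<close> is triangular
  with diagonal entries the negatives of these weights.\<close>

lemma spectrum_next:
  assumes "distinct [i, j, k]" "\<mu> \<in> spectrum j k"
  shows "- \<mu> \<in> spectrum i j"
proof -
  let ?V = "E.eigenspace (tet_x i j)"
  have ij: "i \<noteq> j" using assms by simp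
  obtain t m where S: "spectrum i j = {t - 2 * of_nat n | n. n \<le> m}"
    and span: "V.span (\<Union>\<theta>\<in>spectrum i j. ?V \<theta>) = UNIV"
    by (rule spectrum_string[OF ij])
  \<comment> \<open>\<open>G n\<close> is the sum of the weight spaces for the \<open>n\<close>
    highest weights.\<close>
  define G where "G n = V.span (\<Union>k\<in>{..<n}. ?V (t - 2 * of_nat k))" for n
  have G_sub: "V.subspace (G n)" for n by (simp add: G_def)
  have GI: "x \<in> G n" if "x \<in> ?V (t - 2 * of_nat k)" "k < n" for x k n
    unfolding G_def by (rule V.span_base) (use that in auto)
  have "(\<Union>\<theta>\<in>spectrum i j. ?V \<theta>) \<subseteq> (\<Union>k\<in>{..<Suc m}. ?V (t - 2 * of_nat k))"
    unfolding S by (auto simp: less_Suc_eq_le)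
  from V.span_mono[OF this] have G_UNIV: "G (Suc m) = UNIV" unfolding span G_def by blast
  have top: "x = 0" if "x \<in> ?V (t + 2)" for x
  proof (rule ccontr)
    assume "x \<noteq> 0"
    with that have "t + 2 \<in> spectrum i j" by (rule spectrumI)
    then obtain n where "t + 2 = t - 2 * of_nat n" unfolding S by blast
    then have "(2 * of_nat (Suc n) :: 'k) = 0" by (simp add: algebra_simps)
    then show False by (simp del: of_nat_Suc)
  qed
  \<comment> \<open>By the triangle relation \<open>?z\<close> raises weights by 2, so it maps
    \<open>G (Suc n)\<close> into \<open>G n\<close>, and \<open>x j k = ?z - x i j\<close> has
    diagonal part \<open>- x i j\<close>.\<close>
  let ?z = "tet_x i j + tet_x j k :: 'k tetrahedron"
  have z: "tet_bracket (tet_x i j) ?z = tet_scale 2 ?z"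
    using tet.y_triple[OF assms(1)] by (simp add: tet.scale_right_distrib)
  have step: "act (tet_x j k) x + scaleV (t - 2 * of_nat n) x \<in> G n" if "x \<in> G (Suc n)" for x n
    using that unfolding G_def[of "Suc n"]
  proof (induction rule: V.span_induct)
    case base
    have "V.subspace {x. act (tet_x j k) x + scaleV (t - 2 * of_nat n) x \<in> G n}"
    proof (rule V.subspaceI, goal_cases)
      case 1
      show ?case by (simp add: act.zero V.subspace_0 G_sub)
    next
      case (2 x y)
      then have "(act (tet_x j k) x + scaleV (t - 2 * of_nat n) x)
          + (act (tet_x j k) y + scaleV (t - 2 * of_nat n) y) \<in> G n"
        unfolding mem_Collect_eq by (rule V.subspace_add[OF G_sub])
      then show ?case by (simp add: act.add V.scale_right_distrib ac_simps)
    next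
      case (3 c x)
      then have "scaleV c (act (tet_x j k) x + scaleV (t - 2 * of_nat n) x) \<in> G n"
        unfolding mem_Collect_eq by (rule V.subspace_scale[OF G_sub])
      then show ?case by (simp add: act.scale V.scale_right_distrib mult.commute)
    qed
    then show ?case .
  next
    case (step x)
    then obtain k' where k': "k' \<le> n" "x \<in> ?V (t - 2 * of_nat k')" by (auto simp: less_Suc_eq_le)
    have zx: "act ?z x \<in> G n"
    proof (cases k')
      case 0
      have "act ?z x = 0" using act_eigenspace[OF z k'(2)] top 0 by simp
      then show ?thesis by (simp add: V.subspace_0 G_sub)
    next
      case (Suc p)
      have "act ?z x \<in> ?V (t - 2 * of_nat p)"
        using act_eigenspace[OF z k'(2)] Suc by (simp add: algebra_simps)
      then show ?thesis using k' Suc by (intro GI) auto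
    qed
    have diag: "scaleV (2 * of_nat k' - 2 * of_nat n) x \<in> G n"
      using k' by (cases "k' = n") (auto intro!: V.subspace_scale[OF G_sub] GI V.subspace_0[OF G_sub])
    have "act (tet_x j k) x + scaleV (t - 2 * of_nat n) x = act ?z x + scaleV (2 * of_nat k' - 2 * of_nat n) x"
    proof -
      have "act (tet_x i j) x = scaleV (t - 2 * of_nat k') x" using k'(2) by (simp add: E.eigenspace_def)
      then have "act (tet_x j k) x = act ?z x - scaleV (t - 2 * of_nat k') x" by (simp add: act_left.add)
      then show ?thesis by (simp add: V.scale_left_diff_distrib algebra_simps)
    qed
    then show ?case using V.subspace_add[OF G_sub zx diag] by simp
  qed
  obtain u where u: "u \<in> E.eigenspace (tet_x j k) \<mu>" "u \<noteq> 0"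
    by (rule spectrumE[OF assms(2)])
  \<comment> \<open>In the first filtration step that contains the eigenvector \<open>u\<close>, the
    two descriptions of \<open>x j k\<close> force a multiple of \<open>u\<close> one step lower;
    the scalar must vanish.\<close>
  define n where "n = (LEAST n. u \<in> G n)"
  have n: "u \<in> G n" "n \<le> Suc m"
    using LeastI[of "\<lambda>n. u \<in> G n" "Suc m"] Least_le[of "\<lambda>n. u \<in> G n" "Suc m"] G_UNIV by (auto simp: n_def)
  have "G 0 = {0}" by (simp add: G_def)
  with n(1) u(2) have "n \<noteq> 0" by (metis singletonD)
  then obtain p where p: "n = Suc p" by (cases n) auto
  have "u \<notin> G p" using not_less_Least[of p "\<lambda>n. u \<in> G n"] p by (simp add: n_def)
  have "scaleV (\<mu> + (t - 2 * of_nat p)) u \<in> G p"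
    using step[of u p] n(1) u(1) by (simp add: p E.eigenspace_def V.scale_left_distrib)
  then have "\<mu> + (t - 2 * of_nat p) = 0"
    using V.subspace_scale[OF G_sub, of "scaleV (\<mu> + (t - 2 * of_nat p)) u" p "inverse (\<mu> + (t - 2 * of_nat p))"] \<open>u \<notin> G p\<close>
    by (cases "\<mu> + (t - 2 * of_nat p) = 0") auto
  then have "- \<mu> = t - 2 * of_nat p" by (simp add: minus_unique)
  then show ?thesis unfolding S using n(2) p by auto
qed

text \<open>Going once around the triangle applies \<open>spectrum_next\<close> three times. The
  three sign changes amount to one, so each spectrum is closed under negation.\<close>

lemma spectrum_cyclic:
  assumes "distinct [i, j, k]"
  shows "\<theta> \<in> spectrum i j \<Longrightarrow> - \<theta> \<in> spectrum i j" "spectrum j k = spectrum i j"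
proof -
  have 1: "- \<theta> \<in> spectrum i j" if "distinct [i, j, k]" "\<theta> \<in> spectrum i j" for i j k \<theta>
  proof -
    have "- \<theta> \<in> spectrum k i" using that by (intro spectrum_next[of k i j]) auto
    then have "- (- \<theta>) \<in> spectrum j k" using that by (intro spectrum_next[of j k i]) auto
    then show ?thesis using that by (intro spectrum_next[of i j k]) auto
  qed
  show "\<theta> \<in> spectrum i j \<Longrightarrow> - \<theta> \<in> spectrum i j" by (rule 1[OF assms])
  have 2: "\<theta> \<in> spectrum i j" if "distinct [i, j, k]" "\<theta> \<in> spectrum j k" for i j k \<theta>
    using 1[OF that(1) spectrum_next[OF that]] by simp
  have "\<theta> \<in> spectrum j k" if "\<theta> \<in> spectrum i j" for \<theta>
    using assms that by (intro 2[of j k i] 2[of k i j]) auto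
  then show "spectrum j k = spectrum i j" using 2[OF assms] by blast
qed

lemma spectrum_flip: "i \<noteq> j \<Longrightarrow> \<theta> \<in> spectrum j i \<longleftrightarrow> - \<theta> \<in> spectrum i j"
proof -
  assume "i \<noteq> j"
  then have "tet_x j i = - (tet_x i j :: 'k tetrahedron)" by (rule tet.y_swap)
  then have "E.eigenspace (tet_x j i) \<theta> = E.eigenspace (tet_x i j) (- \<theta>)"
    by (auto simp: E.eigenspace_def act_left.neg minus_equation_iff)
  then show ?thesis by (simp add: spectrum_def)
qed

lemma exists_third: "\<exists>k::4. k \<noteq> i \<and> k \<noteq> j"
proof -
  have "card (UNIV :: 4 set) = 4" by simp
  then have "\<not> UNIV \<subseteq> {i, j}" using card_mono[of "{i, j}" "UNIV :: 4 set"] card_insert_le_m1[of 2 "{j}" i] by fastforce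
  then show ?thesis by blast
qed

lemma spectrum_eq:
  assumes "i \<noteq> j" "k \<noteq> l"
  shows "spectrum k l = spectrum i j"
proof -
  have flip: "spectrum b a = spectrum a b" if "a \<noteq> b" for a b
  proof -
    obtain c where "c \<noteq> a" "c \<noteq> b" using exists_third[of a b] by blast
    then have "distinct [a, b, c]" using that by auto
    from spectrum_cyclic(1)[OF this] spectrum_flip[OF that] show ?thesis
      by (metis (no_types, lifting) minus_minus subset_antisym subsetI)
  qed
  have next': "spectrum b c = spectrum a b" if "a \<noteq> b" "b \<noteq> c" for a b c
    using flip[OF that(1)] spectrum_cyclic(2)[of a b c] that by (cases "c = a") auto
  show ?thesis
  proof (cases "j = k")
    case True
    then show ?thesis using next' assms by metis
  next
    case False
    then have "spectrum k l = spectrum j k" "spectrum j k = spectrum i j"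
      using next' assms by metis+
    then show ?thesis by simp
  qed
qed

lemma spectrum_diameter:
  "\<exists>d. \<forall>i j. i \<noteq> j \<longrightarrow> spectrum i j = {of_int (int d - 2 * int n) | n. n \<le> d} \<and>
    V.span (\<Union>\<theta>. E.eigenspace (tet_x i j) \<theta>) = UNIV"
proof -
  obtain t m where S: "spectrum 1 2 = {t - 2 * of_nat n | n. n \<le> m}"
    by (rule spectrum_string[of 1 2]) auto
  have sym: "- \<theta> \<in> spectrum 1 2" if "\<theta> \<in> spectrum 1 2" for \<theta>
    by (rule spectrum_cyclic(1)[of _ _ 3]) (use that in auto)
  have "t \<in> spectrum 1 2" unfolding S by (auto intro!: exI[of _ 0])
  \<comment> \<open>Negating the two ends of the string \<open>t, t - 2, ..., t - 2 m\<close> gives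
    \<open>t = n\<close> with \<open>n \<le> m\<close>, and \<open>m + n' = n\<close>. Hence
    \<open>n = m\<close> and \<open>t = m\<close>.\<close>
  from sym[OF this] obtain n where n: "- t = t - 2 * of_nat n" "n \<le> m" unfolding S by blast
  have "t - 2 * of_nat m \<in> spectrum 1 2" unfolding S by blast
  from sym[OF this] obtain n' where n': "- (t - 2 * of_nat m) = t - 2 * of_nat n'" unfolding S by blast
  have "2 * t = 2 * of_nat n" using n(1) by (simp add: algebra_simps)
  then have t: "t = of_nat n" by simp
  have "2 * (of_nat (m + n') :: 'k) = 2 * of_nat n" using n' t by (simp add: algebra_simps)
  then have "m + n' = n" unfolding mult_cancel_left of_nat_eq_iff by simp
  then have "t = of_nat m" using n(2) t by simp
  then have *: "spectrum 1 2 = {of_int (int m - 2 * int n) | n. n \<le> m}" unfolding S by simp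
  show ?thesis
  proof (intro exI[of _ m] allI impI conjI)
    fix i j :: 4 assume ij: "i \<noteq> j"
    show "spectrum i j = {of_int (int m - 2 * int n) | n. n \<le> m}"
      using spectrum_eq[of 1 2 i j] ij * by simp
    from ij obtain t m where "V.span (\<Union>\<theta>\<in>spectrum i j. E.eigenspace (tet_x i j) \<theta>) = UNIV"
      by (rule spectrum_string)
    moreover have "(\<Union>\<theta>\<in>spectrum i j. E.eigenspace (tet_x i j) \<theta>) \<subseteq> (\<Union>\<theta>. E.eigenspace (tet_x i j) \<theta>)" by blast
    ultimately show "V.span (\<Union>\<theta>. E.eigenspace (tet_x i j) \<theta>) = UNIV"
      using V.span_mono by blast
  qed
qed

lemma tet_diameter_eq:
  assumes "\<And>i j. i \<noteq> j \<Longrightarrow> spectrum i j = {of_int (int d - 2 * int n) | n. n \<le> d}"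
    "\<And>i j. i \<noteq> j \<Longrightarrow> V.span (\<Union>\<theta>. E.eigenspace (tet_x i j) \<theta>) = UNIV"
  shows "tet_diameter scaleV act = d"
proof -
  have ev: "eigenvectors scaleV (act a) \<theta> = E.eigenspace a \<theta> - {0}" for a \<theta>
    by (auto simp: eigenvectors_def E.eigenspace_def)
  have spec: "eigenvalues scaleV (act (tet_x i j)) = spectrum i j" for i j
    using V.subspace_0[OF E.subspace_eigenspace[of "tet_x i j"]] unfolding eigenvalues_def ev spectrum_def by fast
  have "(\<Union>\<theta>. eigenvectors scaleV (act a) \<theta>) = (\<Union>\<theta>. E.eigenspace a \<theta>) - {0}" for a
    by (auto simp: ev)
  then have semi: "semisimple_map scaleV (act (tet_x i j))" if "i \<noteq> j" for i j
    using assms(2)[OF that] by (simp add: semisimple_map_def)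
  show ?thesis
    unfolding tet_diameter_def
  proof (rule the_equality)
    show "\<forall>i j. i \<noteq> j \<longrightarrow> semisimple_map scaleV (act (tet_x i j)) \<and>
        eigenvalues scaleV (act (tet_x i j)) = {of_int (int d - 2 * int n) |n. n \<le> d}"
      using assms(1) semi by (simp add: spec)
    fix d' assume "\<forall>i j. i \<noteq> j \<longrightarrow> semisimple_map scaleV (act (tet_x i j)) \<and>
        eigenvalues scaleV (act (tet_x i j)) = {of_int (int d' - 2 * int n) |n. n \<le> d'}"
    then have eq: "{of_int (int d' - 2 * int n) :: 'k | n. n \<le> d'} = {of_int (int d - 2 * int n) | n. n \<le> d}"
      using assms(1)[of 1 2] by (auto simp: spec)
    have le: "a \<le> b" if ab: "{of_int (int a - 2 * int n) :: 'k | n. n \<le> a} = {of_int (int b - 2 * int n) | n. n \<le> b}" for a b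
    proof -
      have "of_int (int a) \<in> {of_int (int a - 2 * int n) :: 'k | n. n \<le> a}" by (auto intro!: exI[of _ 0])
      then obtain n where "(of_int (int a) :: 'k) = of_int (int b - 2 * int n)" unfolding ab by blast
      then have "int a = int b - 2 * int n" unfolding of_int_eq_iff .
      then show ?thesis by simp
    qed
    show "d' = d" using le[OF eq] le[OF eq[symmetric]] by simp
  qed
qed

end

section \<open>The loop action on a tetrahedron module\<close>

lemma exhaust_index: "x = 0 \<or> x = 1 \<or> x = 2 \<or> x = 3" for x :: 4
proof (induct x)
  case (of_int z)
  then have "z = 0 \<or> z = 1 \<or> z = 2 \<or> z = 3" by fastforce
  then show ?case by auto
qed

context tet_module
begin

text \<open>Up to the factor \<open>- 1/2\<close>, \<open>ad (h 1 - h 0)\<close> multiplies by \<open>t - 1\<close> and \<open>ad [e 0, s]\<close> divides by it,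
  so \<open>ad (h 1 - h 0)\<close> maps the span of \<open>s\<close> and all \<open>f n\<close> injectively into the span of the \<open>f n\<close>.\<close>

lemma extra_in_span:
  assumes seq: "loop_sequences tet_scale tet_bracket e f g k l"
    and s: "tet_bracket (e 1 - e 0) s = g + g" "tet_bracket s (f 0) = 0" "tet_bracket s (f (- 1)) = 0"
      "tet_bracket g s = - s"
  shows "\<exists>\<xi>\<in>tet.span (range f). act \<xi> = act s"
proof -
  interpret loop_sequences tet_scale tet_bracket e f g k l by (rule seq)
  let ?scale = "\<lambda>c (g::'v \<Rightarrow> 'v) x. scaleV c (g x)"
  interpret fs: vector_space ?scale by (rule V.vector_space_fun)
  obtain G where G: "finite G" "\<And>g. Vector_Spaces.linear scaleV scaleV g \<Longrightarrow> g \<in> fs.span G"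
    using V.linear_maps_in_finite_span[OF finite_dim] by blast
  \<comment> \<open>The adjoint action is transported from the algebra to maps on \<open>V\<close>,
    where the linear maps lie in a finite span and the dimension count applies.\<close>
  define ad where "ad a g = (\<lambda>x. scaleV (- 1 / 2) (act a (g x) - g (act a x)))" for a and g :: "'v \<Rightarrow> 'v"
  have ad: "ad a (act b) = act (tet_scale (- 1 / 2) (tet_bracket a b))" for a b
    by (simp add: ad_def act_left.scale act_left.neg act_bracket fun_eq_iff)
  have linear_ad: "Vector_Spaces.linear ?scale ?scale (ad a)" for a
    by unfold_locales (simp_all add: ad_def fun_eq_iff act.add act.scale V.scale_right_distrib
        V.scale_right_diff_distrib mult.commute)
  have half: "tet_scale (- 1 / 2) (- x - x) = x" for x :: "'k tetrahedron"
    using tet.halves[of x] by (simp add: tet.scale_right_diff_distrib)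
  have inv: "tet_bracket (tet_bracket (e 0) s) (f n) = tet_bracket (h n) s" for n
    by (rule extra_e0_s[OF s(1-3)])
  have Df: "ad (h 1 - h 0) (act (f n)) = act (f (n + 1)) - act (f n)" for n
  proof -
    have "tet_bracket (h 1 - h 0) (f n) = - (f (n + 1) - f n) - (f (n + 1) - f n)"
      by (simp add: hf add.commute)
    then show ?thesis unfolding ad by (simp only: half) (auto simp: act_left.diff)
  qed
  have Ds: "ad (h 1 - h 0) (act s) = act (f 0)"
    using extra_h_difference[OF s(1-3) s(2)] unfolding ad by (simp only: half add_0)
  have Kf: "ad (tet_bracket (e 0) s) (act (f (n + 1)) - act (f n)) = act (f n)" for n
  proof -
    have "act (f (n + 1)) - act (f n) = act (f (n + 1) - f n)" by (auto simp: act_left.diff)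
    then show ?thesis
      using extra_inverse[OF s(1-3), of n] by (simp only: ad half)
  qed
  have "tet_bracket (h 0) s = - s - s" by (simp add: h_0 s(4))
  then have Ks: "ad (tet_bracket (e 0) s) (act (f 0)) = act s"
    unfolding ad inv by (simp only: half)
  have f_span: "act (f n) \<in> fs.span (range (\<lambda>n. act (f n)))" for n
    by (rule fs.span_base) (rule rangeI)
  have "act s \<in> fs.span (range (\<lambda>n. act (f n)))"
  proof (rule fs.in_span_of_injective[OF G(1) _ linear_ad _ linear_ad])
    show "range (\<lambda>n. act (f n)) \<subseteq> fs.span G" using G(2) linear_act by blast
    show "ad (h 1 - h 0) ` insert (act s) (range (\<lambda>n. act (f n))) \<subseteq> fs.span (range (\<lambda>n. act (f n)))"
    proof (rule image_subsetI)
      fix x assume "x \<in> insert (act s) (range (\<lambda>n. act (f n)))"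
      then consider "x = act s" | n where "x = act (f n)" by blast
      then show "ad (h 1 - h 0) x \<in> fs.span (range (\<lambda>n. act (f n)))"
      proof cases
        case 1
        show ?thesis unfolding 1 Ds by (rule f_span)
      next
        case 2
        show ?thesis unfolding 2 Df by (rule fs.span_diff[OF f_span f_span])
      qed
    qed
    show "ad (tet_bracket (e 0) s) (ad (h 1 - h 0) x) = x" if "x \<in> insert (act s) (range (\<lambda>n. act (f n)))" for x
      using that by (auto simp: Df Ds Kf Ks)
  qed
  then show ?thesis
  proof (induction rule: fs.span_induct)
    case base
    have "fs.subspace {y. \<exists>\<xi>\<in>tet.span (range f). act \<xi> = y}"
    proof (rule fs.subspaceI, goal_cases)
      case 1
      have "act 0 = 0" by (auto simp: act_left.zero)
      then show ?case using tet.span_zero by blast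
    next
      case (2 x y)
      then obtain a b where "a \<in> tet.span (range f)" "b \<in> tet.span (range f)" "x = act a" "y = act b" by blast
      moreover have "act (a + b) = act a + act b" by (auto simp: act_left.add)
      ultimately show ?case using tet.span_add[of a _ b] by blast
    next
      case (3 c x)
      then obtain a where "a \<in> tet.span (range f)" "x = act a" by blast
      moreover have "act (tet_scale c a) = ?scale c (act a)" by (auto simp: act_left.scale)
      ultimately show ?case using tet.span_scale[of a _ c] by blast
    qed
    then show ?case .
  next
    case (step y)
    then obtain n where "y = act (f n)" by blast
    then show ?case using tet.span_base[of "f n" "range f"] by blast
  qed
qed

lemma loop_module_exists:
  obtains e f h where "loop_module tet_scale tet_bracket scaleV act e f h (tet_diameter scaleV act)"
proof -
  obtain e f :: "int \<Rightarrow> 'k tetrahedron" and g k l s where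
    seq: "loop_sequences tet_scale tet_bracket e f g k l"
    and x: "tet_x 1 2 = g + g" "tet_x 2 3 = e 0 + e 0 - (g + g)" "tet_x 2 0 = e 1 + e 1 - (g + g)"
    "tet_x 3 1 = - (g + g) - (f 0 + f 0)" "tet_x 0 1 = - (g + g) - (f (- 1) + f (- 1))"
    "tet_x 3 0 = s + s + (tet_bracket (e 0) s + tet_bracket (e 0) s) + tet_bracket (e 0) (tet_bracket (e 0) s)
      + (g + g) - (e 0 + e 0)"
    and s: "tet_bracket (e 1 - e 0) s = g + g" "tet_bracket s (f 0) = 0" "tet_bracket s (f (- 1)) = 0"
      "tet_bracket g s = - s"
    by (rule tet.loop_presentation)
  interpret loop_sequences tet_scale tet_bracket e f g k l by (rule seq)
  obtain \<sigma> where \<sigma>: "\<sigma> \<in> tet.span (range f)" "act \<sigma> = act s"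
    using extra_in_span[OF seq s] by blast
  from spectrum_diameter obtain d where
    "\<forall>i j. i \<noteq> j \<longrightarrow> spectrum i j = {of_int (int d - 2 * int n) | n. n \<le> d} \<and>
      V.span (\<Union>\<theta>. E.eigenspace (tet_x i j) \<theta>) = UNIV" ..
  then have d: "\<And>i j. i \<noteq> j \<Longrightarrow> spectrum i j = {of_int (int d - 2 * int n) | n. n \<le> d}"
    "\<And>i j. i \<noteq> j \<Longrightarrow> V.span (\<Union>\<theta>. E.eigenspace (tet_x i j) \<theta>) = UNIV"
    by simp_all
  have diam: "tet_diameter scaleV act = d" by (rule tet_diameter_eq[OF d])
  have h0: "h 0 = tet_x 1 2" by (simp add: h_0 x)
  have "loop_module tet_scale tet_bracket scaleV act e f h d"
  proof (unfold_locales, goal_cases)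
    case (1 m n)
    show ?case by (rule ee)
  next
    case (2 m n)
    show ?case by (rule ff)
  next
    case (3 m n)
    show ?case by (rule hh)
  next
    case (4 m n)
    show ?case by (rule ef)
  next
    case (5 m n)
    show ?case by (simp add: he tet.scale_2)
  next
    case (6 m n)
    show ?case by (simp add: hf tet.scale_2)
  next
    case (7 P \<xi>)
    note add = 7(3) and scale = 7(4) and bracket = 7(5) and cong = 7(6)
    have neg: "P (- a)" if "P a" for a using scale[OF that, of "- 1"] by simp
    have diff: "P (a - b)" if "P a" "P b" for a b using add[OF that(1) neg[OF that(2)]] by simp
    \<comment> \<open>\<open>g\<close> is recovered from the loop generators as half of
      \<open>[e 0, f 0]\<close>.\<close>
    have "P (tet_scale (1/2) (tet_bracket (e 0) (f 0)))"
      by (intro scale bracket 7)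
    moreover have "tet_scale (1/2) (tet_bracket (e 0) (f 0)) = g"
      using tet.halves[of g] by (simp add: ef h_0 tet.scale_right_distrib)
    ultimately have g: "P g" by simp
    have "P \<sigma>"
      using \<sigma>(1)
    proof (induction rule: tet.span_induct)
      case base
      have "P 0" using scale[OF g, of 0] by simp
      then have "tet.subspace {a. P a}"
        by (intro tet.subspaceI) (simp_all add: add scale)
      then show ?case .
    next
      case (step a)
      then show ?case using 7(2) by blast
    qed
    \<comment> \<open>Here closure under equal actions is used: \<open>s\<close> is replaced by
      \<sigma>, which lies in the span of the \<open>f n\<close>.\<close>
    then have s: "P s" using cong \<sigma>(2) by blast
    have base: "P (tet_x 1 2)" "P (tet_x 2 3)" "P (tet_x 2 0)" "P (tet_x 3 1)" "P (tet_x 0 1)" "P (tet_x 3 0)"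
      unfolding x by (intro add diff neg bracket g s 7(1,2))+
    have flip: "P (tet_x j i)" if "P (tet_x i j)" "i \<noteq> j" for i j
    proof -
      have "tet_x j i = - (tet_x i j :: 'k tetrahedron)" by (rule tet.y_swap[OF that(2)])
      then show ?thesis using neg[OF that(1)] by simp
    qed
    have "P (tet_x i j)" if "i \<noteq> j" for i j
      using exhaust_index[of i] exhaust_index[of j] that base base[THEN flip] by auto
    then show ?case using add scale bracket by (rule tetrahedron_induct)
  next
    case 8
    show ?case by (rule irreducible)
  next
    case 9
    show ?case by (rule finite_dim)
  next
    case 10
    show ?case using d(2)[of 1 2] by (simp add: h0 E.eigenspace_def)
  next
    case (11 \<theta>)
    have "(\<exists>x. x \<noteq> 0 \<and> act (h 0) x = scaleV \<theta> x) \<longleftrightarrow> \<theta> \<in> spectrum 1 2"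
    proof
      assume "\<theta> \<in> spectrum 1 2"
      then obtain x where "x \<in> E.eigenspace (tet_x 1 2) \<theta>" "x \<noteq> 0" by (rule spectrumE)
      then show "\<exists>x. x \<noteq> 0 \<and> act (h 0) x = scaleV \<theta> x" by (auto simp: h0 E.eigenspace_def)
    qed (auto simp: h0 E.eigenspace_def intro: spectrumI)
    then show ?case using d(1)[of 1 2] by auto
  qed
  then show ?thesis using that diam by metis
qed

end

theorem theorem18p1:
  fixes scale :: "'k::{alg_closed_field, field_char_0} \<Rightarrow> 'v::ab_group_add \<Rightarrow> 'v"
    and act :: "'k tetrahedron \<Rightarrow> 'v \<Rightarrow> 'v"
  assumes "lie_module tet_scale tet_bracket scale act"
    and "finite_dimensional scale"
    and "irreducible_action scale act"
  shows "\<exists>f. nonzero_invariant_form scale act f \<and>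
           (\<forall>g. nonzero_invariant_form scale act g \<longrightarrow> (\<exists>c. c \<noteq> 0 \<and> (\<forall>u v. g u v = c * f u v))) \<and>
           nondegenerate f \<and>
           (even (tet_diameter scale act) \<longrightarrow> (\<forall>u v. f u v = f v u)) \<and>
           (odd (tet_diameter scale act) \<longrightarrow> (\<forall>u v. f u v = - f v u))"
proof -
  have "tet_module scale act"
    using assms by (simp add: tet_module_def tet_module_axioms_def)
  then obtain e f h where "loop_module tet_scale tet_bracket scale act e f h (tet_diameter scale act)"
    by (rule tet_module.loop_module_exists)
  then obtain B where B: "nonzero_invariant_form scale act B"
    "\<forall>g. nonzero_invariant_form scale act g \<longrightarrow> (\<exists>c. c \<noteq> 0 \<and> (\<forall>u v. g u v = c * B u v))"
    "nondegenerate B" "\<forall>u v. B u v = (- 1) ^ tet_diameter scale act * B v u"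
    using loop_module.invariant_forms by blast
  have "B u v = B v u" if "even (tet_diameter scale act)" for u v
    using that B(4)[rule_format, of u v] by simp
  moreover have "B u v = - B v u" if "odd (tet_diameter scale act)" for u v
    using that B(4)[rule_format, of u v] by simp
  ultimately show ?thesis using B(1-3) by (intro exI[of _ B]) blast
qed

end
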